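(* Assume $\mathsf{MA}(\sigma\text{-centered})$. Then there exists a countable dense homogeneous subspace $X$ of $2^\omega$ whose complement $2^\omega\setminus X$ is dense in $2^\omega$ and rigid.
   Context: $2^\omega$ is the Cantor set with the product topology. For a space $Z$, $\mathcal{H}(Z)$ denotes the group of homeomorphisms of $Z$ onto itself. A (separable metrizable) space $Z$ is countable dense homogeneous if for every pair $(A,B)$ of countable dense subsets of $Z$ there exists $h\in\mathcal{H}(Z)$ such that $h[A]=B$. A space $Z$ is rigid if $\mathcal{H}(Z)=\{\mathrm{id}\}$. Subsets of $2^\omega$ carry the subspace topology. $\mathsf{MA}(\sigma\text{-centered})$ is Martin's Axiom for $\sigma$-centered posets: for every non-empty $\sigma$-centered poset $\mathbb{P}$ and every collection of fewer than $\mathfrak{c}=2^{\aleph_0}$ dense subsets of $\mathbb{P}$ there is a filter on $\mathbb{P}$ meeting every member of the collection; a poset is $\sigma$-centered if it is a union of countably many subsets, each of which is centered (every finite subset of it has a common lower bound in $\mathbb{P}$). *)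

theory Defs
  imports "HOL-Analysis.Analysis"
begin

section \<open>Topology\<close>

definition cantor_space :: "(nat \<Rightarrow> bool) topology"
  where "cantor_space = product_topology (\<lambda>n. discrete_topology UNIV) UNIV"

definition dense_in_space :: "'a topology \<Rightarrow> 'a set \<Rightarrow> bool"
  where "dense_in_space Z A \<longleftrightarrow> A \<subseteq> topspace Z \<and> Z closure_of A = topspace Z"

definition countable_dense_homogeneous :: "'a topology \<Rightarrow> bool"
  where "countable_dense_homogeneous Z \<longleftrightarrow>
    separable_space Z \<and> metrizable_space Z \<and>
    (\<forall>A B. countable A \<and> dense_in_space Z A \<and> countable B \<and> dense_in_space Z B \<longrightarrow>
      (\<exists>h. homeomorphic_map Z Z h \<and> h ` A = B))"

text \<open>Maps are total functions on the ambient type, so a self-homeomorphism of \<^term>\<open>Z\<close> is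
  determined only by its values on \<^term>\<open>topspace Z\<close>.\<close>

definition rigid_space :: "'a topology \<Rightarrow> bool"
  where "rigid_space Z \<longleftrightarrow>
    (\<forall>h. homeomorphic_map Z Z h \<longrightarrow> (\<forall>x\<in>topspace Z. h x = x))"

lemma cantor_space_euclidean: "cantor_space = euclidean"
proof -
  have "(euclidean :: bool topology) = discrete_topology UNIV"
    by (simp add: topology_eq open_discrete)
  then show ?thesis
    by (simp add: cantor_space_def flip: euclidean_product_topology)
qed

lemma topspace_cantor_space [simp]: "topspace cantor_space = UNIV"
  by (simp add: cantor_space_euclidean)


section \<open>Martin's Axiom for sigma-centered posets\<close>

text \<open>A poset is a carrier \<^term>\<open>P\<close> with a relation \<^term>\<open>r\<close> where \<^term>\<open>(q, p) \<in> r\<close> means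
  \<^term>\<open>q \<le> p\<close>.\<close>

definition dense_subset_of_poset :: "'a set \<Rightarrow> 'a rel \<Rightarrow> 'a set \<Rightarrow> bool"
  where "dense_subset_of_poset P r D \<longleftrightarrow> D \<subseteq> P \<and> (\<forall>p\<in>P. \<exists>d\<in>D. (d, p) \<in> r)"

definition centered_subset :: "'a set \<Rightarrow> 'a rel \<Rightarrow> 'a set \<Rightarrow> bool"
  where "centered_subset P r C \<longleftrightarrow>
    C \<subseteq> P \<and> (\<forall>F. finite F \<and> F \<subseteq> C \<longrightarrow> (\<exists>q\<in>P. \<forall>p\<in>F. (q, p) \<in> r))"

definition sigma_centered :: "'a set \<Rightarrow> 'a rel \<Rightarrow> bool"
  where "sigma_centered P r \<longleftrightarrow>
    (\<exists>C :: nat \<Rightarrow> 'a set. P = (\<Union>n. C n) \<and> (\<forall>n. centered_subset P r (C n)))"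

definition filter_on_poset :: "'a set \<Rightarrow> 'a rel \<Rightarrow> 'a set \<Rightarrow> bool"
  where "filter_on_poset P r G \<longleftrightarrow>
    G \<subseteq> P \<and> G \<noteq> {} \<and>
    (\<forall>p\<in>G. \<forall>q\<in>P. (p, q) \<in> r \<longrightarrow> q \<in> G) \<and>
    (\<forall>p\<in>G. \<forall>q\<in>G. \<exists>s\<in>G. (s, p) \<in> r \<and> (s, q) \<in> r)"

definition has_generic_filters :: "'a set \<Rightarrow> 'a rel \<Rightarrow> bool"
  where "has_generic_filters P r \<longleftrightarrow>
    (\<forall>\<D>. \<D> \<prec> (UNIV :: nat set set) \<and> (\<forall>D\<in>\<D>. dense_subset_of_poset P r D) \<longrightarrow>
      (\<exists>G. filter_on_poset P r G \<and> (\<forall>D\<in>\<D>. G \<inter> D \<noteq> {})))"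

text \<open>A formula cannot quantify over types, so the posets below have their carrier in a fixed type
  of cardinality continuum.  This loses nothing: by the theorem
  \<open>MA_sigma_centered_any_type\<close> below, the axiom in this form implies the same
  statement for the posets on an arbitrary type.\<close>

definition MA_sigma_centered :: bool
  where "MA_sigma_centered \<longleftrightarrow>
    (\<forall>(P :: nat set set) r. P \<noteq> {} \<and> partial_order_on P r \<and> sigma_centered P r \<longrightarrow>
      has_generic_filters P r)"

text \<open>For the passage to arbitrary types, a poset is cut down to a subposet with at most continuum
  many elements that is closed under a choice of lower bounds and of elements of the dense
  sets.\<close>

lemma lepoll_fun_nat_set: "(UNIV :: (nat \<Rightarrow> nat set) set) \<lesssim> (UNIV :: nat set set)"
proof -
  have "inj (\<lambda>f :: nat \<Rightarrow> nat set. {prod_encode (i, j) |i j. j \<in> f i})"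
  proof (rule injI)
    fix f g :: "nat \<Rightarrow> nat set"
    assume "{prod_encode (i, j) |i j. j \<in> f i} = {prod_encode (i, j) |i j. j \<in> g i}"
    then have "prod_encode (i, j) \<in> {prod_encode (i, j) |i j. j \<in> f i} \<longleftrightarrow>
        prod_encode (i, j) \<in> {prod_encode (i, j) |i j. j \<in> g i}" for i j
      by simp
    then have "j \<in> f i \<longleftrightarrow> j \<in> g i" for i j
      by (simp add: prod_encode_eq)
    then show "f = g" by blast
  qed
  then show ?thesis unfolding lepoll_def by blast
qed

lemma lepoll_nat_set_closure:
  fixes b :: "nat \<Rightarrow> 'a set \<Rightarrow> 'a" and f :: "'b \<Rightarrow> 'a \<Rightarrow> 'a"
  assumes \<D>: "\<D> \<lesssim> (UNIV :: nat set set)"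
  obtains Q where "p0 \<in> Q" "Q \<lesssim> (UNIV :: nat set set)"
    "\<And>D p. \<lbrakk>D \<in> \<D>; p \<in> Q\<rbrakk> \<Longrightarrow> f D p \<in> Q"
    "\<And>n F. \<lbrakk>finite F; F \<subseteq> Q\<rbrakk> \<Longrightarrow> b n F \<in> Q"
    "\<And>R. \<lbrakk>p0 \<in> R; \<And>D p. \<lbrakk>D \<in> \<D>; p \<in> R\<rbrakk> \<Longrightarrow> f D p \<in> R;
       \<And>n F. \<lbrakk>finite F; F \<subseteq> R\<rbrakk> \<Longrightarrow> b n F \<in> R\<rbrakk> \<Longrightarrow> Q \<subseteq> R"
proof -
  define step where "step A =
    A \<union> (\<lambda>(D, p). f D p) ` (\<D> \<times> A) \<union> (\<lambda>(n, F). b n F) ` (UNIV \<times> {F. finite F \<and> F \<subseteq> A})" for A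
  define Q where "Q n = (step ^^ n) {p0}" for n
  have Q0: "Q 0 = {p0}" and QS: "Q (Suc n) = step (Q n)" for n
    by (simp_all add: Q_def)
  have inc: "Q n \<subseteq> Q (Suc n)" for n
    by (auto simp: QS step_def)
  have mono: "Q m \<subseteq> Q n" if "m \<le> n" for m n
    using lift_Suc_mono_le[of Q, OF inc that] .
  have p0: "p0 \<in> Q n" for n using mono[of 0 n] Q0 by auto
  obtain d where d: "\<D> \<subseteq> d ` (UNIV :: nat set set)"
    using \<D> unfolding lepoll_iff by blast
  have sum_fun: "A \<lesssim> (UNIV :: nat set set)" if "A \<subseteq> e ` (UNIV :: (nat \<Rightarrow> nat set) set)" for A :: "'a set" and e
    using lepoll_trans[OF subset_image_lepoll[OF that] lepoll_fun_nat_set] .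
  have small: "Q n \<lesssim> (UNIV :: nat set set)" for n
  proof (induction n)
    case 0
    show ?case by (simp add: Q0 finite_lepoll_infinite Finite_Set.finite_set)
  next
    case (Suc n)
    then obtain t where t: "Q n \<subseteq> t ` (UNIV :: nat set set)"
      unfolding lepoll_iff by blast
    define e where "e h =
      (if h 0 = {} then t (h 1)
       else if h 0 = {0} then f (d (h 1)) (t (h 2))
       else b (Min (h 1)) ((\<lambda>i. t (h (i + 3))) ` {..<Min (h 2)}))" for h :: "nat \<Rightarrow> nat set"
    have "x \<in> range e" if x: "x \<in> Q (Suc n)" for x
    proof -
      consider "x \<in> Q n" | D p where "D \<in> \<D>" "p \<in> Q n" "x = f D p"
        | k F where "finite F" "F \<subseteq> Q n" "x = b k F"
        using x unfolding QS step_def by auto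
      then show ?thesis
      proof cases
        case 1
        then obtain u where "x = t u" using t by auto
        then have "x = e ((\<lambda>_. {})(1 := u))" by (simp add: e_def)
        then show ?thesis by blast
      next
        case 2
        then obtain u v where "D = d u" "p = t v" using t d by blast
        then have "x = e ((\<lambda>_. {0})(1 := u, 2 := v))" using 2 by (simp add: e_def)
        then show ?thesis by blast
      next
        case 3
        obtain l m where l: "F = l ` {..<m::nat}"
          using finite_imp_nat_seg_image_inj_on[OF 3(1)] by (auto simp: lessThan_def)
        have "\<forall>i<m. \<exists>u. l i = t u" using 3(2) t l by blast
        then obtain w where w: "\<And>i. i < m \<Longrightarrow> l i = t (w i)" by metis
        define h where "h i = (if i = 0 then {1} else if i = 1 then {k}
            else if i = 2 then {m} else w (i - 3))" for i :: nat
        have "h 0 = {1}" "h 1 = {k}" "h 2 = {m}" "\<And>i. h (i + 3) = w i"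
          by (auto simp: h_def)
        then have "e h = b k ((\<lambda>i. t (w i)) ` {..<m})" by (simp add: e_def)
        also have "(\<lambda>i. t (w i)) ` {..<m} = F" unfolding l by (rule image_cong) (auto simp: w)
        finally show ?thesis using 3(3) by (metis rangeI)
      qed
    qed
    then show ?case by (intro sum_fun[of _ e]) blast
  qed
  define R where "R = (\<Union>n. Q n)"
  have "\<exists>t. \<forall>n. Q n \<subseteq> t n ` (UNIV :: nat set set)"
    using small unfolding lepoll_iff by (rule choice[OF allI])
  then obtain t where t: "\<And>n. Q n \<subseteq> t n ` (UNIV :: nat set set)" by blast
  have "x \<in> range (\<lambda>h :: nat \<Rightarrow> nat set. t (Min (h 0)) (h 1))" if x: "x \<in> R" for x
  proof -
    obtain n u where "x = t n u" using x t unfolding R_def by blast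
    then have "x = (\<lambda>h :: nat \<Rightarrow> nat set. t (Min (h 0)) (h 1)) ((\<lambda>_. u)(0 := {n}))" by simp
    then show ?thesis by blast
  qed
  then have "R \<lesssim> (UNIV :: nat set set)" by (intro sum_fun) blast
  moreover have "f D p \<in> R" if "D \<in> \<D>" "p \<in> R" for D p
  proof -
    obtain n where "p \<in> Q n" using \<open>p \<in> R\<close> unfolding R_def by blast
    then have "f D p \<in> Q (Suc n)" using \<open>D \<in> \<D>\<close> by (auto simp: QS step_def)
    then show ?thesis unfolding R_def by blast
  qed
  moreover have "b k F \<in> R" if "finite F" "F \<subseteq> R" for k F
  proof -
    have "\<exists>n. F \<subseteq> Q n"
      using that
    proof (induction F)
      case (insert x F)
      then obtain n m where "F \<subseteq> Q n" "x \<in> Q m" unfolding R_def by auto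
      then have "insert x F \<subseteq> Q (max n m)"
        using mono[of n "max n m"] mono[of m "max n m"] by auto
      then show ?case by blast
    qed auto
    then obtain n where "F \<subseteq> Q n" by blast
    then have "b k F \<in> Q (Suc n)" using \<open>finite F\<close> by (auto simp: QS step_def)
    then show ?thesis unfolding R_def by blast
  qed
  moreover have "R \<subseteq> S"
    if S: "p0 \<in> S" "\<And>D p. \<lbrakk>D \<in> \<D>; p \<in> S\<rbrakk> \<Longrightarrow> f D p \<in> S"
      "\<And>n F. \<lbrakk>finite F; F \<subseteq> S\<rbrakk> \<Longrightarrow> b n F \<in> S" for S
  proof -
    have "Q n \<subseteq> S" for n
    proof (induction n)
      case (Suc n)
      have "f D p \<in> S" if "D \<in> \<D>" "p \<in> Q n" for D p
        using S(2) Suc.IH that by auto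
      moreover have "b k F \<in> S" if "finite F" "F \<subseteq> Q n" for k F
        using S(3) Suc.IH that by auto
      ultimately show ?case
        using Suc.IH unfolding QS step_def by auto
    qed (simp add: Q0 S)
    then show ?thesis unfolding R_def by blast
  qed
  moreover have "p0 \<in> R" using p0 unfolding R_def by blast
  ultimately show ?thesis using that[of R] by blast
qed

lemma map_prod_image_iff:
  assumes "inj_on j Q" "r \<subseteq> Q \<times> Q" "x \<in> Q" "y \<in> Q"
  shows "(j x, j y) \<in> map_prod j j ` r \<longleftrightarrow> (x, y) \<in> r"
proof
  assume "(j x, j y) \<in> map_prod j j ` r"
  then obtain u v where uv: "(u, v) \<in> r" "j x = j u" "j y = j v" by auto
  then have "u \<in> Q" "v \<in> Q" using assms(2) by auto
  then have "x = u" "y = v" using uv inj_onD[OF assms(1)] assms(3,4) by metis+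
  then show "(x, y) \<in> r" using uv by simp
qed force

lemma has_generic_filters_inj_image:
  fixes j :: "'a \<Rightarrow> 'b" and r :: "'a rel"
  assumes j: "inj_on j Q" and r: "r \<subseteq> Q \<times> Q"
    and gen: "has_generic_filters (j ` Q) (map_prod j j ` r)"
  shows "has_generic_filters Q r"
proof -
  have jr: "(j x, j y) \<in> map_prod j j ` r \<longleftrightarrow> (x, y) \<in> r" if "x \<in> Q" "y \<in> Q" for x y
    by (rule map_prod_image_iff[OF j r that])
  show ?thesis
    unfolding has_generic_filters_def
  proof (intro allI impI, elim conjE)
    fix \<D> :: "'a set set"
    assume c: "\<D> \<prec> (UNIV :: nat set set)" and D: "\<forall>D\<in>\<D>. dense_subset_of_poset Q r D"
    have "(`) j ` \<D> \<prec> (UNIV :: nat set set)"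
      using lesspoll_trans1[OF image_lepoll c] .
    moreover have "\<forall>E\<in>(`) j ` \<D>. dense_subset_of_poset (j ` Q) (map_prod j j ` r) E"
    proof
      fix E assume "E \<in> (`) j ` \<D>"
      then obtain D where "D \<in> \<D>" and E: "E = j ` D" by blast
      then have DQ: "D \<subseteq> Q" and dn: "\<And>p. p \<in> Q \<Longrightarrow> \<exists>d\<in>D. (d, p) \<in> r"
        using D unfolding dense_subset_of_poset_def by auto
      show "dense_subset_of_poset (j ` Q) (map_prod j j ` r) E"
        unfolding dense_subset_of_poset_def E
      proof (intro conjI ballI)
        show "j ` D \<subseteq> j ` Q" using DQ by blast
        fix p assume "p \<in> j ` Q"
        then obtain x where x: "x \<in> Q" "p = j x" by blast
        then obtain y where "y \<in> D" "(y, x) \<in> r" using dn by blast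
        then show "\<exists>d\<in>j ` D. (d, p) \<in> map_prod j j ` r" using x jr DQ by blast
      qed
    qed
    ultimately obtain G where G: "filter_on_poset (j ` Q) (map_prod j j ` r) G"
      and meet: "\<forall>E\<in>(`) j ` \<D>. G \<inter> E \<noteq> {}"
      using gen[unfolded has_generic_filters_def, rule_format, of "(`) j ` \<D>"] by auto
    define H where "H = {x \<in> Q. j x \<in> G}"
    have GH: "G = j ` H" using G unfolding filter_on_poset_def H_def by blast
    have up: "q \<in> G" if "p \<in> G" "q \<in> j ` Q" "(p, q) \<in> map_prod j j ` r" for p q
      using G that unfolding filter_on_poset_def by (elim conjE) metis
    have dir: "\<exists>s\<in>G. (s, p) \<in> map_prod j j ` r \<and> (s, q) \<in> map_prod j j ` r"
      if "p \<in> G" "q \<in> G" for p q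
      using G that unfolding filter_on_poset_def by (elim conjE) metis
    have HQ: "H \<subseteq> Q" by (auto simp: H_def)
    have "filter_on_poset Q r H"
      unfolding filter_on_poset_def
    proof (intro conjI ballI impI)
      show "H \<noteq> {}" using G GH by (auto simp: filter_on_poset_def)
      show "q \<in> H" if "p \<in> H" "q \<in> Q" "(p, q) \<in> r" for p q
        using up[of "j p" "j q"] that jr[of p q] by (auto simp: H_def)
      show "\<exists>s\<in>H. (s, p) \<in> r \<and> (s, q) \<in> r" if pq: "p \<in> H" "q \<in> H" for p q
      proof -
        have "j p \<in> G" "j q \<in> G" using pq by (simp_all add: H_def)
        then obtain t where t: "t \<in> G" "(t, j p) \<in> map_prod j j ` r" "(t, j q) \<in> map_prod j j ` r"
          using dir by metis
        then obtain s where s: "s \<in> H" "t = j s" using GH by (metis imageE)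
        have "p \<in> Q" "q \<in> Q" "s \<in> Q" using pq s(1) by (simp_all add: H_def)
        then have "(s, p) \<in> r" "(s, q) \<in> r" using t(2,3) jr s(2) by metis+
        then show ?thesis using s(1) by metis
      qed
    qed (use HQ in auto)
    moreover have "H \<inter> D \<noteq> {}" if "D \<in> \<D>" for D
    proof -
      have DQ: "D \<subseteq> Q" using D that unfolding dense_subset_of_poset_def by blast
      have "G \<inter> j ` D \<noteq> {}" using meet that by simp
      then obtain x where "x \<in> D" "j x \<in> G" by auto
      then show ?thesis using DQ by (auto simp: H_def)
    qed
    ultimately show "\<exists>G. filter_on_poset Q r G \<and> (\<forall>D\<in>\<D>. G \<inter> D \<noteq> {})"
      by (intro exI[of _ H]) simp
  qed
qed

theorem MA_sigma_centered_any_type: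
  fixes P :: "'a set"
  assumes MA: MA_sigma_centered
    and P: "P \<noteq> {}" and po: "partial_order_on P r" and sc: "sigma_centered P r"
  shows "has_generic_filters P r"
  unfolding has_generic_filters_def
proof (intro allI impI, elim conjE)
  fix \<D> :: "'a set set"
  assume c: "\<D> \<prec> (UNIV :: nat set set)" and D: "\<forall>D\<in>\<D>. dense_subset_of_poset P r D"
  have rP: "r \<subseteq> P \<times> P" and refl: "\<And>x. x \<in> P \<Longrightarrow> (x, x) \<in> r"
    and tr: "\<And>x y z. \<lbrakk>(x, y) \<in> r; (y, z) \<in> r\<rbrakk> \<Longrightarrow> (x, z) \<in> r"
    and as: "\<And>x y. \<lbrakk>(x, y) \<in> r; (y, x) \<in> r\<rbrakk> \<Longrightarrow> x = y"
    using po unfolding partial_order_on_def preorder_on_def refl_on_def trans_def antisym_def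
    by blast+
  obtain C :: "nat \<Rightarrow> 'a set" where PC: "P = (\<Union>n. C n)" and cen: "\<And>n. centered_subset P r (C n)"
    using sc unfolding sigma_centered_def by blast
  obtain p0 where p0: "p0 \<in> P" using P by blast
  define f where "f D p = (SOME d. d \<in> D \<and> (d, p) \<in> r)" for D p
  define b where "b n F = (if F \<subseteq> C n \<and> finite F then SOME q. q \<in> P \<and> (\<forall>p\<in>F. (q, p) \<in> r) else p0)"
    for n F
  have f: "f D p \<in> D" "(f D p, p) \<in> r" "f D p \<in> P" if "D \<in> \<D>" "p \<in> P" for D p
  proof -
    have "\<exists>d. d \<in> D \<and> (d, p) \<in> r" using D that unfolding dense_subset_of_poset_def by blast
    from someI_ex[OF this] show "f D p \<in> D" "(f D p, p) \<in> r" unfolding f_def by blast+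
    then show "f D p \<in> P" using rP by blast
  qed
  have b: "b n F \<in> P \<and> (\<forall>p\<in>F. (b n F, p) \<in> r)" if "F \<subseteq> C n" "finite F" for n F
  proof -
    have "\<exists>q. q \<in> P \<and> (\<forall>p\<in>F. (q, p) \<in> r)"
      using cen[of n] that unfolding centered_subset_def by blast
    from someI_ex[OF this] show ?thesis using that unfolding b_def by simp
  qed
  have bP: "b n F \<in> P" for n F
    using b[of F n] p0 by (cases "F \<subseteq> C n \<and> finite F") (auto simp: b_def)
  obtain Q where Q0: "p0 \<in> Q" and Qs: "Q \<lesssim> (UNIV :: nat set set)"
    and Qf: "\<And>D p. \<lbrakk>D \<in> \<D>; p \<in> Q\<rbrakk> \<Longrightarrow> f D p \<in> Q"
    and Qb: "\<And>n F. \<lbrakk>finite F; F \<subseteq> Q\<rbrakk> \<Longrightarrow> b n F \<in> Q"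
    and Qmin: "\<And>R. \<lbrakk>p0 \<in> R; \<And>D p. \<lbrakk>D \<in> \<D>; p \<in> R\<rbrakk> \<Longrightarrow> f D p \<in> R;
       \<And>n F. \<lbrakk>finite F; F \<subseteq> R\<rbrakk> \<Longrightarrow> b n F \<in> R\<rbrakk> \<Longrightarrow> Q \<subseteq> R"
    using lepoll_nat_set_closure[OF lesspoll_imp_lepoll[OF c], of p0 f b] by blast
  have QP: "Q \<subseteq> P" using Qmin[OF p0] f(3) bP by blast
  define s where "s = r \<inter> Q \<times> Q"
  obtain j :: "'a \<Rightarrow> nat set" where j: "inj_on j Q" using Qs unfolding lepoll_def by (elim exE conjE)
  have js: "(j x, j y) \<in> map_prod j j ` s \<longleftrightarrow> (x, y) \<in> r" if "x \<in> Q" "y \<in> Q" for x y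
    using that map_prod_image_iff[OF j, of s x y] by (simp add: s_def)
  have "partial_order_on (j ` Q) (map_prod j j ` s)"
    unfolding partial_order_on_def preorder_on_def
  proof (intro conjI)
    show "map_prod j j ` s \<subseteq> j ` Q \<times> j ` Q" by (auto simp: s_def)
    show "refl_on (j ` Q) (map_prod j j ` s)"
      using refl QP js by (auto simp: refl_on_def)
    show "trans (map_prod j j ` s)"
    proof (rule transI)
      fix x y z assume "(x, y) \<in> map_prod j j ` s" "(y, z) \<in> map_prod j j ` s"
      then obtain x' y' y'' z' where "(x', y') \<in> s" "x = j x'" "y = j y'" "(y'', z') \<in> s"
        "y = j y''" "z = j z'" by auto
      moreover from this have "y' = y''" using j by (auto simp: inj_on_def s_def)
      ultimately show "(x, z) \<in> map_prod j j ` s" using js[of x' z'] tr by (auto simp: s_def)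
    qed
    show "antisym (map_prod j j ` s)"
    proof (rule antisymI)
      fix x y assume "(x, y) \<in> map_prod j j ` s" "(y, x) \<in> map_prod j j ` s"
      moreover from this obtain x' y' where "x' \<in> Q" "y' \<in> Q" "x = j x'" "y = j y'"
        by (auto simp: s_def)
      ultimately show "x = y" using js[of x' y'] js[of y' x'] as[of x' y'] by simp
    qed
  qed
  moreover have "sigma_centered (j ` Q) (map_prod j j ` s)"
    unfolding sigma_centered_def
  proof (intro exI conjI allI)
    show "j ` Q = (\<Union>n. j ` (C n \<inter> Q))" using QP PC by blast
    fix n
    show "centered_subset (j ` Q) (map_prod j j ` s) (j ` (C n \<inter> Q))"
      unfolding centered_subset_def
    proof (intro conjI allI impI, blast, elim conjE)
      fix F assume "finite F" "F \<subseteq> j ` (C n \<inter> Q)"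
      then obtain F' where F': "F' \<subseteq> C n \<inter> Q" "finite F'" "F = j ` F'"
        using finite_subset_image by metis
      then have "b n F' \<in> Q" "\<forall>p\<in>F'. (b n F', p) \<in> r" using Qb b by auto
      then show "\<exists>q\<in>j ` Q. \<forall>p\<in>F. (q, p) \<in> map_prod j j ` s"
        using js F' by blast
    qed
  qed
  ultimately have "has_generic_filters (j ` Q) (map_prod j j ` s)"
    using MA[unfolded MA_sigma_centered_def, rule_format, of "j ` Q"] Q0 by blast
  then have gen: "has_generic_filters Q s"
    by (rule has_generic_filters_inj_image[OF j, rotated]) (auto simp: s_def)
  have "(\<lambda>D. D \<inter> Q) ` \<D> \<prec> (UNIV :: nat set set)"
    using lesspoll_trans1[OF image_lepoll c] .
  moreover have "\<forall>E\<in>(\<lambda>D. D \<inter> Q) ` \<D>. dense_subset_of_poset Q s E"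
    using Qf f QP unfolding dense_subset_of_poset_def s_def by blast
  ultimately obtain H where H: "filter_on_poset Q s H" and meet: "\<forall>D\<in>\<D>. H \<inter> (D \<inter> Q) \<noteq> {}"
    using gen[unfolded has_generic_filters_def, rule_format, of "(\<lambda>D. D \<inter> Q) ` \<D>"] by auto
  define G where "G = {p \<in> P. \<exists>h\<in>H. (h, p) \<in> r}"
  have HG: "H \<subseteq> G" using H QP refl unfolding G_def filter_on_poset_def by blast
  have "filter_on_poset P r G"
    unfolding filter_on_poset_def
  proof (intro conjI ballI impI)
    show "G \<subseteq> P" by (auto simp: G_def)
    show "G \<noteq> {}" using H HG unfolding filter_on_poset_def by blast
    show "q \<in> G" if "p \<in> G" "q \<in> P" "(p, q) \<in> r" for p q
      using that tr unfolding G_def by blast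
    show "\<exists>t\<in>G. (t, p) \<in> r \<and> (t, q) \<in> r" if pq: "p \<in> G" "q \<in> G" for p q
    proof -
      obtain x y where xy: "x \<in> H" "y \<in> H" "(x, p) \<in> r" "(y, q) \<in> r"
        using pq unfolding G_def by blast
      then obtain t where "t \<in> H" "(t, x) \<in> r" "(t, y) \<in> r"
        using H unfolding filter_on_poset_def s_def by blast
      then show ?thesis using HG xy tr by blast
    qed
  qed
  then show "\<exists>G. filter_on_poset P r G \<and> (\<forall>D\<in>\<D>. G \<inter> D \<noteq> {})"
    using meet HG by blast
qed

end

theory Submission
  imports Defs
begin

text \<open>
  The set \<open>X\<close> and its complement \<open>Y\<close> are built by recursion over the continuum.  Along with them grows a
  family of \<^emph>\<open>partial homeomorphisms\<close>, that is, homeomorphisms between comeager subsets of the Cantor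
  set, each of which restricts to a homeomorphism of \<open>X\<close> onto \<open>X\<close>.  One of them is provided for every
  pair of countable dense subsets \<open>A\<close>, \<open>B\<close> of \<open>X\<close>, and it maps \<open>A\<close> onto \<open>B\<close>; this makes \<open>X\<close> countable
  dense homogeneous.

  Unless it is the identity, such a map must not extend to \<open>Y\<close>, even locally, since \<open>Y\<close> is to be rigid.  So the maps are
  kept \<^emph>\<open>erratic\<close>: a composition of them and their inverses is either a restriction of the identity
  or is not uniformly continuous on any cylinder.  This settles rigidity.  Suppose that a
  homeomorphism \<open>h\<close> of \<open>Y\<close> moves a point.  It extends to a partial homeomorphism \<open>g\<close>, coded by the
  values of \<open>h\<close> on a countable dense set, and some stage of the recursion deals with this code.  If
  at that stage there is a point \<open>x\<close> such that \<open>x\<close> can still be put into \<open>Y\<close> and \<open>g x\<close> into \<open>X\<close>, then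
  this is done, and \<open>h\<close> cannot map \<open>Y\<close> into itself.  If there is none, a category argument for
  fewer than continuum many comeager sets (\<open>MA_comeager\<close>) yields a composition \<open>v\<close> of the earlier maps
  that agrees with \<open>g\<close> on a cylinder without fixed points of \<open>g\<close>
  (\<open>agrees_with_word_if_no_suitable\<close>).  Now \<open>v\<close> is continuous at the points of \<open>X\<close>
  and \<open>g\<close> at those of \<open>Y\<close>, so by compactness \<open>v\<close> is uniformly continuous on this cylinder
  (\<open>unif_cont_on_if_agrees\<close>); hence \<open>v\<close> is a restriction of the identity, contrary to the choice of the
  cylinder.

  The main work is to enlarge a family of erratic maps by a map \<open>f\<close> that permutes a
  given set of fewer than continuum many points, using only pairs from a prescribed relation (\<open>extend_group\<close>).
  Here Martin's Axiom is applied to an uncountable poset.  A condition consists of finitely many pairs of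
  cylinders that \<open>f\<close> is to match and of finitely many pairs of points whose neighbourhoods have to be
  matched.  The pairs of points are of two kinds: \<^emph>\<open>commitments\<close> \<open>f x = y\<close>, and \<^emph>\<open>promises\<close>
  \<open>(c, p)\<close> and \<open>(c, q)\<close> with \<open>p\<close> different from \<open>q\<close>, which say that \<open>f\<close> has both \<open>p\<close> and \<open>q\<close> as limit
  points at \<open>c\<close>.  A word in \<open>f\<close> and the old maps whose first use of \<open>f\<close> happens at such a \<open>c\<close>
  oscillates near \<open>c\<close>, provided that the remaining letters carry small neighbourhoods of \<open>p\<close> and \<open>q\<close>
  into disjoint cylinders, and finitely many further pairs of cylinders force them to
  (\<open>dense_D_word\<close>).

  The poset has to be \<open>\<sigma>\<close>-centered although there may be uncountably many commitments.
  To this end the commitments are covered by countably many injective relations, the colours.  Apart from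
  countably many points they match a point with its images under the words in a fixed countable
  family, whose orbits are dense (\<open>ex_base_group\<close>, \<open>ex_colouring\<close>).
\<close>

section \<open>Sets of cardinality less than the continuum\<close>

definition small :: "'a set \<Rightarrow> bool"
  where "small A \<longleftrightarrow> A \<prec> (UNIV :: nat set set)"

lemma small_iff_card:
  includes cardinal_syntax
  shows "small A \<longleftrightarrow> |A| <o |UNIV :: nat set set|"
proof -
  have le: "A \<lesssim> (UNIV :: nat set set) \<longleftrightarrow> |A| \<le>o |UNIV :: nat set set|"
    unfolding lepoll_def card_of_ordLeq[symmetric] ..
  have eq: "A \<approx> (UNIV :: nat set set) \<longleftrightarrow> |A| =o |UNIV :: nat set set|"
    by (rule eqpoll_iff_card_of_ordIso)
  show ?thesis
    unfolding small_def lesspoll_def le eqpoll_def[symmetric]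
  proof (intro iffI conjI)
    assume A: "|A| \<le>o |UNIV :: nat set set| \<and> \<not> A \<approx> (UNIV :: nat set set)"
    then show "|A| <o |UNIV :: nat set set|"
      unfolding eq using ordLeq_iff_ordLess_or_ordIso by metis
  next
    assume A: "|A| <o |UNIV :: nat set set|"
    then show "|A| \<le>o |UNIV :: nat set set|" by (rule ordLess_imp_ordLeq)
    show "\<not> A \<approx> (UNIV :: nat set set)"
      unfolding eq using A not_ordLess_ordIso by metis
  qed
qed

lemma infinite_nat_set: "infinite (UNIV :: nat set set)"
  by (simp add: Finite_Set.finite_set)

lemma small_mono: "A \<subseteq> B \<Longrightarrow> small B \<Longrightarrow> small A"
  unfolding small_def using lesspoll_trans1 subset_imp_lepoll by metis

lemma small_image: "small A \<Longrightarrow> small (f ` A)"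
  unfolding small_def using lesspoll_trans1 image_lepoll by metis

lemma small_Un: "small A \<Longrightarrow> small B \<Longrightarrow> small (A \<union> B)"
  unfolding small_iff_card
  using card_of_Un_ordLess_infinite infinite_nat_set by metis

lemma small_countable:
  assumes "countable A" shows "small A"
proof -
  have "A \<lesssim> (UNIV :: nat set)"
    using assms unfolding countable_def lepoll_def by blast
  moreover have "(UNIV :: nat set) \<prec> (UNIV :: nat set set)"
    using lesspoll_Pow_self[of "UNIV :: nat set"] by simp
  ultimately show ?thesis unfolding small_def by (rule lesspoll_trans1)
qed

lemma small_infinite_square:
  includes cardinal_syntax
  assumes "infinite B"
  shows "\<exists>p. inj_on p (B \<times> B) \<and> p ` (B \<times> B) \<subseteq> B"
  using card_of_Times_same_infinite[OF assms] ordIso_imp_ordLeq card_of_ordLeq by metis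

lemma small_Times:
  fixes A :: "'a set" and B :: "'b set"
  assumes "small A" "small B"
  shows "small (A \<times> B)"
proof -
  define i :: "'a \<Rightarrow> 'a + 'b + nat" where "i = Inl"
  define j :: "'b \<Rightarrow> 'a + 'b + nat" where "j = Inr \<circ> Inl"
  define k :: "nat \<Rightarrow> 'a + 'b + nat" where "k = Inr \<circ> Inr"
  define D where "D = i ` A \<union> j ` B \<union> range k"
  have inj: "inj i" "inj j" "inj k" by (auto simp: i_def j_def k_def inj_def)
  have "infinite D"
    using finite_imageD[of k UNIV] inj(3) infinite_UNIV_nat unfolding D_def by auto
  from small_infinite_square[OF this]
  obtain p where p: "inj_on p (D \<times> D)" "p ` (D \<times> D) \<subseteq> D" by blast
  have "inj_on (\<lambda>(x, y). p (i x, j y)) (A \<times> B)"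
  proof (rule inj_onI, clarify)
    fix x y x' y' assume "x \<in> A" "y \<in> B" "x' \<in> A" "y' \<in> B" "p (i x, j y) = p (i x', j y')"
    then have "(i x, j y) = (i x', j y')" by (intro inj_onD[OF p(1)]) (auto simp: D_def)
    then show "x = x' \<and> y = y'" using inj(1,2) by (simp add: inj_eq)
  qed
  moreover have "(\<lambda>(x, y). p (i x, j y)) ` (A \<times> B) \<subseteq> D"
  proof clarify
    fix x y assume "x \<in> A" "y \<in> B"
    then have "(i x, j y) \<in> D \<times> D" by (auto simp: D_def)
    then show "p (i x, j y) \<in> D" using p(2) by blast
  qed
  ultimately have "A \<times> B \<lesssim> D" unfolding lepoll_def by blast
  moreover have "small D"
    unfolding D_def by (intro small_Un small_image assms small_countable) auto
  ultimately show ?thesis unfolding small_def by (rule lesspoll_trans1)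
qed

lemma small_if_parametrized:
  assumes "small I" "\<And>x. x \<in> U \<Longrightarrow> \<exists>i\<in>I. x = f i"
  shows "small U"
  by (rule small_mono[OF _ small_image[OF assms(1), of f]]) (use assms(2) in auto)

lemma inj_on_fold_pairs:
  assumes p: "inj_on p (B \<times> B)" "p ` (B \<times> B) \<subseteq> B" and "b0 \<in> B"
  shows "inj_on (\<lambda>l. (length l, foldr (\<lambda>x y. p (x, y)) l b0)) (lists B)"
proof -
  have mem: "foldr (\<lambda>x y. p (x, y)) l b0 \<in> B" if "l \<in> lists B" for l
    using that by (induction l) (use assms in auto)
  have "l = l'" if "l \<in> lists B" "l' \<in> lists B" "length l = length l'"
    "foldr (\<lambda>x y. p (x, y)) l b0 = foldr (\<lambda>x y. p (x, y)) l' b0" for l l'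
    using that(3,1,2,4)
  proof (induction l l' rule: list_induct2)
    case (Cons x xs y ys)
    then have "(x, foldr (\<lambda>x y. p (x, y)) xs b0) = (y, foldr (\<lambda>x y. p (x, y)) ys b0)"
      using mem[of xs] mem[of ys] by (intro inj_onD[OF p(1)]) auto
    then show ?case using Cons by auto
  qed simp
  then show ?thesis by (auto simp: inj_on_def)
qed

text \<open>A list is determined by its length together with the single element to which an injection of
  \<open>B \<times> B\<close> into \<open>B\<close> folds it.  A disjoint copy of the natural numbers is added first to make the set
  infinite.\<close>

lemma small_lists:
  assumes "small A" shows "small (lists A)"
proof -
  define B where "B = Inl ` A \<union> range (Inr :: nat \<Rightarrow> 'a + nat)"
  have sB: "small B"
    unfolding B_def by (intro small_Un small_image assms small_countable) auto
  have iB: "infinite B"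
    unfolding B_def by (simp add: finite_image_iff)
  from small_infinite_square[OF iB]
  obtain p where p: "inj_on p (B \<times> B)" "p ` (B \<times> B) \<subseteq> B" by blast
  have b0: "Inr 0 \<in> B" unfolding B_def by blast
  define e where "e l = (length l, foldr (\<lambda>x y. p (x, y)) l (Inr 0))" for l
  have mem: "e l \<in> UNIV \<times> B" if "l \<in> lists B" for l
  proof -
    have "foldr (\<lambda>x y. p (x, y)) l (Inr 0) \<in> B"
      using that by (induction l) (use p(2) b0 in auto)
    then show ?thesis by (simp add: e_def)
  qed
  have "inj_on e (lists B)"
    using inj_on_fold_pairs[OF p b0] by (simp add: e_def[abs_def])
  then have "lists B \<lesssim> (UNIV :: nat set) \<times> B"
    unfolding lepoll_def using mem by blast
  moreover have "small ((UNIV :: nat set) \<times> B)"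
    by (intro small_Times sB small_countable) auto
  ultimately have "small (lists B)"
    unfolding small_def using lesspoll_trans1 by blast
  then have "small (map (case_sum id (\<lambda>_. undefined)) ` lists B)" by (rule small_image)
  moreover have "lists A \<subseteq> map (case_sum id (\<lambda>_. undefined)) ` lists B"
  proof
    fix l assume "l \<in> lists A"
    then have "map Inl l \<in> lists B" unfolding B_def by (auto simp: in_lists_conv_set)
    moreover have "l = map (case_sum id (\<lambda>_. undefined)) (map Inl l)" by (simp add: comp_def)
    ultimately show "l \<in> map (case_sum id (\<lambda>_. undefined)) ` lists B" by blast
  qed
  ultimately show ?thesis using small_mono by blast
qed

section \<open>Cylinders and category in the Cantor set\<close>

type_synonym point = "nat \<Rightarrow> bool"
type_synonym prel = "(point \<times> point) set"
type_synonym boxes = "(bool list \<times> bool list) set"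
type_synonym condition = "boxes \<times> prel"
type_synonym stage = "prel \<times> point set \<times> point set"

definition agree :: "nat \<Rightarrow> point \<Rightarrow> point \<Rightarrow> bool"
  where "agree n x y \<longleftrightarrow> (\<forall>i<n. x i = y i)"

definition cyl :: "bool list \<Rightarrow> point set"
  where "cyl a = {x. \<forall>i<length a. x i = a ! i}"

definition init :: "nat \<Rightarrow> point \<Rightarrow> bool list"
  where "init n x = map x [0..<n]"

lemma length_init [simp]: "length (init n x) = n"
  by (simp add: init_def)

lemma agree_refl [simp]: "agree n x x"
  by (simp add: agree_def)

lemma agree_sym: "agree n x y \<Longrightarrow> agree n y x"
  by (simp add: agree_def)

lemma agree_trans: "agree n x y \<Longrightarrow> agree n y z \<Longrightarrow> agree n x z"
  by (simp add: agree_def)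

lemma agree_mono: "agree n x y \<Longrightarrow> m \<le> n \<Longrightarrow> agree m x y"
  by (simp add: agree_def)

lemma agree_all_imp_eq: "(\<And>n. agree n x y) \<Longrightarrow> x = y"
  unfolding agree_def by (rule ext) (metis lessI)

lemma not_eq_imp_not_agree: "x \<noteq> y \<Longrightarrow> \<exists>n. \<not> agree n x y"
  using agree_all_imp_eq by blast

lemma in_cyl_init [simp]: "y \<in> cyl (init n x) \<longleftrightarrow> agree n x y"
  by (auto simp: cyl_def init_def agree_def)

lemma cyl_eq_agree:
  assumes "x \<in> cyl a" shows "y \<in> cyl a \<longleftrightarrow> agree (length a) x y"
  using assms by (auto simp: cyl_def agree_def)

lemma cyl_agree: "x \<in> cyl a \<Longrightarrow> agree n x y \<Longrightarrow> length a \<le> n \<Longrightarrow> y \<in> cyl a"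
  using cyl_eq_agree agree_mono by blast

lemma init_of_mem_cyl: "x \<in> cyl a \<Longrightarrow> init (length a) x = a"
  by (auto simp: cyl_def init_def intro!: nth_equalityI)

lemma cyl_nonempty: "\<exists>x. x \<in> cyl a"
  by (rule exI[of _ "\<lambda>i. a ! i"]) (simp add: cyl_def)

lemma open_iff_agree: "open S \<longleftrightarrow> (\<forall>x\<in>S. \<exists>n. \<forall>y. agree n x y \<longrightarrow> y \<in> S)" for S :: "point set"
proof
  assume S: "open S"
  show "\<forall>x\<in>S. \<exists>n. \<forall>y. agree n x y \<longrightarrow> y \<in> S"
  proof
    fix x assume "x \<in> S"
    have "openin (product_topology (\<lambda>i. euclidean) UNIV) S"
      using S open_fun_def by blast
    then obtain U where U: "finite {i. U i \<noteq> UNIV}" "x \<in> Pi\<^sub>E UNIV U" "Pi\<^sub>E UNIV U \<subseteq> S"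
      using \<open>x \<in> S\<close> unfolding openin_product_topology_alt by auto
    obtain n where n: "\<And>i. U i \<noteq> UNIV \<Longrightarrow> i < n"
      using U(1) finite_nat_set_iff_bounded by auto
    have "y \<in> S" if y: "agree n x y" for y
    proof -
      have "y i \<in> U i" for i
      proof (cases "U i = UNIV")
        case False
        then have "y i = x i" using n y by (simp add: agree_def)
        then show ?thesis using U(2) by (auto simp: PiE_iff)
      qed simp
      then show ?thesis using U(3) by (auto simp: PiE_iff)
    qed
    then show "\<exists>n. \<forall>y. agree n x y \<longrightarrow> y \<in> S" by blast
  qed
next
  assume S: "\<forall>x\<in>S. \<exists>n. \<forall>y. agree n x y \<longrightarrow> y \<in> S"
  have "\<exists>T. open T \<and> x \<in> T \<and> T \<subseteq> S" if x: "x \<in> S" for x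
  proof -
    obtain n where n: "\<forall>y. agree n x y \<longrightarrow> y \<in> S" using S x by blast
    have "open (Pi\<^sub>E UNIV (\<lambda>i. if i < n then {x i} else UNIV))"
    proof (rule open_PiE)
      show "open (if i < n then {x i} else UNIV)" for i
        by (simp add: open_discrete)
      have "{i. (if i < n then {x i} else UNIV) \<noteq> UNIV} \<subseteq> {..<n}" by auto
      then show "finite {i. (if i < n then {x i} else UNIV) \<noteq> UNIV}"
        using finite_subset by blast
    qed
    moreover have "Pi\<^sub>E UNIV (\<lambda>i. if i < n then {x i} else UNIV) = {y. agree n x y}"
      by (auto simp: PiE_iff agree_def split: if_splits)
    ultimately show ?thesis using n by (intro exI[of _ "{y. agree n x y}"]) auto
  qed
  then show "open S" by (subst open_subopen) blast
qed

lemma open_cyl: "open (cyl a)"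
  unfolding open_iff_agree using cyl_agree by blast

definition dense_set :: "point set \<Rightarrow> bool"
  where "dense_set S \<longleftrightarrow> (\<forall>a. \<exists>x\<in>S. x \<in> cyl a)"

lemma dense_setD: "dense_set S \<Longrightarrow> \<exists>y\<in>S. agree n x y"
  unfolding dense_set_def by (metis in_cyl_init)

lemma dense_setI: "(\<And>n x. \<exists>y\<in>S. agree n x y) \<Longrightarrow> dense_set S"
  unfolding dense_set_def by (metis cyl_nonempty cyl_agree order_refl)

lemma dense_set_mono: "dense_set S \<Longrightarrow> S \<subseteq> T \<Longrightarrow> dense_set T"
  unfolding dense_set_def by blast

lemma dense_set_open:
  assumes "dense_set S" "open T" "T \<noteq> {}" shows "\<exists>x\<in>S. x \<in> T"
  using assms dense_setD unfolding open_iff_agree by (metis all_not_in_conv)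

lemma dense_set_minus_point:
  assumes "dense_set S" shows "dense_set (S - {p})"
proof (rule dense_setI)
  fix n x
  define x' where "x' = (if agree (Suc n) x p then x(n := \<not> x n) else x)"
  have 1: "agree n x x'" "\<not> agree (Suc n) x' p"
    unfolding x'_def by (auto simp: agree_def)
  obtain y where y: "y \<in> S" "agree (Suc n) x' y" using dense_setD[OF assms] by blast
  then have "y \<noteq> p" using 1 by blast
  moreover have "agree n x y" using agree_trans[OF 1(1)] agree_mono[OF y(2)] by simp
  ultimately show "\<exists>y\<in>S - {p}. agree n x y" using y by blast
qed

lemma dense_set_minus_finite:
  assumes "finite F" "dense_set S" shows "dense_set (S - F)"
  using assms(1)
proof (induction F)
  case (insert p F)
  then have "dense_set (S - F - {p})" using dense_set_minus_point by blast
  then show ?case by (metis Diff_insert)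
qed (use assms in simp)

definition comeager :: "point set \<Rightarrow> bool"
  where "comeager S \<longleftrightarrow> (\<exists>U :: nat \<Rightarrow> point set. (\<forall>n. open (U n) \<and> dense_set (U n)) \<and> (\<Inter>n. U n) \<subseteq> S)"

lemma comeager_mono: "comeager S \<Longrightarrow> S \<subseteq> T \<Longrightarrow> comeager T"
  unfolding comeager_def by (meson subset_trans)

lemma comeager_open_dense: "open U \<Longrightarrow> dense_set U \<Longrightarrow> comeager U"
  unfolding comeager_def by (intro exI[of _ "\<lambda>_. U"]) auto

lemma comeager_UNIV: "comeager UNIV"
  by (rule comeager_open_dense) (auto simp: dense_set_def cyl_nonempty)

lemma comeager_INT:
  assumes "\<And>n::nat. comeager (S n)" shows "comeager (\<Inter>n. S n)"
proof -
  have "\<forall>n. \<exists>U :: nat \<Rightarrow> point set. (\<forall>m. open (U m) \<and> dense_set (U m)) \<and> (\<Inter>m. U m) \<subseteq> S n"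
    using assms unfolding comeager_def by blast
  then obtain U :: "nat \<Rightarrow> nat \<Rightarrow> point set" where U: "\<And>n m. open (U n m)" "\<And>n m. dense_set (U n m)"
    "\<And>n. (\<Inter>m. U n m) \<subseteq> S n" by metis
  show ?thesis
    unfolding comeager_def
  proof (intro exI[of _ "\<lambda>k. U (fst (prod_decode k)) (snd (prod_decode k))"] conjI allI U(1,2))
    show "(\<Inter>k. U (fst (prod_decode k)) (snd (prod_decode k))) \<subseteq> (\<Inter>n. S n)"
    proof (intro subsetI INT_I)
      fix x n assume x: "x \<in> (\<Inter>k. U (fst (prod_decode k)) (snd (prod_decode k)))"
      have "x \<in> U n m" for m
        using INT_D[OF x, of "prod_encode (n, m)"] by simp
      then show "x \<in> S n" using U(3) by blast
    qed
  qed
qed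

lemma comeager_Int: "comeager S \<Longrightarrow> comeager T \<Longrightarrow> comeager (S \<inter> T)"
  using comeager_INT[of "\<lambda>n. if n = 0 then S else T"]
  by (rule comeager_mono) (auto split: if_splits)

lemma comeager_Compl_point: "comeager (- {p})"
proof (rule comeager_open_dense)
  show "open (- {p})"
    unfolding open_iff_agree using not_eq_imp_not_agree by (metis ComplD ComplI singletonD singletonI)
  show "dense_set (- {p})"
    using dense_set_minus_point[of UNIV p] by (simp add: Compl_eq_Diff_UNIV dense_set_def cyl_nonempty)
qed

text \<open>The Baire category theorem for fewer than continuum many sets.  The poset consists of the finite
  binary words below \<open>a\<close>; it is countable, hence a countable union of singletons, and these are
  centered.\<close>

lemma MA_comeager:
  assumes MA: MA_sigma_centered and I: "small I" and S: "\<And>i. i \<in> I \<Longrightarrow> comeager (S i)"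
  shows "\<exists>x\<in>cyl a. \<forall>i\<in>I. x \<in> S i"
proof -
  have "\<forall>i\<in>I. \<exists>U :: nat \<Rightarrow> point set. (\<forall>n. open (U n) \<and> dense_set (U n)) \<and> (\<Inter>n. U n) \<subseteq> S i"
    using S unfolding comeager_def by blast
  then obtain U where U: "\<And>i n. i \<in> I \<Longrightarrow> open (U i n)" "\<And>i n. i \<in> I \<Longrightarrow> dense_set (U i n)"
    "\<And>i. i \<in> I \<Longrightarrow> (\<Inter>n::nat. U i n) \<subseteq> S i" by metis
  define P where "P = {b. cyl b \<subseteq> cyl a}"
  define r where "r = {(b, c). b \<in> P \<and> c \<in> P \<and> (\<exists>d. b = c @ d)}"
  have aP: "a \<in> P" by (simp add: P_def)
  have cyl_app: "cyl (b @ d) \<subseteq> cyl b" for b d by (auto simp: cyl_def nth_append)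
  have po: "partial_order_on P r"
    unfolding partial_order_on_def preorder_on_def refl_on_def trans_def antisym_def r_def by auto
  have sc: "sigma_centered P r"
    unfolding sigma_centered_def
  proof (intro exI conjI allI)
    have cP: "countable P" by simp
    have ne: "P \<noteq> {}" using aP by auto
    show "P = (\<Union>n. {from_nat_into P n})"
      unfolding UNION_singleton_eq_range range_from_nat_into[OF ne cP] ..
    fix n
    have "from_nat_into P n \<in> P" by (rule from_nat_into[OF ne])
    then show "centered_subset P r {from_nat_into P n}"
      unfolding centered_subset_def by (auto simp: r_def subset_singleton_iff)
  qed
  define D where "D j = (case j of Inl (i, n) \<Rightarrow> {b \<in> P. cyl b \<subseteq> U i n} | Inr n \<Rightarrow> {b \<in> P. n \<le> length b})"
    for j :: "('a \<times> nat) + nat"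
  define J where "J = (Inl ` (I \<times> (UNIV :: nat set)) \<union> range Inr :: (('a \<times> nat) + nat) set)"
  have sJ: "small (D ` J)"
    unfolding J_def by (intro small_image small_Un small_Times I small_countable) auto
  have gen: "has_generic_filters P r"
    using MA_sigma_centered_any_type[OF MA _ po sc] aP by blast
  have init_ext: "\<exists>d. init k x = b @ d" if "x \<in> cyl b" "length b \<le> k" for b x k
  proof -
    have "take (length b) (init k x) = init (length b) x"
      using that(2) by (simp add: init_def take_map)
    then show ?thesis using init_of_mem_cyl[OF that(1)] append_take_drop_id by metis
  qed
  have "dense_subset_of_poset P r (D j)" if j: "j \<in> J" for j
    unfolding dense_subset_of_poset_def
  proof (intro conjI ballI)
    show "D j \<subseteq> P" by (auto simp: D_def split: sum.splits)
    fix p assume p: "p \<in> P"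
    show "\<exists>d\<in>D j. (d, p) \<in> r"
    proof (cases j)
      case (Inl v)
      obtain i n where v: "v = (i, n)" by (cases v)
      then have i: "i \<in> I" using j Inl by (auto simp: J_def)
      obtain x where x: "x \<in> U i n" "x \<in> cyl p" using U(2)[OF i] unfolding dense_set_def by blast
      then obtain m where m: "\<And>y. agree m x y \<Longrightarrow> y \<in> U i n"
        using U(1)[OF i, of n] x(1) unfolding open_iff_agree by metis
      define k where "k = max m (length p)"
      obtain d where d: "init k x = p @ d" using init_ext[OF x(2), of k] by (auto simp: k_def)
      then have "p @ d \<in> P" using p cyl_app by (auto simp: P_def)
      moreover have "cyl (p @ d) \<subseteq> U i n"
        unfolding d[symmetric] using m agree_mono by (auto simp: k_def)
      ultimately show ?thesis using p unfolding Inl v D_def r_def by auto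
    next
      case (Inr n)
      have "p @ replicate n True \<in> P" using p cyl_app by (auto simp: P_def)
      then show ?thesis using p unfolding Inr D_def r_def
        by (auto intro!: bexI[of _ "p @ replicate n True"])
    qed
  qed
  then have "D ` J \<prec> (UNIV :: nat set set) \<and> (\<forall>E\<in>D ` J. dense_subset_of_poset P r E)"
    using sJ by (simp add: small_def)
  from gen[unfolded has_generic_filters_def, rule_format, OF this]
  obtain G where G: "filter_on_poset P r G" and meet: "\<And>j. j \<in> J \<Longrightarrow> G \<inter> D j \<noteq> {}"
    by auto
  have dir: "\<exists>e\<in>G. (\<exists>d. e = b @ d) \<and> (\<exists>d. e = c @ d)" if "b \<in> G" "c \<in> G" for b c
    using G that unfolding filter_on_poset_def r_def by blast
  have "\<exists>b\<in>G. n < length b" for n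
    using meet[of "Inr (Suc n)"] unfolding J_def D_def by (auto simp: Suc_le_eq)
  then obtain b where b: "\<And>n. b n \<in> G" "\<And>n. n < length (b n)" by metis
  define x where "x n = b n ! n" for n
  have xG: "x \<in> cyl c" if c: "c \<in> G" for c
    unfolding cyl_def
  proof (intro CollectI allI impI)
    fix i assume i: "i < length c"
    obtain e d d' where "e = c @ d" "e = b i @ d'" using dir[OF c b(1)] by metis
    then have "c ! i = b i ! i" using i b(2)[of i] by (metis nth_append)
    then show "x i = c ! i" by (simp add: x_def)
  qed
  have "x \<in> S i" if i: "i \<in> I" for i
  proof -
    have "x \<in> U i n" for n
      using meet[of "Inl (i, n)"] i xG unfolding J_def D_def by auto
    then show ?thesis using U(3)[OF i] by blast
  qed
  moreover have "x \<in> cyl a"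
    using G xG unfolding filter_on_poset_def P_def by blast
  ultimately show ?thesis by blast
qed

section \<open>Homeomorphisms between comeager sets\<close>

text \<open>Partial maps are relations.  Continuity in this form includes single-valuedness: take
  \<open>x' = x\<close>.\<close>

definition rel_continuous :: "prel \<Rightarrow> bool"
  where "rel_continuous w \<longleftrightarrow>
    (\<forall>x y. (x, y) \<in> w \<longrightarrow> (\<forall>k. \<exists>n. \<forall>x' y'. (x', y') \<in> w \<longrightarrow> agree n x x' \<longrightarrow> agree k y y'))"

definition partial_homeo :: "prel \<Rightarrow> bool"
  where "partial_homeo w \<longleftrightarrow> rel_continuous w \<and> rel_continuous (w\<inverse>) \<and>
    comeager (Domain w) \<and> comeager (Range w)"

lemma rel_continuousD:
  assumes "rel_continuous w" "(x, y) \<in> w"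
  shows "\<exists>n. \<forall>x' y'. (x', y') \<in> w \<longrightarrow> agree n x x' \<longrightarrow> agree k y y'"
  using assms unfolding rel_continuous_def by metis

lemma rel_continuous_unique: "rel_continuous w \<Longrightarrow> (x, y) \<in> w \<Longrightarrow> (x, y') \<in> w \<Longrightarrow> y = y'"
  using agree_all_imp_eq agree_refl rel_continuousD by metis

lemma rel_continuous_open:
  assumes "rel_continuous w" "(x, y) \<in> w" "open T" "y \<in> T"
  obtains n where "\<And>x' y'. (x', y') \<in> w \<Longrightarrow> agree n x x' \<Longrightarrow> y' \<in> T"
proof -
  obtain k where "\<And>z. agree k y z \<Longrightarrow> z \<in> T" using assms(3,4) unfolding open_iff_agree by metis
  then show thesis using rel_continuousD[OF assms(1,2), of k] that by metis
qed

lemma rel_continuous_comp: "rel_continuous v \<Longrightarrow> rel_continuous w \<Longrightarrow> rel_continuous (v O w)"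
  unfolding rel_continuous_def relcomp_unfold mem_Collect_eq split_conv by metis

lemma partial_homeo_converse: "partial_homeo w \<Longrightarrow> partial_homeo (w\<inverse>)"
  by (simp add: partial_homeo_def)

lemma partial_homeo_unique:
  assumes "partial_homeo w"
  shows "(x, y) \<in> w \<Longrightarrow> (x, y') \<in> w \<Longrightarrow> y = y'" "(x, y) \<in> w \<Longrightarrow> (x', y) \<in> w \<Longrightarrow> x = x'"
  using assms rel_continuous_unique[of w] rel_continuous_unique[of "w\<inverse>"]
  unfolding partial_homeo_def by auto

text \<open>Baire's theorem itself: the cylinders of longer and longer words \<open>b n\<close>, that of \<open>b (Suc n)\<close> being
  contained in that of \<open>b n\<close> and in \<open>U n\<close>, shrink to a point of all the \<open>U n\<close>.\<close>

lemma comeager_dense: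
  assumes "comeager S" shows "dense_set S"
  unfolding dense_set_def
proof
  fix a
  obtain U :: "nat \<Rightarrow> point set" where U: "\<And>n. open (U n)" "\<And>n. dense_set (U n)" "(\<Inter>n. U n) \<subseteq> S"
    using assms unfolding comeager_def by metis
  have step: "\<exists>b. cyl b \<subseteq> cyl c \<inter> U n \<and> length c < length b" for c n
  proof -
    obtain x where x: "x \<in> U n" "x \<in> cyl c" using U(2) unfolding dense_set_def by metis
    then obtain m where m: "\<And>y. agree m x y \<Longrightarrow> y \<in> U n"
      using U(1)[of n] unfolding open_iff_agree by metis
    have "cyl (init (Suc (max m (length c))) x) \<subseteq> cyl c \<inter> U n"
      using m cyl_agree[OF x(2)] agree_mono by (auto simp: max_def split: if_splits)
    then show ?thesis by (intro exI[of _ "init (Suc (max m (length c))) x"]) auto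
  qed
  define b where "b = rec_nat a (\<lambda>n c. SOME d. cyl d \<subseteq> cyl c \<inter> U n \<and> length c < length d)"
  have "cyl (b (Suc n)) \<subseteq> cyl (b n) \<inter> U n \<and> length (b n) < length (b (Suc n))" for n
    using someI_ex[OF step[of "b n" n]] by (simp add: b_def)
  then have b: "\<And>n. cyl (b (Suc n)) \<subseteq> cyl (b n) \<inter> U n" "\<And>n. length (b n) < length (b (Suc n))"
    "b 0 = a"
    by (auto simp: b_def)
  have dec: "cyl (b m) \<subseteq> cyl (b n)" if "n \<le> m" for n m
    by (rule lift_Suc_antimono_le[of "\<lambda>n. cyl (b n)", OF _ that]) (use b(1) in blast)
  have len: "n \<le> length (b n)" for n
    by (induction n) (auto intro: le_less_trans b(2) simp: Suc_le_eq)
  define z where "z n = (SOME x. x \<in> cyl (b n))" for n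
  have z: "z n \<in> cyl (b n)" for n using someI_ex[OF cyl_nonempty] by (simp add: z_def)
  define x where "x i = b (Suc i) ! i" for i
  have "x \<in> cyl (b n)" for n
  proof -
    have "x i = b n ! i" if i: "i < length (b n)" for i
    proof -
      define m where "m = max n (Suc i)"
      have "z m \<in> cyl (b n)" "z m \<in> cyl (b (Suc i))"
        using dec[of n m] dec[of "Suc i" m] z[of m] by (auto simp: m_def)
      then show ?thesis
        using i len[of "Suc i"] by (auto simp: cyl_def x_def)
    qed
    then show ?thesis by (simp add: cyl_def)
  qed
  then have xb: "x \<in> cyl (b n)" for n .
  have "x \<in> U n" for n using b(1)[of n] xb[of "Suc n"] by blast
  then show "\<exists>x\<in>S. x \<in> cyl a" using U(3) xb[of 0] b(3) by blast
qed

text \<open>For a dense open set \<open>U n\<close>, the points near which \<open>w\<close> takes values in \<open>U n\<close> only form an open set; it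
  is dense because \<open>w\<close> has a dense range and its inverse is continuous.\<close>

lemma comeager_vimage:
  assumes w: "partial_homeo w" and S: "comeager S"
  shows "comeager {x. \<exists>y\<in>S. (x, y) \<in> w}"
proof -
  have c: "rel_continuous w" and ci: "rel_continuous (w\<inverse>)" and dom: "comeager (Domain w)"
    and ran: "dense_set (Range w)"
    using w comeager_dense unfolding partial_homeo_def by auto
  obtain U :: "nat \<Rightarrow> point set" where U: "\<And>n. open (U n)" "\<And>n. dense_set (U n)" "(\<Inter>n. U n) \<subseteq> S"
    using S unfolding comeager_def by metis
  define V where "V n = {x. \<exists>m. \<forall>x' y'. (x', y') \<in> w \<longrightarrow> agree m x x' \<longrightarrow> y' \<in> U n}" for n
  have "comeager (V n)" for n
  proof (rule comeager_open_dense)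
    show "open (V n)"
      unfolding open_iff_agree
    proof
      fix x assume "x \<in> V n"
      then obtain m where m: "\<And>x' y'. (x', y') \<in> w \<Longrightarrow> agree m x x' \<Longrightarrow> y' \<in> U n"
        unfolding V_def by blast
      have "y \<in> V n" if "agree m x y" for y
        unfolding V_def using m agree_trans[OF that] by blast
      then show "\<exists>n'. \<forall>y. agree n' x y \<longrightarrow> y \<in> V n" by blast
    qed
    show "dense_set (V n)"
    proof (rule dense_setI)
      fix k x0
      obtain x y where xy: "(x, y) \<in> w" "agree k x0 x"
        using dense_setD[OF comeager_dense[OF dom]] by blast
      obtain j where j: "\<And>x' y'. (x', y') \<in> w \<Longrightarrow> agree j y y' \<Longrightarrow> agree k x x'"
        using rel_continuousD[OF ci, of y x k] xy(1) unfolding converse_iff by metis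
      obtain u where u: "u \<in> U n" "agree j y u" using dense_setD[OF U(2)] by blast
      obtain i where i: "\<And>z. agree i u z \<Longrightarrow> z \<in> U n" using U(1)[of n] u(1) unfolding open_iff_agree by metis
      obtain x' y' where xy': "(x', y') \<in> w" "agree (max i j) u y'" using dense_setD[OF ran] by blast
      have y': "y' \<in> U n" "agree j y y'"
        using i agree_mono[OF xy'(2)] agree_trans[OF u(2)] by auto
      then obtain m where "\<And>x'' y''. (x'', y'') \<in> w \<Longrightarrow> agree m x' x'' \<Longrightarrow> y'' \<in> U n"
        using rel_continuous_open[OF c xy'(1) U(1)] by metis
      then have "x' \<in> V n" unfolding V_def by blast
      moreover have "agree k x0 x'" using agree_trans[OF xy(2) j[OF xy'(1) y'(2)]] .
      ultimately show "\<exists>y\<in>V n. agree k x0 y" by blast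
    qed
  qed
  then have "comeager (Domain w \<inter> (\<Inter>n. V n))" using comeager_Int[OF dom comeager_INT] by blast
  then show ?thesis
  proof (rule comeager_mono, intro subsetI)
    fix x assume x: "x \<in> Domain w \<inter> (\<Inter>n. V n)"
    then obtain y where y: "(x, y) \<in> w" by blast
    have "y \<in> U n" for n
    proof -
      have "x \<in> V n" using x by blast
      then show ?thesis using y agree_refl unfolding V_def by blast
    qed
    then show "x \<in> {x. \<exists>y\<in>S. (x, y) \<in> w}" using U(3) y by blast
  qed
qed

lemma partial_homeo_comp:
  assumes v: "partial_homeo v" and w: "partial_homeo w" shows "partial_homeo (v O w)"
proof -
  have "comeager {x. \<exists>y\<in>Domain w. (x, y) \<in> v}" "comeager {y. \<exists>x\<in>Range v. (y, x) \<in> w\<inverse>}"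
    using comeager_vimage[OF v] comeager_vimage[OF partial_homeo_converse[OF w]] v w
    unfolding partial_homeo_def by auto
  moreover have "{x. \<exists>y\<in>Domain w. (x, y) \<in> v} \<subseteq> Domain (v O w)"
    "{y. \<exists>x\<in>Range v. (y, x) \<in> w\<inverse>} \<subseteq> Range (v O w)" by blast+
  ultimately have "comeager (Domain (v O w))" "comeager (Range (v O w))"
    using comeager_mono by blast+
  then show ?thesis
    using v w rel_continuous_comp[of v w] rel_continuous_comp[of "w\<inverse>" "v\<inverse>"]
    unfolding partial_homeo_def converse_relcomp by simp
qed

lemma partial_homeo_Id: "partial_homeo Id"
  using comeager_UNIV by (auto simp: partial_homeo_def rel_continuous_def)

definition unif_cont_on :: "prel \<Rightarrow> bool list \<Rightarrow> bool"
  where "unif_cont_on w a \<longleftrightarrow> (\<forall>k. \<exists>n. \<forall>x y x' y'. (x, y) \<in> w \<longrightarrow> (x', y') \<in> w \<longrightarrow>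
    x \<in> cyl a \<longrightarrow> x' \<in> cyl a \<longrightarrow> agree n x x' \<longrightarrow> agree k y y')"

text \<open>The second alternative excludes that \<open>w\<close> agrees with a continuous function on a compact open set.\<close>

definition erratic :: "prel \<Rightarrow> bool"
  where "erratic w \<longleftrightarrow> w \<subseteq> Id \<or> (\<forall>a. \<not> unif_cont_on w a)"

text \<open>A modulus of continuity of a densely defined part is one of the whole map.\<close>

lemma unif_cont_on_superset:
  assumes vw: "v \<subseteq> w" and v: "dense_set (Domain v)" and w: "rel_continuous w" and u: "unif_cont_on v a"
  shows "unif_cont_on w a"
  unfolding unif_cont_on_def
proof
  fix k
  obtain n where n: "\<And>x y x' y'. (x, y) \<in> v \<Longrightarrow> (x', y') \<in> v \<Longrightarrow>
    x \<in> cyl a \<Longrightarrow> x' \<in> cyl a \<Longrightarrow> agree n x x' \<Longrightarrow> agree k y y'"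
    using u unfolding unif_cont_on_def by metis
  have appr: "\<exists>x' y'. (x', y') \<in> v \<and> x' \<in> cyl a \<and> agree n x x' \<and> agree k y y'"
    if xy: "(x, y) \<in> w" "x \<in> cyl a" for x y
  proof -
    obtain m where m: "\<And>x' y'. (x', y') \<in> w \<Longrightarrow> agree m x x' \<Longrightarrow> agree k y y'"
      using rel_continuousD[OF w xy(1), of k] by metis
    obtain x' y' where v': "(x', y') \<in> v" "agree (max m (max n (length a))) x x'"
      using dense_setD[OF v] by blast
    then show ?thesis
      using m[of x' y'] vw cyl_agree[OF xy(2) v'(2)] agree_mono[OF v'(2)] by (intro exI[of _ x'] exI[of _ y']) auto
  qed
  show "\<exists>n. \<forall>x y x' y'. (x, y) \<in> w \<longrightarrow> (x', y') \<in> w \<longrightarrow>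
    x \<in> cyl a \<longrightarrow> x' \<in> cyl a \<longrightarrow> agree n x x' \<longrightarrow> agree k y y'"
  proof (intro exI[of _ n] allI impI)
    fix x y x' y'
    assume *: "(x, y) \<in> w" "(x', y') \<in> w" "x \<in> cyl a" "x' \<in> cyl a" "agree n x x'"
    obtain u z where u: "(u, z) \<in> v" "u \<in> cyl a" "agree n x u" "agree k y z" using appr[OF *(1,3)] by blast
    obtain u' z' where u': "(u', z') \<in> v" "u' \<in> cyl a" "agree n x' u'" "agree k y' z'" using appr[OF *(2,4)] by blast
    have "agree n u u'" using u(3) u'(3) *(5) by (simp add: agree_def)
    then have "agree k z z'" using n u u' by blast
    then show "agree k y y'" using u(4) u'(4) by (simp add: agree_def)
  qed
qed

lemma erratic_subset:
  assumes "v \<subseteq> w" "dense_set (Domain v)" "rel_continuous w" "erratic w"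
  shows "erratic v"
  using assms unif_cont_on_superset[OF assms(1-3)] unfolding erratic_def by blast

lemma erratic_moves:
  assumes w: "erratic w" "\<not> w \<subseteq> Id" and T: "open T" "T \<noteq> {}"
  shows "\<exists>x y. (x, y) \<in> w \<and> x \<in> T \<and> x \<noteq> y"
proof (rule ccontr)
  assume no: "\<not> ?thesis"
  obtain x n where x: "x \<in> T" "\<And>y. agree n x y \<Longrightarrow> y \<in> T" using T unfolding open_iff_agree by blast
  have "unif_cont_on w (init n x)"
    unfolding unif_cont_on_def in_cyl_init using no x(2) by metis
  then show False using w unfolding erratic_def by blast
qed

section \<open>Groups of partial homeomorphisms and words\<close>

definition homeo_group :: "prel set \<Rightarrow> bool"
  where "homeo_group \<Gamma> \<longleftrightarrow> Id \<in> \<Gamma> \<and> (\<forall>v\<in>\<Gamma>. \<forall>w\<in>\<Gamma>. v O w \<in> \<Gamma>) \<and> (\<forall>w\<in>\<Gamma>. w\<inverse> \<in> \<Gamma>) \<and>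
    (\<forall>w\<in>\<Gamma>. partial_homeo w)"

text \<open>Multiplication by one generator from the left reaches all words, and it is the form in which
  cancellations are easiest to follow.\<close>

inductive_set gen :: "prel set \<Rightarrow> prel set"
  for F where
    gen_Id: "Id \<in> gen F"
  | gen_left: "f \<in> F \<Longrightarrow> w \<in> gen F \<Longrightarrow> f O w \<in> gen F"
  | gen_inv: "f \<in> F \<Longrightarrow> w \<in> gen F \<Longrightarrow> f\<inverse> O w \<in> gen F"

lemma gen_mono: "F \<subseteq> F' \<Longrightarrow> gen F \<subseteq> gen F'"
proof
  fix w assume "F \<subseteq> F'" "w \<in> gen F"
  then show "w \<in> gen F'" by (induction rule: gen.induct[OF \<open>w \<in> gen F\<close>]) (auto intro: gen.intros)
qed

lemma gen_base: "f \<in> F \<Longrightarrow> f \<in> gen F" "f \<in> F \<Longrightarrow> f\<inverse> \<in> gen F"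
  using gen_left[OF _ gen_Id] gen_inv[OF _ gen_Id] by fastforce+

lemma gen_comp: "v \<in> gen F \<Longrightarrow> w \<in> gen F \<Longrightarrow> v O w \<in> gen F"
  by (induction rule: gen.induct) (auto simp: O_assoc intro: gen.intros)

lemma gen_converse: "v \<in> gen F \<Longrightarrow> v\<inverse> \<in> gen F"
proof (induction rule: gen.induct)
  case (gen_inv f w)
  then show ?case using gen_comp gen_base(1) by (simp add: converse_relcomp)
qed (auto simp: converse_relcomp intro: gen_Id gen_comp gen_base)

lemma homeo_group_gen:
  assumes "\<And>f. f \<in> F \<Longrightarrow> partial_homeo f" shows "homeo_group (gen F)"
proof -
  have "partial_homeo w" if "w \<in> gen F" for w
    using that
    by (induction rule: gen.induct) (auto intro: partial_homeo_Id partial_homeo_comp partial_homeo_converse assms)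
  then show ?thesis unfolding homeo_group_def using gen_Id gen_comp gen_converse by blast
qed

text \<open>At limit stages of the recursion this reduces statements about words to earlier stages.\<close>

lemma gen_finite_support:
  "w \<in> gen F \<Longrightarrow> \<exists>F0\<subseteq>F. finite F0 \<and> w \<in> gen F0"
proof (induction rule: gen.induct)
  case gen_Id
  then show ?case by (intro exI[of _ "{}"]) (auto intro: gen.gen_Id)
next
  case (gen_left f w)
  then obtain F0 where "F0 \<subseteq> F" "finite F0" "w \<in> gen F0" by blast
  then show ?case using gen_left gen_mono[of F0 "insert f F0"]
    by (intro exI[of _ "insert f F0"]) (auto intro: gen.gen_left)
next
  case (gen_inv f w)
  then obtain F0 where "F0 \<subseteq> F" "finite F0" "w \<in> gen F0" by blast
  then show ?case using gen_inv gen_mono[of F0 "insert f F0"]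
    by (intro exI[of _ "insert f F0"]) (auto intro: gen.gen_inv)
qed

lemma gen_subset_image_lists:
  "gen F \<subseteq> (\<lambda>l. foldr (\<lambda>(e, f) w. (if e then f else f\<inverse>) O w) l Id) ` lists ((UNIV :: bool set) \<times> F)"
    (is "_ \<subseteq> ?h ` _")
proof
  fix w assume "w \<in> gen F"
  then have "\<exists>l\<in>lists (UNIV \<times> F). w = ?h l"
  proof (induction rule: gen.induct)
    case gen_Id
    then show ?case by (intro bexI[of _ "[]"]) auto
  next
    case (gen_left f w)
    then obtain l where "l \<in> lists (UNIV \<times> F)" "w = ?h l" by blast
    then show ?case using gen_left by (intro bexI[of _ "(True, f) # l"]) auto
  next
    case (gen_inv f w)
    then obtain l where "l \<in> lists (UNIV \<times> F)" "w = ?h l" by blast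
    then show ?case using gen_inv by (intro bexI[of _ "(False, f) # l"]) auto
  qed
  then show "w \<in> ?h ` lists (UNIV \<times> F)" by blast
qed

lemma small_gen: assumes "small F" shows "small (gen F)"
  by (rule small_mono[OF gen_subset_image_lists])
    (intro small_image small_lists small_Times assms small_countable, auto)

lemma countable_gen: "countable F \<Longrightarrow> countable (gen F)"
  by (rule countable_subset[OF gen_subset_image_lists]) (intro countable_image countable_lists, auto)

definition orient :: "bool \<Rightarrow> ('a \<times> 'a) set \<Rightarrow> ('a \<times> 'a) set"
  where "orient e f = (if e then f else f\<inverse>)"

text \<open>The word \<open>g\<^sub>0 f\<^sup>\<plusminus> g\<^sub>1 f\<^sup>\<plusminus> \<dots> f\<^sup>\<plusminus> g\<^sub>n\<close>, applied from left to right.  It is reduced if no \<open>g\<^sub>i\<close> between two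
  opposite powers of \<open>f\<close> is a restriction of the identity; \<open>g\<^sub>0\<close> and \<open>g\<^sub>n\<close> have only one neighbour and
  are not restricted.\<close>

fun word :: "prel \<Rightarrow> prel \<Rightarrow> (bool \<times> prel) list \<Rightarrow> prel"
  where
    "word f g [] = g"
  | "word f g ((e, g') # ws) = g O orient e f O word f g' ws"

fun reduced :: "(bool \<times> prel) list \<Rightarrow> bool"
  where
    "reduced [] \<longleftrightarrow> True"
  | "reduced [s] \<longleftrightarrow> True"
  | "reduced ((e, g) # (e', g') # ws) \<longleftrightarrow> (e \<noteq> e' \<longrightarrow> \<not> g \<subseteq> Id) \<and> reduced ((e', g') # ws)"

lemma word_left: "h O word f g ws = word f (h O g) ws"
  by (cases "(f, g, ws)" rule: word.cases) (simp_all add: O_assoc)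

lemma word_homeo:
  assumes "homeo_group \<Gamma>" "partial_homeo f" "g \<in> \<Gamma>" "set ws \<subseteq> UNIV \<times> \<Gamma>"
  shows "partial_homeo (word f g ws)"
  using assms(3,4)
proof (induction ws arbitrary: g)
  case (Cons s ws)
  obtain e g' where s: "s = (e, g')" by (cases s)
  have "partial_homeo (orient e f)"
    using assms(2) partial_homeo_converse by (simp add: orient_def)
  then show ?case
    using Cons assms(1) unfolding s homeo_group_def by (auto intro!: partial_homeo_comp)
qed (use assms in \<open>auto simp: homeo_group_def\<close>)

text \<open>Put a letter \<open>f\<^sup>\<plusminus>\<close> in front of a reduced word.  Either the result is reduced, with the identity
  as the new first entry, or the letter cancels against the next one.  A cancellation enlarges the relation, because
  \<open>f O Id O f\<inverse>\<close> is only a part of the identity; this is why the conclusion is an inclusion.\<close>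

lemma gen_subset_reduced_word:
  assumes \<Gamma>: "homeo_group \<Gamma>" and f: "partial_homeo f" and F: "F \<subseteq> insert f \<Gamma>" and w: "w \<in> gen F"
  shows "\<exists>g ws. g \<in> \<Gamma> \<and> set ws \<subseteq> UNIV \<times> \<Gamma> \<and> reduced ws \<and> w \<subseteq> word f g ws"
proof -
  define red where "red v \<longleftrightarrow> (\<exists>g ws. g \<in> \<Gamma> \<and> set ws \<subseteq> UNIV \<times> \<Gamma> \<and> reduced ws \<and> v \<subseteq> word f g ws)" for v
  have G: "red (h O v)" if "red v" "h \<in> \<Gamma>" for h v
  proof -
    obtain g ws where *: "g \<in> \<Gamma>" "set ws \<subseteq> UNIV \<times> \<Gamma>" "reduced ws" "v \<subseteq> word f g ws"
      using \<open>red v\<close> unfolding red_def by metis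
    then have "h O v \<subseteq> word f (h O g) ws"
      unfolding word_left[symmetric] by (intro relcomp_mono) auto
    moreover have "h O g \<in> \<Gamma>" using \<Gamma> * that unfolding homeo_group_def by blast
    ultimately show ?thesis using * unfolding red_def by blast
  qed
  have Ff: "red (orient e f O v)" if "red v" for e v
  proof -
    obtain g ws where *: "g \<in> \<Gamma>" "set ws \<subseteq> UNIV \<times> \<Gamma>" "reduced ws" "v \<subseteq> word f g ws"
      using \<open>red v\<close> unfolding red_def by metis
    have Id: "Id \<in> \<Gamma>" using \<Gamma> unfolding homeo_group_def by blast
    show ?thesis
    proof (cases "\<exists>e' g' ws'. ws = (e', g') # ws' \<and> e \<noteq> e' \<and> g \<subseteq> Id")
      case True
      then obtain e' g' ws' where ws: "ws = (e', g') # ws'" "e \<noteq> e'" "g \<subseteq> Id" by metis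
      let ?W = "word f g' ws'"
      have can: "orient e f O orient e' f \<subseteq> Id"
      proof (intro subrelI)
        fix x z assume "(x, z) \<in> orient e f O orient e' f"
        then obtain y where y: "(x, y) \<in> orient e f" "(y, z) \<in> orient e' f" by blast
        have "e' = (\<not> e)" using ws(2) by auto
        with y have "(x, y) \<in> f \<and> (z, y) \<in> f \<or> (y, x) \<in> f \<and> (y, z) \<in> f"
          by (cases e) (simp_all add: orient_def)
        then have "x = z" using partial_homeo_unique[OF f] by metis
        then show "(x, z) \<in> Id" by simp
      qed
      have "orient e f O v \<subseteq> orient e f O (g O orient e' f O ?W)"
        using *(4) unfolding ws(1) by (intro relcomp_mono) auto
      also have "\<dots> \<subseteq> orient e f O (Id O orient e' f O ?W)"
        using ws(3) by (intro relcomp_mono) auto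
      also have "\<dots> = (orient e f O orient e' f) O ?W" by (simp add: O_assoc)
      also have "\<dots> \<subseteq> Id O ?W" using can by (intro relcomp_mono) auto
      finally have "orient e f O v \<subseteq> ?W" by simp
      moreover have "reduced ws'" using *(3) unfolding ws(1) by (cases ws') auto
      moreover have "g' \<in> \<Gamma>" "set ws' \<subseteq> UNIV \<times> \<Gamma>" using *(2) ws(1) by auto
      ultimately show ?thesis unfolding red_def by metis
    next
      case False
      then have "reduced ((e, g) # ws)"
        using *(3) by (cases "(e, g) # ws" rule: reduced.cases) (simp_all, metis)
      moreover have "orient e f O v \<subseteq> word f Id ((e, g) # ws)"
        using relcomp_mono[OF order_refl *(4), of "orient e f"] by simp
      ultimately show ?thesis using * Id unfolding red_def
        by (intro exI[of _ Id] exI[of _ "(e, g) # ws"]) auto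
    qed
  qed
  have "red w" using w
  proof (induction rule: gen.induct)
    case gen_Id
    have "Id \<in> \<Gamma>" using \<Gamma> unfolding homeo_group_def by blast
    then show ?case unfolding red_def by (intro exI[of _ Id] exI[of _ "[]"]) auto
  next
    case (gen_left h w)
    then show ?case using F G Ff[of w True] by (auto simp: orient_def)
  next
    case (gen_inv h w)
    then have "h = f \<or> h\<inverse> \<in> \<Gamma>" using F \<Gamma> unfolding homeo_group_def by (metis insertE subsetD)
    then show ?case using gen_inv G Ff[of w False] by (auto simp: orient_def)
  qed
  then show ?thesis unfolding red_def .
qed

section \<open>Finite approximations\<close>

text \<open>The points that may be matched when the cylinders \<open>cyl a\<close> and \<open>cyl b\<close> correspond to each other for
  all \<open>(a, b) \<in> T\<close>.  The set \<open>T\<close> cuts the space into finitely many pieces on both sides, according to the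
  cylinders to which a point belongs; balanced means that both sides have the same nonempty pieces.\<close>

definition box_rel :: "boxes \<Rightarrow> prel"
  where "box_rel T = {(x, y). \<forall>(a, b)\<in>T. x \<in> cyl a \<longleftrightarrow> y \<in> cyl b}"

definition balanced :: "boxes \<Rightarrow> bool"
  where "balanced T \<longleftrightarrow> finite T \<and> (\<forall>x. \<exists>y. (x, y) \<in> box_rel T) \<and> (\<forall>y. \<exists>x. (x, y) \<in> box_rel T)"

lemma box_rel_antimono: "T \<subseteq> T' \<Longrightarrow> box_rel T' \<subseteq> box_rel T"
  unfolding box_rel_def by blast

lemma box_relD: "(x, y) \<in> box_rel T \<Longrightarrow> (a, b) \<in> T \<Longrightarrow> x \<in> cyl a \<longleftrightarrow> y \<in> cyl b"
  unfolding box_rel_def by blast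

lemma box_rel_insert: "(x, y) \<in> box_rel (insert (a, b) T) \<longleftrightarrow> (x \<in> cyl a \<longleftrightarrow> y \<in> cyl b) \<and> (x, y) \<in> box_rel T"
  unfolding box_rel_def by auto

lemma box_rel_converse: "box_rel (T\<inverse>) = (box_rel T)\<inverse>"
  unfolding box_rel_def by auto

lemma balanced_converse: "balanced T \<Longrightarrow> balanced (T\<inverse>)"
  by (simp add: balanced_def box_rel_converse)

lemma box_rel_agree:
  assumes "finite T"
  shows "\<exists>m. \<forall>x y x' y'. (x, y) \<in> box_rel T \<longrightarrow> agree m x x' \<longrightarrow> agree m y y' \<longrightarrow> (x', y') \<in> box_rel T"
  using assms
proof (induction T)
  case empty
  then show ?case by (simp add: box_rel_def)
next
  case (insert t T)
  obtain a b where t: "t = (a, b)" by (cases t)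
  obtain m where m: "\<And>x y x' y'. (x, y) \<in> box_rel T \<Longrightarrow> agree m x x' \<Longrightarrow> agree m y y' \<Longrightarrow> (x', y') \<in> box_rel T"
    using insert by metis
  have cy: "z' \<in> cyl c \<longleftrightarrow> z \<in> cyl c" if "agree n z z'" "length c \<le> n" for z z' c n
    using cyl_agree that agree_sym by metis
  show ?case
  proof (intro exI[of _ "max m (max (length a) (length b))"] allI impI)
    fix x y x' y'
    assume *: "(x, y) \<in> box_rel (insert t T)" "agree (max m (max (length a) (length b))) x x'"
      "agree (max m (max (length a) (length b))) y y'"
    have "x' \<in> cyl a \<longleftrightarrow> x \<in> cyl a" "y' \<in> cyl b \<longleftrightarrow> y \<in> cyl b"
      using cy[OF *(2)] cy[OF *(3)] by auto
    moreover have "(x', y') \<in> box_rel T"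
      using *(1) m[of x y] agree_mono[OF *(2), of m] agree_mono[OF *(3), of m] unfolding t box_rel_insert by auto
    ultimately show "(x', y') \<in> box_rel (insert t T)"
      using *(1) unfolding t box_rel_insert by simp
  qed
qed

lemma separate_point:
  assumes "finite F" shows "\<exists>N. \<forall>n\<ge>N. \<forall>y\<in>F. agree n x y \<longrightarrow> y = x"
  using assms
proof (induction F)
  case (insert z F)
  then obtain N where N: "\<forall>n\<ge>N. \<forall>y\<in>F. agree n x y \<longrightarrow> y = x" by blast
  show ?case
  proof (cases "x = z")
    case False
    then obtain m where m: "\<not> agree m x z" using not_eq_imp_not_agree by blast
    show ?thesis
      by (rule exI[of _ "max m N"]) (use N m agree_mono in auto)
  qed (use N in auto)
qed simp

lemma separate_points:
  assumes "finite F" shows "\<exists>N. \<forall>x\<in>F. \<forall>y\<in>F. agree N x y \<longrightarrow> y = x"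
proof -
  have "\<forall>x. \<exists>N. \<forall>n\<ge>N. \<forall>y\<in>F. agree n x y \<longrightarrow> y = x" using separate_point[OF assms] by blast
  then obtain N where N: "\<And>x n y. n \<ge> N x \<Longrightarrow> y \<in> F \<Longrightarrow> agree n x y \<Longrightarrow> y = x" by metis
  show ?thesis
  proof (intro exI[of _ "Max (insert 0 (N ` F))"] ballI impI)
    fix x y assume *: "x \<in> F" "y \<in> F" "agree (Max (insert 0 (N ` F))) x y"
    have "N x \<le> Max (insert 0 (N ` F))" using * assms by (intro Max_ge) auto
    then show "y = x" using N * by blast
  qed
qed

text \<open>If the new cylinders around \<open>x\<close> and \<open>y\<close> are longer than everything in \<open>T\<close>, they are proper parts of
  matching pieces.  What is left of both pieces is nonempty, as the change of one late digit
  leads out of the new cylinder but not out of the piece, so the pieces still match.  Long cylinders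
  also separate \<open>x\<close> and \<open>y\<close> from the finitely many other points of \<open>s\<close>.\<close>

lemma balanced_insert:
  assumes T: "balanced T" and xy: "(x, y) \<in> box_rel T" and s: "finite s" "s \<subseteq> box_rel T"
    and sep: "\<And>x' y'. (x', y') \<in> s \<Longrightarrow> (x', y') = (x, y) \<or> x' \<noteq> x \<and> y' \<noteq> y"
  shows "\<exists>N. \<forall>n\<ge>N. balanced (insert (init n x, init n y) T) \<and> s \<subseteq> box_rel (insert (init n x, init n y) T)"
proof -
  obtain M where M: "\<And>u v u' v'. (u, v) \<in> box_rel T \<Longrightarrow> agree M u u' \<Longrightarrow> agree M v v' \<Longrightarrow> (u', v') \<in> box_rel T"
    using box_rel_agree T unfolding balanced_def by metis
  obtain N1 where N1: "\<And>n z. n \<ge> N1 \<Longrightarrow> z \<in> Domain s \<Longrightarrow> agree n x z \<Longrightarrow> z = x"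
    using separate_point[of "Domain s" x] s(1) finite_Domain by metis
  obtain N2 where N2: "\<And>n z. n \<ge> N2 \<Longrightarrow> z \<in> Range s \<Longrightarrow> agree n y z \<Longrightarrow> z = y"
    using separate_point[of "Range s" y] s(1) finite_Range by metis
  have "balanced (insert (init n x, init n y) T) \<and> s \<subseteq> box_rel (insert (init n x, init n y) T)"
    if n: "n \<ge> Suc M + N1 + N2" for n
  proof (intro conjI)
    obtain k where k: "n = Suc k" "M \<le> k" using n by (cases n) auto
    \<comment> \<open>The digit \<open>k\<close> is invisible to \<open>T\<close> but counts for the new cylinders.\<close>
    have push: "\<exists>z'. agree M z z' \<and> \<not> agree n q z'" if "agree n q z" for q z
    proof (intro exI conjI)
      show "agree M z (z(k := \<not> z k))" using k(2) by (auto simp: agree_def)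
      show "\<not> agree n q (z(k := \<not> z k))" using that k(1) by (auto simp: agree_def)
    qed
    show "balanced (insert (init n x, init n y) T)"
      unfolding balanced_def
    proof (intro conjI allI)
      show "finite (insert (init n x, init n y) T)" using T unfolding balanced_def by simp
      fix z
      show "\<exists>v. (z, v) \<in> box_rel (insert (init n x, init n y) T)"
      proof (cases "agree n x z")
        case True
        then have "(z, y) \<in> box_rel T" using M[OF xy] agree_mono[OF True, of M] n by auto
        then show ?thesis using True by (intro exI[of _ y]) (simp add: box_rel_insert)
      next
        case False
        obtain v where v: "(z, v) \<in> box_rel T" using T unfolding balanced_def by blast
        show ?thesis
        proof (cases "agree n y v")
          case True
          then obtain v' where "agree M v v'" "\<not> agree n y v'" using push by blast
          then show ?thesis using M[OF v] False by (intro exI[of _ v']) (simp add: box_rel_insert)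
        qed (use False v in \<open>auto simp: box_rel_insert\<close>)
      qed
      show "\<exists>u. (u, z) \<in> box_rel (insert (init n x, init n y) T)"
      proof (cases "agree n y z")
        case True
        then have "(x, z) \<in> box_rel T" using M[OF xy] agree_mono[OF True, of M] n by auto
        then show ?thesis using True by (intro exI[of _ x]) (simp add: box_rel_insert)
      next
        case False
        obtain v where v: "(v, z) \<in> box_rel T" using T unfolding balanced_def by blast
        show ?thesis
        proof (cases "agree n x v")
          case True
          then obtain v' where "agree M v v'" "\<not> agree n x v'" using push by blast
          then show ?thesis using M[OF v] False by (intro exI[of _ v']) (simp add: box_rel_insert)
        qed (use False v in \<open>auto simp: box_rel_insert\<close>)
      qed
    qed
    show "s \<subseteq> box_rel (insert (init n x, init n y) T)"
    proof (intro subrelI)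
      fix u v assume uv: "(u, v) \<in> s"
      have "agree n x u \<longleftrightarrow> agree n y v"
        using sep[OF uv] N1[of n u] N2[of n v] uv n by auto
      then show "(u, v) \<in> box_rel (insert (init n x, init n y) T)"
        using uv s(2) by (auto simp: box_rel_insert)
    qed
  qed
  then show ?thesis by blast
qed

definition coherent :: "boxes \<Rightarrow> bool"
  where "coherent \<T> \<longleftrightarrow> (\<forall>F. finite F \<longrightarrow> F \<subseteq> \<T> \<longrightarrow> (\<exists>T. F \<subseteq> T \<and> T \<subseteq> \<T> \<and> balanced T))"

text \<open>The map determined by a coherent set of boxes: \<open>x\<close> goes to \<open>y\<close> if arbitrarily small matching
  cylinders surround them.\<close>

definition limit_map :: "boxes \<Rightarrow> prel"
  where "limit_map \<T> = {(x, y) \<in> box_rel \<T>. \<forall>n. \<exists>(a, b)\<in>\<T>. n \<le> length a \<and> n \<le> length b \<and> x \<in> cyl a \<and> y \<in> cyl b}"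

lemma limit_map_converse: "limit_map (\<T>\<inverse>) = (limit_map \<T>)\<inverse>"
  unfolding limit_map_def box_rel_converse by auto

lemma coherent_converse: "coherent \<T> \<Longrightarrow> coherent (\<T>\<inverse>)"
  unfolding coherent_def by (metis balanced_converse converse_converse converse_mono finite_converse)

lemma rel_continuous_limit_map: "rel_continuous (limit_map \<T>)"
  unfolding rel_continuous_def
proof (intro allI impI)
  fix x y k assume "(x, y) \<in> limit_map \<T>"
  then obtain a b where ab: "(a, b) \<in> \<T>" "k \<le> length b" "x \<in> cyl a" "y \<in> cyl b"
    unfolding limit_map_def by blast
  show "\<exists>n. \<forall>x' y'. (x', y') \<in> limit_map \<T> \<longrightarrow> agree n x x' \<longrightarrow> agree k y y'"
  proof (intro exI[of _ "length a"] allI impI)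
    fix x' y' assume *: "(x', y') \<in> limit_map \<T>" "agree (length a) x x'"
    have "x' \<in> cyl a" using cyl_eq_agree[OF ab(3)] *(2) by blast
    then have "y' \<in> cyl b" using *(1) ab(1) box_relD unfolding limit_map_def by blast
    then show "agree k y y'" using cyl_eq_agree[OF ab(4)] agree_mono ab(2) by blast
  qed
qed

text \<open>Small cylinders around \<open>x\<close> on the left determine the digits of its image one after the other.
  By coherence any finitely many boxes are realised by some common point \<open>v\<close>, and hence the digits
  obtained from different boxes agree.\<close>

lemma Domain_limit_map:
  assumes co: "coherent \<T>"
    and x: "\<And>n. \<exists>(a, b)\<in>\<T>. n \<le> length a \<and> n \<le> length b \<and> x \<in> cyl a"
  shows "x \<in> Domain (limit_map \<T>)"
proof -
  have "\<forall>n. \<exists>a b. (a, b) \<in> \<T> \<and> n \<le> length a \<and> n \<le> length b \<and> x \<in> cyl a" using x by blast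
  then obtain a b where ab: "\<And>n. (a n, b n) \<in> \<T>" "\<And>n. n \<le> length (a n)" "\<And>n. n \<le> length (b n)"
    "\<And>n. x \<in> cyl (a n)" by metis
  have common: "\<exists>v. (x, v) \<in> box_rel F" if F: "finite F" "F \<subseteq> \<T>" for F
  proof -
    obtain T where T: "F \<subseteq> T" "T \<subseteq> \<T>" "balanced T" using co F unfolding coherent_def by metis
    then show ?thesis using box_rel_antimono[OF T(1)] unfolding balanced_def by blast
  qed
  define y where "y i = b (Suc i) ! i" for i
  have near: "agree n v y" if v: "(x, v) \<in> box_rel ((\<lambda>i. (a i, b i)) ` {..n})" for v n
    unfolding agree_def
  proof (intro allI impI)
    fix i assume i: "i < n"
    have "(a (Suc i), b (Suc i)) \<in> (\<lambda>i. (a i, b i)) ` {..n}" using i by auto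
    then have "v \<in> cyl (b (Suc i))" using box_relD[OF v] ab(4) by blast
    then show "v i = y i" using ab(3)[of "Suc i"] by (auto simp: cyl_def y_def)
  qed
  have cong: "x \<in> cyl c \<longleftrightarrow> y \<in> cyl d" if cd: "(c, d) \<in> \<T>" for c d
  proof -
    obtain v where v: "(x, v) \<in> box_rel (insert (c, d) ((\<lambda>i. (a i, b i)) ` {..length d}))"
      using common[of "insert (c, d) ((\<lambda>i. (a i, b i)) ` {..length d})"] cd ab(1) by blast
    then have "agree (length d) v y" using near box_rel_insert by blast
    then have "v \<in> cyl d \<longleftrightarrow> y \<in> cyl d" using cyl_agree agree_sym by blast
    then show ?thesis using v box_rel_insert by blast
  qed
  have "(x, y) \<in> limit_map \<T>"
    unfolding limit_map_def box_rel_def using cong ab by blast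
  then show ?thesis by blast
qed

lemma comeager_Domain_limit_map:
  assumes co: "coherent \<T>"
    and d: "\<And>c n. \<exists>(a, b)\<in>\<T>. n \<le> length a \<and> n \<le> length b \<and> cyl a \<subseteq> cyl c"
  shows "comeager (Domain (limit_map \<T>))"
proof -
  define U where "U n = (\<Union>(a, b)\<in>{(a, b)\<in>\<T>. n \<le> length a \<and> n \<le> length b}. cyl a)" for n
  have "comeager (U n)" for n
  proof (rule comeager_open_dense)
    show "open (U n)" unfolding U_def using open_cyl by auto
    show "dense_set (U n)"
      unfolding dense_set_def
    proof
      fix c
      obtain a b where ab: "(a, b) \<in> \<T>" "n \<le> length a" "n \<le> length b" "cyl a \<subseteq> cyl c" using d by blast
      obtain x where "x \<in> cyl a" using cyl_nonempty by blast
      then show "\<exists>x\<in>U n. x \<in> cyl c" using ab unfolding U_def by blast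
    qed
  qed
  then have "comeager (\<Inter>n. U n)" by (rule comeager_INT)
  then show ?thesis
    by (rule comeager_mono) (use Domain_limit_map[OF co] in \<open>fastforce simp: U_def\<close>)
qed

lemma partial_homeo_limit_map:
  assumes co: "coherent \<T>"
    and d1: "\<And>c n. \<exists>(a, b)\<in>\<T>. n \<le> length a \<and> n \<le> length b \<and> cyl a \<subseteq> cyl c"
    and d2: "\<And>c n. \<exists>(a, b)\<in>\<T>. n \<le> length a \<and> n \<le> length b \<and> cyl b \<subseteq> cyl c"
  shows "partial_homeo (limit_map \<T>)"
proof -
  have "comeager (Domain (limit_map (\<T>\<inverse>)))"
    by (rule comeager_Domain_limit_map[OF coherent_converse[OF co]]) (use d2 in fastforce)
  then show ?thesis
    unfolding partial_homeo_def using rel_continuous_limit_map[of \<T>] rel_continuous_limit_map[of "\<T>\<inverse>"]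
      comeager_Domain_limit_map[OF co d1] by (simp add: limit_map_converse)
qed

section \<open>The forcing poset\<close>

definition inj_rel :: "('a \<times> 'b) set \<Rightarrow> bool"
  where "inj_rel R \<longleftrightarrow> (\<forall>x y x' y'. (x, y) \<in> R \<longrightarrow> (x', y') \<in> R \<longrightarrow> (x = x' \<longleftrightarrow> y = y'))"

lemma inj_relD: "inj_rel R \<Longrightarrow> (x, y) \<in> R \<Longrightarrow> (x', y') \<in> R \<Longrightarrow> x = x' \<longleftrightarrow> y = y'"
  unfolding inj_rel_def by blast

lemma inj_rel_subset: "inj_rel R \<Longrightarrow> S \<subseteq> R \<Longrightarrow> inj_rel S"
  unfolding inj_rel_def by blast

text \<open>A chain is the orbit of \<open>p\<close> under a word in which each use of \<open>f\<close> is replaced by one of finitely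
  many given pairs \<open>es\<close>, in the order in which they are used.\<close>

fun chain :: "prel \<Rightarrow> (bool \<times> prel) list \<Rightarrow> point \<Rightarrow> point \<Rightarrow> (point \<times> point) list \<Rightarrow> bool"
  where
    "chain g [] p q es \<longleftrightarrow> es = [] \<and> (p, q) \<in> g"
  | "chain g ((e, g') # ws) p q [] \<longleftrightarrow> False"
  | "chain g ((e, g') # ws) p q ((l, r) # es) \<longleftrightarrow>
      (p, if e then l else r) \<in> g \<and> chain g' ws (if e then r else l) q es"

text \<open>Boxes around the pairs of a chain force every map that respects them to carry points near \<open>p\<close>
  to points near \<open>q\<close>.  The boxes are chosen from the end of the chain backwards, because the size of each depends
  on the modulus of continuity of what follows it.  The pairs in \<open>s\<close> stay matched.\<close>

lemma fix_chain:
  assumes "balanced T" "finite s" "s \<subseteq> box_rel T"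
    and "rel_continuous g" "\<forall>h\<in>snd ` set ws. rel_continuous h"
    and "chain g ws p q es" "set es \<subseteq> box_rel T" "distinct (map fst es)" "distinct (map snd es)"
    and "fst ` set es \<inter> Domain s = {}" "snd ` set es \<inter> Range s = {}"
  shows "\<exists>T'. T \<subseteq> T' \<and> balanced T' \<and> s \<subseteq> box_rel T' \<and>
    (\<exists>m. \<forall>f\<subseteq>box_rel T'. \<forall>u v. (u, v) \<in> word f g ws \<longrightarrow> agree m p u \<longrightarrow> agree k q v)"
  using assms
proof (induction g ws p q es arbitrary: s rule: chain.induct)
  case (1 g p q es)
  then have "(p, q) \<in> g" by simp
  then obtain m where "\<And>u v. (u, v) \<in> g \<Longrightarrow> agree m p u \<Longrightarrow> agree k q v"
    using rel_continuousD[OF 1(4)] by metis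
  then show ?case using 1 by (intro exI[of _ T]) auto
next
  case (3 g e g' ws p q l r es)
  define y where "y = (if e then l else r)"
  define x where "x = (if e then r else l)"
  have py: "(p, y) \<in> g" and ch: "chain g' ws x q es" using 3(7) by (simp_all add: x_def y_def)
  have rc: "rel_continuous g'" "\<forall>h\<in>snd ` set ws. rel_continuous h"
    using 3(6) by auto
  have "\<exists>T'. T \<subseteq> T' \<and> balanced T' \<and> insert (l, r) s \<subseteq> box_rel T' \<and>
    (\<exists>m. \<forall>f\<subseteq>box_rel T'. \<forall>u v. (u, v) \<in> word f g' ws \<longrightarrow> agree m x u \<longrightarrow> agree k q v)"
    unfolding x_def by (rule 3(1)) (use 3(2-5) 3(7-12) rc in auto)
  then obtain T1 m1 where T1: "T \<subseteq> T1" "balanced T1" "insert (l, r) s \<subseteq> box_rel T1"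
    and m1': "\<forall>f\<subseteq>box_rel T1. \<forall>u v. (u, v) \<in> word f g' ws \<longrightarrow> agree m1 x u \<longrightarrow> agree k q v"
    by (elim exE conjE) simp
  have m1: "agree k q v" if "f \<subseteq> box_rel T1" "(u, v) \<in> word f g' ws" "agree m1 x u" for f u v
    using m1' that by blast
  have "\<exists>N. \<forall>n\<ge>N. balanced (insert (init n l, init n r) T1) \<and> s \<subseteq> box_rel (insert (init n l, init n r) T1)"
  proof (rule balanced_insert[OF T1(2)])
    show "(l, r) \<in> box_rel T1" "s \<subseteq> box_rel T1" using T1(3) by auto
    show "(x', y') = (l, r) \<or> x' \<noteq> l \<and> y' \<noteq> r" if "(x', y') \<in> s" for x' y'
      using 3(11,12) that by auto
  qed (use 3 in auto)
  then obtain n where n: "n \<ge> m1" "balanced (insert (init n l, init n r) T1)"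
    "s \<subseteq> box_rel (insert (init n l, init n r) T1)" by (meson nat_le_linear)
  obtain m where m: "\<And>u v. (u, v) \<in> g \<Longrightarrow> agree m p u \<Longrightarrow> agree n y v"
    using rel_continuousD[OF 3(5) py] by metis
  have "agree k q v" if f: "f \<subseteq> box_rel (insert (init n l, init n r) T1)"
    and uv: "(u, v) \<in> word f g ((e, g') # ws)" "agree m p u" for f u v
  proof -
    obtain a b where ab: "(u, a) \<in> g" "(a, b) \<in> orient e f" "(b, v) \<in> word f g' ws" using uv(1) by auto
    have "agree n y a" using m ab(1) uv(2) by blast
    moreover have "agree n y a \<longleftrightarrow> agree n x b"
      using ab(2) f box_rel_insert unfolding orient_def x_def y_def by (cases e) auto
    ultimately have "agree m1 x b" using agree_mono n(1) by blast
    moreover have "f \<subseteq> box_rel T1" using f box_rel_antimono by blast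
    ultimately show ?thesis using m1 ab(3) by blast
  qed
  then show ?case using n T1(1) by (intro exI[of _ "insert (init n l, init n r) T1"]) blast
qed simp

text \<open>The auxiliary set \<open>Z\<close> supplies the points of promises and chains.  It is invariant under \<open>\<Gamma>\<close>, so
  that chains stay inside it, and disjoint from the points of commitments, so that promises never
  interfere with commitments.\<close>

locale forcing =
  fixes \<Gamma> :: "prel set" and Z :: "point set" and T0 :: "boxes"
    and colour :: "nat \<Rightarrow> prel"
  assumes group: "homeo_group \<Gamma>" and erratic: "\<And>w. w \<in> \<Gamma> \<Longrightarrow> erratic w" and small_\<Gamma>: "small \<Gamma>"
    and small_Z: "small Z" and dense_Z: "dense_set Z"
    and Z_Domain: "\<And>w z. w \<in> \<Gamma> \<Longrightarrow> z \<in> Z \<Longrightarrow> z \<in> Domain w"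
    and Z_inv: "\<And>w z y. w \<in> \<Gamma> \<Longrightarrow> z \<in> Z \<Longrightarrow> (z, y) \<in> w \<Longrightarrow> y \<in> Z"
    and T0: "balanced T0"
    and colour: "\<And>n. inj_rel (colour n)"
    and small_Domain: "small (Domain (\<Union>n. colour n))" and small_Range: "small (Range (\<Union>n. colour n))"
    and Domain_Z: "Domain (\<Union>n. colour n) \<inter> Z = {}" and Range_Z: "Range (\<Union>n. colour n) \<inter> Z = {}"
    and dense_right: "\<And>x. x \<in> Domain (\<Union>n. colour n) \<Longrightarrow> dense_set {y. (x, y) \<in> (\<Union>n. colour n)}"
    and dense_left: "\<And>y. y \<in> Range (\<Union>n. colour n) \<Longrightarrow> dense_set {x. (x, y) \<in> (\<Union>n. colour n)}"
begin

definition C :: "prel" where "C = (\<Union>n. colour n)"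

lemma group_cont: "w \<in> \<Gamma> \<Longrightarrow> rel_continuous w"
  using group unfolding homeo_group_def partial_homeo_def by blast

lemma group_homeo: "w \<in> \<Gamma> \<Longrightarrow> partial_homeo w"
  using group unfolding homeo_group_def by blast

lemma C_disjoint: "(x, y) \<in> C \<Longrightarrow> x \<notin> Z \<and> y \<notin> Z"
  using Domain_Z Range_Z unfolding C_def by blast

text \<open>An erratic \<open>g\<close> that is not a restriction of the identity moves some point of \<open>B\<close> and then, by continuity, all
  points of an open part of \<open>B\<close>; finitely many points and their preimages can be avoided there.\<close>

lemma select:
  assumes B: "open B" "B \<noteq> {}" and g: "g \<in> \<Gamma>" and F: "finite F1" "finite F2"
  obtains x y where "x \<in> Z" "x \<in> B" "(x, y) \<in> g" "x \<notin> F1" "y \<notin> F2" "\<not> g \<subseteq> Id \<Longrightarrow> y \<noteq> x" "y \<in> Z"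
proof -
  have "\<exists>B'. open B' \<and> B' \<noteq> {} \<and> B' \<subseteq> B \<and> (\<forall>x y. x \<in> B' \<longrightarrow> (x, y) \<in> g \<longrightarrow> \<not> g \<subseteq> Id \<longrightarrow> y \<noteq> x)"
  proof (cases "g \<subseteq> Id")
    case False
    obtain u v where uv: "(u, v) \<in> g" "u \<in> B" "u \<noteq> v"
      using erratic_moves[OF erratic[OF g] False B] by blast
    obtain k where k: "\<not> agree k u v" using not_eq_imp_not_agree[OF uv(3)] by blast
    obtain n where n: "\<And>x' y'. (x', y') \<in> g \<Longrightarrow> agree n u x' \<Longrightarrow> agree k v y'"
      using rel_continuousD[OF group_cont[OF g] uv(1)] by metis
    obtain i where i: "\<And>z. agree i u z \<Longrightarrow> z \<in> B" using B(1) uv(2) unfolding open_iff_agree by metis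
    define m where "m = max (max n k) i"
    show ?thesis
    proof (intro exI[of _ "cyl (init m u)"] conjI allI impI open_cyl)
      show "cyl (init m u) \<noteq> {}" by (metis agree_refl empty_iff in_cyl_init)
      show "cyl (init m u) \<subseteq> B"
        using i agree_mono[of m u _ i] by (auto simp: m_def)
      fix x y assume x: "x \<in> cyl (init m u)" "(x, y) \<in> g"
      then have "agree n u x" "agree k u x" using agree_mono[of m u x] by (auto simp: m_def)
      then have "agree k v y" "agree k u x" using n x(2) by auto
      then show "y \<noteq> x" using k by (auto simp: agree_def)
    qed
  qed (use B in blast)
  then obtain B' where B': "open B'" "B' \<noteq> {}" "B' \<subseteq> B" "\<And>x y. x \<in> B' \<Longrightarrow> (x, y) \<in> g \<Longrightarrow> \<not> g \<subseteq> Id \<Longrightarrow> y \<noteq> x"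
    by metis
  define F where "F = F1 \<union> {x. \<exists>y\<in>F2. (x, y) \<in> g}"
  have "{x. \<exists>y\<in>F2. (x, y) \<in> g} \<subseteq> (\<lambda>y. THE x. (x, y) \<in> g) ` F2"
  proof clarify
    fix x y assume "y \<in> F2" "(x, y) \<in> g"
    moreover from this have "(THE x. (x, y) \<in> g) = x"
      using partial_homeo_unique(2)[OF group_homeo[OF g]] by blast
    ultimately show "x \<in> (\<lambda>y. THE x. (x, y) \<in> g) ` F2" by force
  qed
  then have "finite F" unfolding F_def using F finite_subset by blast
  then obtain x where x: "x \<in> Z - F" "x \<in> B'"
    using dense_set_open[OF dense_set_minus_finite[OF _ dense_Z] B'(1,2)] by blast
  then obtain y where y: "(x, y) \<in> g" using Z_Domain[OF g] by blast
  show thesis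
    by (rule that[of x y]) (use x y B' Z_inv[OF g] in \<open>auto simp: F_def\<close>)
qed

lemma open_box_side:
  assumes "balanced T"
  shows "open {x. (y, x) \<in> orient e (box_rel T)}" "{x. (y, x) \<in> orient e (box_rel T)} \<noteq> {}"
proof -
  obtain m where m: "\<And>u v u' v'. (u, v) \<in> box_rel T \<Longrightarrow> agree m u u' \<Longrightarrow> agree m v v' \<Longrightarrow> (u', v') \<in> box_rel T"
    using box_rel_agree assms unfolding balanced_def by metis
  show "open {x. (y, x) \<in> orient e (box_rel T)}"
    unfolding open_iff_agree
  proof (intro ballI exI[of _ m] allI impI)
    fix x z assume "x \<in> {x. (y, x) \<in> orient e (box_rel T)}" "agree m x z"
    then show "z \<in> {x. (y, x) \<in> orient e (box_rel T)}"
      using m[of y x y z] m[of x y z y] by (auto simp: orient_def)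
  qed
  show "{x. (y, x) \<in> orient e (box_rel T)} \<noteq> {}"
    using assms unfolding balanced_def orient_def by auto
qed

text \<open>Each image under a power of \<open>f\<close> can be chosen freely in the piece that matches the current point.
  It has to be chosen so that the next letter \<open>g'\<close> leads to a point not yet used on the side
  from which \<open>f\<close> is applied next.  The used points are finitely many, and apart from them only
  \<open>x\<close> itself could be hit, namely when the direction of \<open>f\<close> changes; reducedness
  excludes that \<open>g'\<close> fixes \<open>x\<close> in this case.\<close>

lemma exists_chain:
  assumes T: "balanced T" and "g \<in> \<Gamma>" "set ws \<subseteq> UNIV \<times> \<Gamma>" "reduced ws"
    and "finite L" "finite R" "finite F" "(p, y) \<in> g" "y \<in> Z"
    and "case ws of [] \<Rightarrow> y \<notin> F | s # _ \<Rightarrow> y \<notin> (if fst s then L else R)"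
  shows "\<exists>q es. chain g ws p q es \<and> set es \<subseteq> box_rel T \<and> distinct (map fst es) \<and> distinct (map snd es) \<and>
    fst ` set es \<inter> L = {} \<and> snd ` set es \<inter> R = {} \<and> q \<notin> F"
  using assms(2-)
proof (induction ws arbitrary: g L R p y)
  case Nil
  then show ?case by (intro exI[of _ y] exI[of _ "[]"]) auto
next
  case (Cons s ws)
  obtain e g' where s: "s = (e, g')" by (cases s)
  have g': "g' \<in> \<Gamma>" using Cons.prems s by auto
  note B = open_box_side[OF T, of y e]
  have fin: "finite (if e then R else L)" "finite (L \<union> R \<union> F \<union> {y})" using Cons.prems by auto
  obtain x z where xz: "x \<in> Z" "(y, x) \<in> orient e (box_rel T)" "(x, z) \<in> g'" "x \<notin> (if e then R else L)"
    "z \<notin> L \<union> R \<union> F \<union> {y}" "\<not> g' \<subseteq> Id \<Longrightarrow> z \<noteq> x" "z \<in> Z"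
    by (rule select[OF B g' fin]) blast
  define l where "l = (if e then y else x)"
  define r where "r = (if e then x else y)"
  have ys: "y \<notin> (if e then L else R)" using Cons.prems s by simp
  have lr: "(l, r) \<in> box_rel T" "l \<notin> L" "r \<notin> R"
    using xz ys by (auto simp: l_def r_def orient_def split: if_splits)
  have "case ws of [] \<Rightarrow> z \<notin> F | s # _ \<Rightarrow> z \<notin> (if fst s then insert l L else insert r R)"
  proof (cases ws)
    case (Cons t ws')
    obtain e' h where t: "t = (e', h)" by (cases t)
    have "e \<noteq> e' \<longrightarrow> \<not> g' \<subseteq> Id" using Cons.prems(3) unfolding s Cons t by simp
    then show ?thesis using xz(5,6) unfolding Cons t by (cases e; cases e') (auto simp: l_def r_def)
  qed (use xz in auto)
  moreover have "reduced ws" using Cons.prems(3) s by (cases ws) auto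
  ultimately obtain q es where es: "chain g' ws x q es" "set es \<subseteq> box_rel T" "distinct (map fst es)"
    "distinct (map snd es)" "fst ` set es \<inter> insert l L = {}" "snd ` set es \<inter> insert r R = {}" "q \<notin> F"
    using Cons.IH[OF g', of "insert l L" "insert r R" x z] Cons.prems xz by auto
  show ?case
    by (intro exI[of _ q] exI[of _ "(l, r) # es"])
      (use es lr Cons.prems in \<open>auto simp: s l_def r_def\<close>)
qed

text \<open>Only the commitments need to be injective; promises may share points.\<close>

definition P :: "condition set"
  where "P = {(T, s). T0 \<subseteq> T \<and> balanced T \<and> finite s \<and> s \<subseteq> box_rel T \<and> s \<subseteq> C \<union> Z \<times> Z \<and> inj_rel (s \<inter> C)}"

definition ext :: "condition rel"
  where "ext = {((T', s'), (T, s)). (T', s') \<in> P \<and> (T, s) \<in> P \<and> T \<subseteq> T' \<and> s \<subseteq> s'}"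

lemma P_start: "(T0, {}) \<in> P"
  using T0 by (simp add: P_def inj_rel_def)

lemma partial_order_P: "partial_order_on P ext"
  unfolding partial_order_on_def preorder_on_def refl_on_def trans_def antisym_def ext_def by auto

lemma P_compatible:
  assumes "(T, s) \<in> P" "(x, y) \<in> s" "(x, y) \<in> C" "(x', y') \<in> s"
  shows "(x', y') = (x, y) \<or> x' \<noteq> x \<and> y' \<noteq> y"
proof (cases "(x', y') \<in> C")
  case True
  then show ?thesis
    using assms inj_relD[of "s \<inter> C" x y x' y'] unfolding P_def by auto
next
  case False
  then have "x' \<in> Z" "y' \<in> Z" using assms unfolding P_def by auto
  then show ?thesis using C_disjoint[OF assms(3)] by auto
qed

lemma add_box:
  assumes P: "(T, s) \<in> P" and xy: "(x, y) \<in> box_rel T"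
    and sep: "\<And>x' y'. (x', y') \<in> s \<Longrightarrow> (x', y') = (x, y) \<or> x' \<noteq> x \<and> y' \<noteq> y"
  obtains m where "n \<le> m" "(insert (init m x, init m y) T, s) \<in> P"
proof -
  have T: "balanced T" "finite s" "s \<subseteq> box_rel T" using P unfolding P_def by auto
  obtain N where N: "\<And>m. m \<ge> N \<Longrightarrow> balanced (insert (init m x, init m y) T) \<and> s \<subseteq> box_rel (insert (init m x, init m y) T)"
    using balanced_insert[OF T(1) xy T(2,3) sep] by metis
  then have "(insert (init (max n N) x, init (max n N) y) T, s) \<in> P"
    using P N[of "max n N"] unfolding P_def by auto
  then show thesis using that[of "max n N"] by simp
qed

lemma add_commitment:
  assumes "(T, s) \<in> P" "(x, y) \<in> C" "(x, y) \<in> box_rel T" "x \<notin> Domain (s \<inter> C)" "y \<notin> Range (s \<inter> C)"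
  shows "(T, insert (x, y) s) \<in> P"
proof -
  have "inj_rel (insert (x, y) s \<inter> C)"
    using assms unfolding P_def inj_rel_def by auto
  then show ?thesis using assms unfolding P_def by auto
qed

definition D_point :: "bool \<Rightarrow> point \<Rightarrow> nat \<Rightarrow> condition set"
  where "D_point e x n = {(T, s) \<in> P. \<exists>y. (x, y) \<in> orient e (s \<inter> C) \<and> (\<exists>(a, b)\<in>orient e T.
    n \<le> length a \<and> n \<le> length b \<and> x \<in> cyl a \<and> y \<in> cyl b)}"

definition D_cyl :: "bool \<Rightarrow> bool list \<Rightarrow> nat \<Rightarrow> condition set"
  where "D_cyl e c n = {(T, s) \<in> P. \<exists>(a, b)\<in>orient e T. n \<le> length a \<and> n \<le> length b \<and> cyl a \<subseteq> cyl c}"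

text \<open>A promise that has become impossible counts as settled.  So each of these sets is dense, and there are as many of
  them as pairs of points of \<open>Z\<close> and numbers.\<close>

definition D_near :: "point \<times> point \<Rightarrow> nat \<Rightarrow> condition set"
  where "D_near p n = {(T, s) \<in> P. p \<notin> box_rel T \<or>
    (\<exists>(a, b)\<in>T. cyl a \<subseteq> cyl (init n (fst p)) \<and> cyl b \<subseteq> cyl (init n (snd p)))}"

text \<open>The two promises at \<open>c'\<close> and the boxes of \<open>T\<close> together force the word with letters \<open>g0\<close>, \<open>f\<close>, \<open>g1\<close>, \<open>ws\<close> to take,
  arbitrarily close to \<open>c\<close>, values near \<open>u1\<close> and values near \<open>u2\<close>.\<close>

definition D_word :: "prel \<Rightarrow> bool \<Rightarrow> prel \<Rightarrow> (bool \<times> prel) list \<Rightarrow>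
    bool list \<Rightarrow> condition set"
  where "D_word g0 e g1 ws v = {(T, s) \<in> P. \<exists>c c' p q m k u1 u2.
    c \<in> Z \<inter> cyl v \<and> (c, c') \<in> g0 \<and> c' \<in> Z \<and> p \<in> Z \<and> q \<in> Z \<and> (c', p) \<in> orient e s \<and> (c', q) \<in> orient e s \<and>
    \<not> agree k u1 u2 \<and> (\<forall>f\<subseteq>box_rel T. \<forall>u w. (u, w) \<in> word f g1 ws \<longrightarrow>
      (agree m p u \<longrightarrow> agree k u1 w) \<and> (agree m q u \<longrightarrow> agree k u2 w))}"

lemma dense_side: "x \<in> Domain (orient e C) \<Longrightarrow> dense_set {y. (x, y) \<in> orient e C}"
  using dense_right dense_left unfolding C_def[symmetric] by (cases e) (simp_all add: orient_def)

text \<open>The possible partners of \<open>x\<close> are dense, so one of them lies in the piece that matches \<open>x\<close>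
  and is still free.\<close>

lemma commit:
  assumes P: "(T, s) \<in> P" and x: "x \<in> Domain (orient e C)"
  obtains s' y where "(T, s') \<in> P" "s \<subseteq> s'" "(x, y) \<in> orient e (s' \<inter> C)"
proof (cases "x \<in> Domain (orient e (s \<inter> C))")
  case True
  then show thesis using that[of s] P by blast
next
  case False
  let ?R = "Range (orient e (s \<inter> C))"
  have T: "balanced T" "finite ?R"
    using P by (auto simp: P_def orient_def finite_Range finite_Domain)
  have "dense_set ({y. (x, y) \<in> orient e C} - ?R)"
    by (rule dense_set_minus_finite[OF T(2) dense_side[OF x]])
  then obtain y where y: "(x, y) \<in> orient e C" "y \<notin> ?R" "(x, y) \<in> orient e (box_rel T)"
    using dense_set_open[OF _ open_box_side[OF T(1), of x e]] by blast
  define xy where "xy = (if e then (x, y) else (y, x))"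
  have "(T, insert xy s) \<in> P"
    using add_commitment[OF P, of x y] add_commitment[OF P, of y x] y False
    by (cases e) (auto simp: orient_def xy_def)
  moreover have "(x, y) \<in> orient e (insert xy s \<inter> C)"
    using y(1) by (cases e) (auto simp: orient_def xy_def)
  ultimately show thesis using that by blast
qed

lemma add_box_at_commitment:
  assumes P: "(T, s) \<in> P" and xy: "(x, y) \<in> s \<inter> C"
  obtains m where "n \<le> m" "(insert (init m x, init m y) T, s) \<in> P"
proof (rule add_box[OF P])
  show "(x, y) \<in> box_rel T" using P xy unfolding P_def by auto
qed (use P_compatible[OF P] xy in blast)+

lemma dense_D_point:
  assumes x: "x \<in> Domain (orient e C)" shows "dense_subset_of_poset P ext (D_point e x n)"
  unfolding dense_subset_of_poset_def
proof (intro conjI ballI)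
  show "D_point e x n \<subseteq> P" unfolding D_point_def by blast
  fix p assume p: "p \<in> P"
  obtain T s where Ts: "p = (T, s)" by (cases p)
  obtain s' y where s': "(T, s') \<in> P" "s \<subseteq> s'" "(x, y) \<in> orient e (s' \<inter> C)"
    using commit[OF p[unfolded Ts] x] .
  define l where "l = (if e then x else y)"
  define r where "r = (if e then y else x)"
  have "(l, r) \<in> s' \<inter> C" using s'(3) by (auto simp: l_def r_def orient_def split: if_splits)
  then obtain m where m: "n \<le> m" "(insert (init m l, init m r) T, s') \<in> P"
    using add_box_at_commitment[OF s'(1)] by blast
  have "(init m x, init m y) \<in> orient e (insert (init m l, init m r) T)"
    by (simp add: orient_def l_def r_def)
  then have "(insert (init m l, init m r) T, s') \<in> D_point e x n"
    using m s'(3) unfolding D_point_def mem_Collect_eq split_conv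
    by (intro conjI exI[of _ y] bexI[of _ "(init m x, init m y)"]) auto
  then show "\<exists>d\<in>D_point e x n. (d, p) \<in> ext"
    using s'(2) m(2) p unfolding Ts ext_def by (intro bexI) auto
qed

lemma cyl_init_subset: "x \<in> cyl c \<Longrightarrow> length c \<le> m \<Longrightarrow> cyl (init m x) \<subseteq> cyl c"
  using cyl_agree by auto

lemma add_box_near:
  assumes P: "(T, s) \<in> P" and cd: "(c, d) \<in> box_rel T"
  obtains x y m where "agree n c x" "agree n d y" "n \<le> m" "(insert (init m x, init m y) T, s) \<in> P"
proof -
  have fT: "finite T" using P unfolding P_def balanced_def by simp
  obtain M where M: "\<And>u v u' v'. (u, v) \<in> box_rel T \<Longrightarrow> agree M u u' \<Longrightarrow> agree M v v' \<Longrightarrow> (u', v') \<in> box_rel T"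
    using box_rel_agree[OF fT] by metis
  have fin: "finite (Domain s)" "finite (Range s)" using P by (auto simp: P_def finite_Range finite_Domain)
  obtain x where x: "x \<notin> Domain s" "agree (max n M) c x"
    using dense_setD[OF dense_set_minus_finite[OF fin(1) dense_Z]] by blast
  obtain y where y: "y \<notin> Range s" "agree (max n M) d y"
    using dense_setD[OF dense_set_minus_finite[OF fin(2) dense_Z]] by blast
  have xy: "(x, y) \<in> box_rel T" using M[OF cd] agree_mono[OF x(2)] agree_mono[OF y(2)] by auto
  obtain m where "n \<le> m" "(insert (init m x, init m y) T, s) \<in> P"
    by (rule add_box[OF P xy]) (use x y in blast)+
  then show thesis
    by (intro that[of x y m]) (use agree_mono[OF x(2)] agree_mono[OF y(2)] in auto)
qed

lemma dense_D_cyl: "dense_subset_of_poset P ext (D_cyl e c n)"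
  unfolding dense_subset_of_poset_def
proof (intro conjI ballI)
  show "D_cyl e c n \<subseteq> P" unfolding D_cyl_def by blast
  fix p assume p: "p \<in> P"
  obtain T s where Ts: "p = (T, s)" by (cases p)
  obtain x0 where x0: "x0 \<in> cyl c" using cyl_nonempty by blast
  have "balanced T" using p Ts by (simp add: P_def)
  then obtain l0 r0 where lr: "(l0, r0) \<in> box_rel T" "x0 = (if e then l0 else r0)"
    unfolding balanced_def by (metis (full_types))
  obtain l r m where m: "agree (n + length c) l0 l" "agree (n + length c) r0 r" "n + length c \<le> m"
    "(insert (init m l, init m r) T, s) \<in> P"
    using add_box_near[OF p[unfolded Ts] lr(1)] .
  define x where "x = (if e then l else r)"
  have "x \<in> cyl c" using cyl_agree[OF x0, of "n + length c" x] m(1,2) lr(2) by (simp add: x_def)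
  then have sub: "cyl (init m x) \<subseteq> cyl c" using cyl_init_subset m(3) by simp
  have "(init m x, init m (if e then r else l)) \<in> orient e (insert (init m l, init m r) T)"
    by (simp add: orient_def x_def)
  then have "(insert (init m l, init m r) T, s) \<in> D_cyl e c n"
    using m(3,4) sub unfolding D_cyl_def mem_Collect_eq split_conv
    by (intro conjI bexI[of _ "(init m x, init m (if e then r else l))"]) auto
  then show "\<exists>d\<in>D_cyl e c n. (d, p) \<in> ext"
    using m(4) p unfolding Ts ext_def by (intro bexI) auto
qed

lemma dense_D_near: "dense_subset_of_poset P ext (D_near cd n)"
  unfolding dense_subset_of_poset_def
proof (intro conjI ballI)
  show "D_near cd n \<subseteq> P" unfolding D_near_def by blast
  fix p assume p: "p \<in> P"
  obtain T s where Ts: "p = (T, s)" by (cases p)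
  obtain c d where cd: "cd = (c, d)" by (cases cd)
  show "\<exists>d\<in>D_near cd n. (d, p) \<in> ext"
  proof (cases "cd \<in> box_rel T")
    case False
    then show ?thesis using p partial_order_P unfolding Ts D_near_def ext_def by auto
  next
    case True
    obtain x y m where m: "agree n c x" "agree n d y" "n \<le> m" "(insert (init m x, init m y) T, s) \<in> P"
      using add_box_near[OF p[unfolded Ts] True[unfolded cd]] .
    have "cyl (init m x) \<subseteq> cyl (init n c)" "cyl (init m y) \<subseteq> cyl (init n d)"
      by (rule cyl_init_subset; use m in simp)+
    then show ?thesis
      using m p unfolding Ts D_near_def ext_def cd
      by (intro bexI[of _ "(insert (init m x, init m y) T, s)"]) auto
  qed
qed

text \<open>Choose \<open>c\<close> and two points \<open>p\<close>, \<open>q\<close> in the piece that matches its image \<open>c'\<close>, and continue \<open>p\<close> and \<open>q\<close>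
  to chains with different ends.  The second chain avoids the first, so all their pairs can be
  surrounded by boxes without separating \<open>c'\<close> from \<open>p\<close> or \<open>q\<close>.\<close>

lemma dense_D_word:
  assumes g0: "g0 \<in> \<Gamma>" and g1: "g1 \<in> \<Gamma>" and ws: "set ws \<subseteq> UNIV \<times> \<Gamma>" and red: "reduced ((e, g1) # ws)"
  shows "dense_subset_of_poset P ext (D_word g0 e g1 ws v)"
  unfolding dense_subset_of_poset_def
proof (intro conjI ballI)
  show "D_word g0 e g1 ws v \<subseteq> P" unfolding D_word_def by blast
  fix p0 assume p0: "p0 \<in> P"
  obtain T s where Ts: "p0 = (T, s)" by (cases p0)
  have T: "balanced T" and s: "finite s" "s \<subseteq> box_rel T" "s \<subseteq> C \<union> Z \<times> Z" using p0 Ts unfolding P_def by auto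
  have rws: "reduced ws" using red by (cases ws) auto
  have cont: "\<forall>h\<in>snd ` set ws. rel_continuous h"
    using group_cont ws by auto
  obtain c where c: "c \<in> Z" "c \<in> cyl v" using dense_Z unfolding dense_set_def by blast
  obtain c' where c': "(c, c') \<in> g0" "c' \<in> Z" using Z_Domain[OF g0 c(1)] Z_inv[OF g0 c(1)] by blast
  note B = open_box_side[OF T, of c' e]
  \<comment> \<open>\<open>c'\<close> is on the side from which \<open>f\<close> is first applied, \<open>p\<close> and \<open>q\<close> are on the other side.\<close>
  define side where "side A x = (A \<union> (if e then {} else {x}), A \<union> (if e then {x} else {}))" for A and x :: point
  define A0 where "A0 = Domain s \<union> Range s \<union> {c'}"
  have fA0: "finite A0" using s(1) by (simp add: A0_def finite_Domain finite_Range)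
  have turn: "case ws of [] \<Rightarrow> y \<notin> F | s # _ \<Rightarrow> y \<notin> (if fst s then fst (side A x) else snd (side A x))"
    if "y \<notin> F" "y \<notin> A" "\<not> g1 \<subseteq> Id \<Longrightarrow> y \<noteq> x" for y x A F
  proof (cases ws)
    case (Cons t ws')
    obtain e' h where t: "t = (e', h)" by (cases t)
    have "e \<noteq> e' \<longrightarrow> \<not> g1 \<subseteq> Id" using red unfolding Cons t by simp
    then show ?thesis using that unfolding Cons t by (cases e; cases e') (auto simp: side_def)
  qed (use that in auto)
  obtain p yp where p: "p \<in> Z" "(c', p) \<in> orient e (box_rel T)" "(p, yp) \<in> g1" "p \<notin> A0" "yp \<notin> A0"
    "\<not> g1 \<subseteq> Id \<Longrightarrow> yp \<noteq> p" "yp \<in> Z"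
    by (rule select[OF B g1 fA0 fA0]) blast
  have fs: "finite (fst (side A x))" "finite (snd (side A x))" if "finite A" for A x
    using that by (simp_all add: side_def)
  obtain u1 esp where esp: "chain g1 ws p u1 esp" "set esp \<subseteq> box_rel T" "distinct (map fst esp)" "distinct (map snd esp)"
    "fst ` set esp \<inter> fst (side A0 p) = {}" "snd ` set esp \<inter> snd (side A0 p) = {}"
    using exists_chain[OF T g1 ws rws fs[OF fA0] finite.emptyI p(3,7) turn] p(5,6) by (metis empty_iff)
  define A1 where "A1 = A0 \<union> {p, u1} \<union> fst ` set esp \<union> snd ` set esp"
  have fA1: "finite A1" using fA0 by (simp add: A1_def)
  obtain q yq where q: "q \<in> Z" "(c', q) \<in> orient e (box_rel T)" "(q, yq) \<in> g1" "q \<notin> A1" "yq \<notin> A1"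
    "\<not> g1 \<subseteq> Id \<Longrightarrow> yq \<noteq> q" "yq \<in> Z"
    by (rule select[OF B g1 fA1 fA1]) blast
  have yq1: "yq \<notin> {u1}" using q(5) by (simp add: A1_def)
  obtain u2 esq where esq: "chain g1 ws q u2 esq" "set esq \<subseteq> box_rel T" "distinct (map fst esq)" "distinct (map snd esq)"
    "fst ` set esq \<inter> fst (side A1 q) = {}" "snd ` set esq \<inter> snd (side A1 q) = {}" "u2 \<notin> {u1}"
    using exists_chain[OF T g1 ws rws fs[OF fA1] _ q(3,7) turn[OF yq1 q(5,6)]] by blast
  have "u1 \<noteq> u2" using esq(7) by auto
  then obtain k where k: "\<not> agree k u1 u2" using not_eq_imp_not_agree by blast
  define prom where "prom = orient e {(c', p), (c', q)}"
  have prom: "prom \<subseteq> box_rel T" "finite prom" "prom \<subseteq> Z \<times> Z"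
    using p q c' by (auto simp: prom_def orient_def)
  \<comment> \<open>While the first chain is fixed, the pairs of the second one are protected.\<close>
  define s2 where "s2 = s \<union> prom \<union> set esq"
  define s3 where "s3 = s \<union> prom"
  have q_side: "q \<notin> fst ` set esp" "q \<notin> snd ` set esp" using q(4) by (auto simp: A1_def)
  have avoid: "fst ` set esq \<inter> A1 = {}" "snd ` set esq \<inter> A1 = {}"
    using esq(5,6) by (auto simp: side_def split: if_splits)
  obtain T1 m1 where T1: "T \<subseteq> T1" "balanced T1" "s2 \<subseteq> box_rel T1"
    and m1: "\<And>f u w. f \<subseteq> box_rel T1 \<Longrightarrow> (u, w) \<in> word f g1 ws \<Longrightarrow> agree m1 p u \<Longrightarrow> agree k u1 w"
  proof -
    have a: "finite s2" "s2 \<subseteq> box_rel T" using s prom esq(2) by (auto simp: s2_def)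
    have "fst ` set esp \<inter> Domain s2 = {}"
    proof -
      have "fst ` set esp \<inter> Domain s = {}" using esp(5) by (auto simp: side_def A0_def)
      moreover have "fst ` set esp \<inter> Domain prom = {}"
        using esp(5) q_side by (auto simp: side_def A0_def prom_def orient_def split: if_splits)
      moreover have "fst ` set esp \<inter> Domain (set esq) = {}"
        using avoid(1) unfolding Domain_fst A1_def by blast
      ultimately show ?thesis unfolding s2_def by blast
    qed
    moreover have "snd ` set esp \<inter> Range s2 = {}"
    proof -
      have "snd ` set esp \<inter> Range s = {}" using esp(6) by (auto simp: side_def A0_def)
      moreover have "snd ` set esp \<inter> Range prom = {}"
        using esp(6) q_side by (auto simp: side_def A0_def prom_def orient_def split: if_splits)
      moreover have "snd ` set esp \<inter> Range (set esq) = {}"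
        using avoid(2) unfolding Range_snd A1_def by blast
      ultimately show ?thesis unfolding s2_def by blast
    qed
    ultimately have av: "fst ` set esp \<inter> Domain s2 = {}" "snd ` set esp \<inter> Range s2 = {}" by blast+
    obtain T' m where "T \<subseteq> T'" "balanced T'" "s2 \<subseteq> box_rel T'"
      "\<forall>f\<subseteq>box_rel T'. \<forall>u w. (u, w) \<in> word f g1 ws \<longrightarrow> agree m p u \<longrightarrow> agree k u1 w"
      using fix_chain[OF T a group_cont[OF g1] cont esp(1-4) av, where k=k] by (elim exE conjE) simp
    then show thesis by (intro that[of T' m]) simp_all
  qed
  obtain T2 m2 where T2: "T1 \<subseteq> T2" "balanced T2" "s3 \<subseteq> box_rel T2"
    and m2: "\<And>f u w. f \<subseteq> box_rel T2 \<Longrightarrow> (u, w) \<in> word f g1 ws \<Longrightarrow> agree m2 q u \<Longrightarrow> agree k u2 w"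
  proof -
    have a: "finite s3" "s3 \<subseteq> box_rel T1" "set esq \<subseteq> box_rel T1"
      using s prom T1(3) by (auto simp: s2_def s3_def)
    have "fst ` set esq \<inter> Domain prom = {}" "snd ` set esq \<inter> Range prom = {}"
      using avoid esq(5,6)
      by (cases e; auto simp: side_def A0_def A1_def prom_def orient_def)+
    moreover have "fst ` set esq \<inter> Domain s = {}"
      using avoid(1) unfolding A1_def A0_def by (simp add: Int_Un_distrib)
    moreover have "snd ` set esq \<inter> Range s = {}"
      using avoid(2) unfolding A1_def A0_def by (simp add: Int_Un_distrib)
    ultimately have av: "fst ` set esq \<inter> Domain s3 = {}" "snd ` set esq \<inter> Range s3 = {}"
      unfolding s3_def Domain_Un_eq Range_Un_eq Int_Un_distrib by simp_all
    obtain T' m where "T1 \<subseteq> T'" "balanced T'" "s3 \<subseteq> box_rel T'"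
      "\<forall>f\<subseteq>box_rel T'. \<forall>u w. (u, w) \<in> word f g1 ws \<longrightarrow> agree m q u \<longrightarrow> agree k u2 w"
      using fix_chain[OF T1(2) a(1,2) group_cont[OF g1] cont esq(1) a(3) esq(3,4) av, where k=k]
      by (elim exE conjE) simp
    then show thesis by (intro that[of T' m]) simp_all
  qed
  have "s3 \<inter> C = s \<inter> C" using prom(3) C_disjoint by (auto simp: s3_def)
  then have "(T2, s3) \<in> P"
    using p0 T1(1) T2 s prom unfolding Ts P_def by (auto simp: s3_def)
  moreover have "(c', p) \<in> orient e s3" "(c', q) \<in> orient e s3"
    by (auto simp: s3_def prom_def orient_def)
  moreover have "(agree (max m1 m2) p u \<longrightarrow> agree k u1 w) \<and> (agree (max m1 m2) q u \<longrightarrow> agree k u2 w)"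
    if f: "f \<subseteq> box_rel T2" "(u, w) \<in> word f g1 ws" for f u w
  proof -
    have "f \<subseteq> box_rel T1" using f(1) box_rel_antimono[OF T2(1)] by blast
    then show ?thesis
      using m1 m2 f agree_mono[of "max m1 m2" p u m1] agree_mono[of "max m1 m2" q u m2] by auto
  qed
  ultimately have "(T2, s3) \<in> D_word g0 e g1 ws v"
    unfolding D_word_def using c c' p(1) q(1) k by blast
  moreover have "((T2, s3), p0) \<in> ext"
    using \<open>(T2, s3) \<in> P\<close> p0 T1(1) T2(1) unfolding Ts ext_def by (auto simp: s3_def)
  ultimately show "\<exists>d\<in>D_word g0 e g1 ws v. (d, p0) \<in> ext" by blast
qed

end

context forcing
begin

text \<open>The centered classes: conditions with the same boxes \<open>T\<close> whose commitments lie in the same pairwise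
  disjoint pairs of cylinders, with one colour for each pair.\<close>

definition typed :: "bool list \<times> bool list \<times> nat \<Rightarrow> point \<times> point \<Rightarrow> bool"
  where "typed t xy \<longleftrightarrow> (case t of (a, b, n) \<Rightarrow> fst xy \<in> cyl a \<and> snd xy \<in> cyl b \<and> xy \<in> colour n)"

definition pattern :: "(bool list \<times> bool list \<times> nat) set \<Rightarrow> bool"
  where "pattern \<tau> \<longleftrightarrow> (\<forall>t\<in>\<tau>. \<forall>t'\<in>\<tau>. t \<noteq> t' \<longrightarrow>
    cyl (fst t) \<inter> cyl (fst t') = {} \<and> cyl (fst (snd t)) \<inter> cyl (fst (snd t')) = {})"

definition class_of :: "(bool list \<times> bool list) list \<Rightarrow> (bool list \<times> bool list \<times> nat) list \<Rightarrow>
    condition set"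
  where "class_of Ts \<tau> = {(T, s) \<in> P. T = set Ts \<and> pattern (set \<tau>) \<and> (\<forall>xy\<in>s \<inter> C. \<exists>t\<in>set \<tau>. typed t xy)}"

text \<open>Two commitments in different pairs of cylinders of the pattern differ on both sides, and two in the same
  pair have the same colour, which is injective.  Therefore finitely many conditions of one class
  have their union as a common lower bound.\<close>

lemma pattern_inj_rel:
  assumes \<tau>: "pattern \<tau>" and R: "\<And>xy. xy \<in> R \<Longrightarrow> \<exists>t\<in>\<tau>. typed t xy"
  shows "inj_rel R"
  unfolding inj_rel_def
proof (intro allI impI)
  fix x y x' y' assume xy: "(x, y) \<in> R" and xy': "(x', y') \<in> R"
  obtain a b n where t: "(a, b, n) \<in> \<tau>" "typed (a, b, n) (x, y)" using R[OF xy] by auto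
  obtain a' b' n' where t': "(a', b', n') \<in> \<tau>" "typed (a', b', n') (x', y')" using R[OF xy'] by auto
  have m: "x \<in> cyl a" "y \<in> cyl b" "(x, y) \<in> colour n" "x' \<in> cyl a'" "y' \<in> cyl b'" "(x', y') \<in> colour n'"
    using t(2) t'(2) by (simp_all add: typed_def)
  show "x = x' \<longleftrightarrow> y = y'"
  proof (cases "(a, b, n) = (a', b', n')")
    case True
    then show ?thesis using inj_relD[OF colour m(3), of x' y'] m(6) by simp
  next
    case False
    then have "cyl a \<inter> cyl a' = {} \<and> cyl b \<inter> cyl b' = {}"
      using \<tau>[unfolded pattern_def, rule_format, OF t(1) t'(1)] by simp
    then show ?thesis using m by (metis disjoint_iff)
  qed
qed

lemma ex_class:
  assumes P: "(T, s) \<in> P" shows "\<exists>Ts \<tau>. (T, s) \<in> class_of Ts \<tau>"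
proof -
  have fin: "finite T" "finite (s \<inter> C)" and inj: "inj_rel (s \<inter> C)"
    using P by (auto simp: P_def balanced_def)
  obtain Ts where Ts: "set Ts = T" using fin(1) finite_list by blast
  obtain l where l: "set l = s \<inter> C" using fin(2) finite_list by blast
  have "finite (Domain (s \<inter> C) \<union> Range (s \<inter> C))" using fin(2) by (simp add: finite_Domain finite_Range)
  from separate_points[OF this]
  obtain N where N: "\<And>x y. x \<in> Domain (s \<inter> C) \<union> Range (s \<inter> C) \<Longrightarrow> y \<in> Domain (s \<inter> C) \<union> Range (s \<inter> C) \<Longrightarrow>
    agree N x y \<Longrightarrow> y = x" by metis
  have "\<forall>xy. \<exists>n. xy \<in> C \<longrightarrow> xy \<in> colour n" by (auto simp: C_def)
  then obtain col where col: "\<And>xy. xy \<in> C \<Longrightarrow> xy \<in> colour (col xy)" by metis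
  define ty where "ty xy = (init N (fst xy), init N (snd xy), col xy)" for xy
  have disj: "cyl (init N x) \<inter> cyl (init N x') = {}" if "\<not> agree N x x'" for x x'
    using that by (auto simp: agree_def)
  have "pattern (ty ` (s \<inter> C))"
    unfolding pattern_def
  proof (intro ballI impI)
    fix t t' assume "t \<in> ty ` (s \<inter> C)" "t' \<in> ty ` (s \<inter> C)" and ne: "t \<noteq> t'"
    then obtain x y x' y' where t: "t = ty (x, y)" "t' = ty (x', y')" and m: "(x, y) \<in> s \<inter> C" "(x', y') \<in> s \<inter> C"
      by auto
    then have "x \<noteq> x' \<and> y \<noteq> y'" using inj_relD[OF inj m] ne by auto
    then have "\<not> agree N x x'" "\<not> agree N y y'" using N[of x x'] N[of y y'] m by blast+
    then show "cyl (fst t) \<inter> cyl (fst t') = {} \<and> cyl (fst (snd t)) \<inter> cyl (fst (snd t')) = {}"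
      using disj unfolding t ty_def by simp
  qed
  moreover have "typed (ty xy) xy" if "xy \<in> s \<inter> C" for xy
    using col that by (auto simp: typed_def ty_def)
  ultimately have "(T, s) \<in> class_of Ts (map ty l)"
    using P Ts l unfolding class_of_def by auto
  then show ?thesis by blast
qed

lemma centered_class: "centered_subset P ext (class_of Ts \<tau>)"
  unfolding centered_subset_def
proof (intro conjI allI impI)
  show "class_of Ts \<tau> \<subseteq> P" unfolding class_of_def by blast
  fix F assume F: "finite F \<and> F \<subseteq> class_of Ts \<tau>"
  show "\<exists>q\<in>P. \<forall>p\<in>F. (q, p) \<in> ext"
  proof (cases "F = {}")
    case False
    define s where "s = \<Union>(snd ` F)"
    have el: "p = (set Ts, snd p)" "p \<in> P" "\<forall>xy\<in>snd p \<inter> C. \<exists>t\<in>set \<tau>. typed t xy" "pattern (set \<tau>)"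
      if "p \<in> F" for p using F that unfolding class_of_def by auto
    have Pp: "(set Ts, snd p) \<in> P" if "p \<in> F" for p using el(1,2)[OF that] by metis
    have fin: "finite s" using F Pp unfolding s_def P_def by auto
    obtain p where "p \<in> F" using False by blast
    then have T: "T0 \<subseteq> set Ts" "balanced (set Ts)" using Pp unfolding P_def by auto
    have sub: "s \<subseteq> box_rel (set Ts)" "s \<subseteq> C \<union> Z \<times> Z" using Pp unfolding s_def P_def by blast+
    have "inj_rel (s \<inter> C)"
      by (rule pattern_inj_rel[of "set \<tau>"]) (use False el(3,4) in \<open>auto simp: s_def\<close>)
    then have q: "(set Ts, s) \<in> P" using fin T sub unfolding P_def by blast
    have "((set Ts, s), p) \<in> ext" if p: "p \<in> F" for p
      using q Pp[OF p] el(1)[OF p] p unfolding ext_def s_def by auto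
    then show ?thesis using q by blast
  qed (use P_start in blast)
qed

lemma sigma_centered_P: "sigma_centered P ext"
  unfolding sigma_centered_def
proof (intro exI conjI allI)
  define c where "c n = (case from_nat n of (Ts, \<tau>) \<Rightarrow> class_of Ts \<tau>)" for n
  show "centered_subset P ext (c n)" for n
    using centered_class by (simp add: c_def split: prod.split)
  show "P = (\<Union>n. c n)"
  proof (intro subset_antisym subsetI)
    fix p assume p: "p \<in> P"
    obtain T s where Ts: "p = (T, s)" by (cases p)
    then obtain Ts \<tau> where "p \<in> class_of Ts \<tau>" using ex_class p by metis
    then have "p \<in> c (to_nat (Ts, \<tau>))" by (simp add: c_def)
    then show "p \<in> (\<Union>n. c n)" by (rule UN_I[OF UNIV_I])
  next
    fix p assume "p \<in> (\<Union>n. c n)"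
    then obtain n where "p \<in> c n" by blast
    then show "p \<in> P"
      by (cases "from_nat n :: (bool list \<times> bool list) list \<times> (bool list \<times> bool list \<times> nat) list")
        (auto simp: c_def class_of_def)
  qed
qed

definition words :: "(prel \<times> bool \<times> prel \<times> (bool \<times> prel) list \<times> bool list) set"
  where "words = {(g0, e, g1, ws, v). g0 \<in> \<Gamma> \<and> g1 \<in> \<Gamma> \<and> set ws \<subseteq> UNIV \<times> \<Gamma> \<and> reduced ((e, g1) # ws)}"

definition tasks :: "condition set set"
  where "tasks = (\<Union>e. (\<lambda>(x, n). D_point e x n) ` (Domain (orient e C) \<times> UNIV) \<union> (\<lambda>(c, n). D_cyl e c n) ` UNIV) \<union>
    (\<lambda>(p, n). D_near p n) ` ((Z \<times> Z) \<times> UNIV) \<union> (\<lambda>(g0, e, g1, ws, v). D_word g0 e g1 ws v) ` words"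

lemma small_tasks: "small tasks"
proof -
  have "words \<subseteq> \<Gamma> \<times> UNIV \<times> \<Gamma> \<times> lists (UNIV \<times> \<Gamma>) \<times> UNIV"
    unfolding words_def by auto
  moreover have "small (\<Gamma> \<times> (UNIV :: bool set) \<times> \<Gamma> \<times> lists ((UNIV :: bool set) \<times> \<Gamma>) \<times> (UNIV :: bool list set))"
    by (intro small_Times small_lists small_\<Gamma> small_countable) auto
  ultimately have "small words" by (rule small_mono)
  moreover have "small (Domain (orient e C))" for e
    using small_Domain small_Range unfolding C_def[symmetric] by (cases e) (simp_all add: orient_def)
  ultimately show ?thesis
    unfolding tasks_def UNIV_bool
    by (auto intro!: small_Un small_image small_Times small_Z intro: small_countable)
qed

lemma D_point_task: "x \<in> Domain (orient e C) \<Longrightarrow> D_point e x n \<in> tasks"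
  unfolding tasks_def by (intro UnI1 UN_I[OF UNIV_I[of e]] image_eqI[of _ _ "(x, n)"]) auto

lemma D_cyl_task: "D_cyl e c n \<in> tasks"
  unfolding tasks_def by (intro UnI1 UN_I[OF UNIV_I[of e]] UnI2 image_eqI[of _ _ "(c, n)"]) auto

lemma dense_tasks: "D \<in> tasks \<Longrightarrow> dense_subset_of_poset P ext D"
  unfolding tasks_def words_def
  by (auto intro: dense_D_point dense_D_cyl dense_D_near dense_D_word)

text \<open>The map is read off from the boxes of a generic filter.  Commitments become values of \<open>f\<close>,
  since boxes shrink to them.  For a reduced word, take the two promises at \<open>c'\<close> of a condition in
  \<open>D_word\<close>: boxes near \<open>(c', p)\<close> and \<open>(c', q)\<close> occur in the filter, and generic points of these boxes give
  points near \<open>c\<close> with values far apart.\<close>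

theorem generic_map:
  assumes MA: MA_sigma_centered
  shows "\<exists>f. partial_homeo f \<and> f \<subseteq> box_rel T0 \<and> Domain C \<subseteq> Domain f \<and> Range C \<subseteq> Range f \<and>
    (\<forall>x y. (x, y) \<in> f \<longrightarrow> x \<in> Domain C \<or> y \<in> Range C \<longrightarrow> (x, y) \<in> C) \<and>
    (\<forall>g0 e g1 ws v. g0 \<in> \<Gamma> \<longrightarrow> g1 \<in> \<Gamma> \<longrightarrow> set ws \<subseteq> UNIV \<times> \<Gamma> \<longrightarrow> reduced ((e, g1) # ws) \<longrightarrow>
      \<not> unif_cont_on (word f g0 ((e, g1) # ws)) v)"
proof -
  have "has_generic_filters P ext"
    using MA_sigma_centered_any_type[OF MA _ partial_order_P sigma_centered_P] P_start by blast
  from this[unfolded has_generic_filters_def, rule_format, of tasks]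
  obtain G where G: "filter_on_poset P ext G" and meet: "\<And>D. D \<in> tasks \<Longrightarrow> G \<inter> D \<noteq> {}"
    using small_tasks dense_tasks unfolding small_def by auto
  have GP: "p \<in> P" if "p \<in> G" for p using G that unfolding filter_on_poset_def by blast
  have dir: "\<exists>T'' s''. (T'', s'') \<in> G \<and> T \<subseteq> T'' \<and> T' \<subseteq> T'' \<and> s \<subseteq> s'' \<and> s' \<subseteq> s''"
    if TT: "(T, s) \<in> G" "(T', s') \<in> G" for T s T' s'
  proof -
    obtain p where "p \<in> G" "(p, (T, s)) \<in> ext" "(p, (T', s')) \<in> ext"
      using G TT unfolding filter_on_poset_def by blast
    then show ?thesis unfolding ext_def by (cases p) auto
  qed
  define \<T> where "\<T> = \<Union>(fst ` G)"
  define S where "S = \<Union>(snd ` G)"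
  have in\<T>: "(T, s) \<in> G \<Longrightarrow> T \<subseteq> \<T>" for T s by (force simp: \<T>_def)
  have inS: "(T, s) \<in> G \<Longrightarrow> s \<subseteq> S" for T s by (force simp: S_def)
  have co: "coherent \<T>"
    unfolding coherent_def
  proof (intro allI impI)
    fix F assume F: "finite F" "F \<subseteq> \<T>"
    have "\<exists>T s. (T, s) \<in> G \<and> F \<subseteq> T"
      using F
    proof (induction F)
      case empty
      have "G \<noteq> {}" using G unfolding filter_on_poset_def by blast
      then show ?case by auto
    next
      case (insert t F)
      then obtain T s where T: "(T, s) \<in> G" "F \<subseteq> T" by auto
      obtain p where p: "p \<in> G" "t \<in> fst p" using insert.prems unfolding \<T>_def by auto
      then have "(fst p, snd p) \<in> G" by simp
      from dir[OF T(1) this] obtain T'' s'' where *: "(T'', s'') \<in> G" "T \<subseteq> T''" "fst p \<subseteq> T''"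
        by (elim exE conjE)
      then have "insert t F \<subseteq> T''" using T(2) p(2) by blast
      then show ?case using *(1) by (intro exI[of _ T''] exI[of _ s''] conjI)
    qed
    then obtain T s where T: "(T, s) \<in> G" "F \<subseteq> T" by (elim exE conjE)
    moreover have "balanced T" using GP[OF T(1)] by (simp add: P_def)
    ultimately show "\<exists>T. F \<subseteq> T \<and> T \<subseteq> \<T> \<and> balanced T" using in\<T>[OF T(1)] by (intro exI[of _ T] conjI)
  qed
  define f where "f = limit_map \<T>"
  have f_box: "f \<subseteq> box_rel T" if "(T, s) \<in> G" for T s
    using box_rel_antimono[OF in\<T>[OF that]] unfolding f_def limit_map_def by blast
  have S_box: "S \<subseteq> box_rel T" if T: "(T, s) \<in> G" for T s
  proof
    fix xy assume "xy \<in> S"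
    then obtain T' s' where T': "(T', s') \<in> G" "xy \<in> s'" unfolding S_def by auto
    from dir[OF T T'(1)] obtain T'' s'' where *: "(T'', s'') \<in> G" "T \<subseteq> T''" "s' \<subseteq> s''"
      by (elim exE conjE)
    then have "xy \<in> s''" using T'(2) by blast
    then have "xy \<in> box_rel T''" using GP[OF *(1)] unfolding P_def by blast
    then show "xy \<in> box_rel T" using box_rel_antimono[OF *(2)] by blast
  qed
  have S_box\<T>: "S \<subseteq> box_rel \<T>"
  proof
    fix xy assume xy: "xy \<in> S"
    have sub: "xy \<in> box_rel T" if "(T, s) \<in> G" for T s using S_box[OF that] xy by blast
    obtain x y where xy': "xy = (x, y)" by (cases xy)
    have "x \<in> cyl a \<longleftrightarrow> y \<in> cyl b" if ab: "(a, b) \<in> \<T>" for a b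
    proof -
      obtain p where "p \<in> G" "(a, b) \<in> fst p" using ab unfolding \<T>_def by auto
      then show ?thesis using sub[of "fst p" "snd p"] box_relD unfolding xy' by auto
    qed
    then show "xy \<in> box_rel \<T>" unfolding box_rel_def xy' by auto
  qed
  have S_inj: "inj_rel (S \<inter> C)"
    unfolding inj_rel_def
  proof (intro allI impI)
    fix x y x' y' assume *: "(x, y) \<in> S \<inter> C" "(x', y') \<in> S \<inter> C"
    then obtain T s T' s' where T: "(T, s) \<in> G" "(x, y) \<in> s" "(T', s') \<in> G" "(x', y') \<in> s'"
      unfolding S_def by auto
    from dir[OF T(1,3)] obtain T'' s'' where **: "(T'', s'') \<in> G" "s \<subseteq> s''" "s' \<subseteq> s''"
      by (elim exE conjE)
    then have "inj_rel (s'' \<inter> C)" using GP[OF **(1)] by (simp add: P_def)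
    then show "x = x' \<longleftrightarrow> y = y'" by (rule inj_relD) (use * ** T in auto)
  qed
  have \<T>_cyl: "\<exists>(a, b)\<in>orient e \<T>. n \<le> length a \<and> n \<le> length b \<and> cyl a \<subseteq> cyl c" for e c n
  proof -
    have "D_cyl e c n \<in> tasks" by (rule D_cyl_task)
    from meet[OF this] obtain T s where T: "(T, s) \<in> G" "(T, s) \<in> D_cyl e c n" by auto
    then have "\<exists>(a, b)\<in>orient e T. n \<le> length a \<and> n \<le> length b \<and> cyl a \<subseteq> cyl c"
      unfolding D_cyl_def by simp
    moreover have "orient e T \<subseteq> orient e \<T>" using in\<T>[OF T(1)] by (auto simp: orient_def)
    ultimately show ?thesis by (elim bexE) (rule bexI, assumption, erule subsetD)
  qed
  have homeo: "partial_homeo f"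
    unfolding f_def
  proof (rule partial_homeo_limit_map[OF co])
    show "\<exists>(a, b)\<in>\<T>. n \<le> length a \<and> n \<le> length b \<and> cyl a \<subseteq> cyl c" for c n
      using \<T>_cyl[of True] by (simp add: orient_def)
    show "\<exists>(a, b)\<in>\<T>. n \<le> length a \<and> n \<le> length b \<and> cyl b \<subseteq> cyl c" for c n
      using \<T>_cyl[of False n c] by (auto simp: orient_def)
  qed
  have ends: "\<exists>y. (x, y) \<in> orient e (f \<inter> C)" if x: "x \<in> Domain (orient e C)" for x e
  proof -
    have "\<exists>y. (x, y) \<in> orient e (S \<inter> C) \<and> (\<exists>(a, b)\<in>orient e \<T>.
      n \<le> length a \<and> n \<le> length b \<and> x \<in> cyl a \<and> y \<in> cyl b)" for n
    proof -
      have "D_point e x n \<in> tasks" by (rule D_point_task[OF x])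
      from meet[OF this] obtain T s where T: "(T, s) \<in> G" "(T, s) \<in> D_point e x n" by auto
      from T(2) obtain y a b where *: "(x, y) \<in> orient e (s \<inter> C)" "(a, b) \<in> orient e T"
        "n \<le> length a" "n \<le> length b" "x \<in> cyl a" "y \<in> cyl b"
        unfolding D_point_def by auto
      have "orient e (s \<inter> C) \<subseteq> orient e (S \<inter> C)" "orient e T \<subseteq> orient e \<T>"
        using in\<T>[OF T(1)] inS[OF T(1)] by (auto simp: orient_def)
      then have "(x, y) \<in> orient e (S \<inter> C)" "(a, b) \<in> orient e \<T>" using *(1,2) by (simp_all add: subsetD)
      then show ?thesis using *(3-) by (intro exI[of _ y] conjI bexI[of _ "(a, b)"]) auto
    qed
    then have "\<forall>n. \<exists>y. (x, y) \<in> orient e (S \<inter> C) \<and> (\<exists>(a, b)\<in>orient e \<T>.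
      n \<le> length a \<and> n \<le> length b \<and> x \<in> cyl a \<and> y \<in> cyl b)" by (rule allI)
    from choice[OF this] obtain y where *: "\<forall>n. (x, y n) \<in> orient e (S \<inter> C) \<and> (\<exists>(a, b)\<in>orient e \<T>.
      n \<le> length a \<and> n \<le> length b \<and> x \<in> cyl a \<and> y n \<in> cyl b)" ..
    have y: "(x, y n) \<in> orient e (S \<inter> C)"
      "\<exists>(a, b)\<in>orient e \<T>. n \<le> length a \<and> n \<le> length b \<and> x \<in> cyl a \<and> y n \<in> cyl b" for n
      using * by blast+
    have "inj_rel (orient e (S \<inter> C))" using S_inj by (auto simp: orient_def inj_rel_def)
    then have same: "y n = y 0" for n using inj_relD[OF _ y(1)[of n] y(1)[of 0]] by simp
    have box: "\<exists>(a, b)\<in>orient e \<T>. n \<le> length a \<and> n \<le> length b \<and> x \<in> cyl a \<and> y 0 \<in> cyl b" for n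
      using y(2)[of n] unfolding same[of n] .
    have "(x, y 0) \<in> limit_map (orient e \<T>)"
      using y(1)[of 0] S_box\<T> box unfolding limit_map_def by (cases e) (auto simp: orient_def box_rel_converse)
    then have "(x, y 0) \<in> orient e f" by (cases e) (simp_all add: orient_def f_def limit_map_converse)
    then show ?thesis using y(1)[of 0] by (cases e) (auto simp: orient_def)
  qed
  have left: "\<exists>y. (x, y) \<in> f \<inter> C" if "x \<in> Domain C" for x
    using ends[of x True] that by (simp add: orient_def)
  have right: "\<exists>x. (x, y) \<in> f \<inter> C" if "y \<in> Range C" for y
    using ends[of y False] that by (simp add: orient_def)
  have only: "(x, y) \<in> C" if xy: "(x, y) \<in> f" "x \<in> Domain C \<or> y \<in> Range C" for x y
    using xy(2)
  proof
    assume "x \<in> Domain C"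
    then obtain y' where "(x, y') \<in> f \<inter> C" using left by blast
    then show ?thesis using partial_homeo_unique(1)[OF homeo xy(1), of y'] by blast
  next
    assume "y \<in> Range C"
    then obtain x' where "(x', y) \<in> f \<inter> C" using right by blast
    then show ?thesis using partial_homeo_unique(2)[OF homeo xy(1), of x'] by blast
  qed
  have wild: "\<not> unif_cont_on (word f g0 ((e, g1) # ws)) v"
    if g0: "g0 \<in> \<Gamma>" and g1: "g1 \<in> \<Gamma>" and ws: "set ws \<subseteq> UNIV \<times> \<Gamma>" and red: "reduced ((e, g1) # ws)" for g0 e g1 ws v
  proof
    assume uc: "unif_cont_on (word f g0 ((e, g1) # ws)) v"
    have "(g0, e, g1, ws, v) \<in> words" using g0 g1 ws red unfolding words_def by blast
    then have "D_word g0 e g1 ws v \<in> tasks" unfolding tasks_def by force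
    from meet[OF this] obtain T s where Ts: "(T, s) \<in> G" "(T, s) \<in> D_word g0 e g1 ws v" by auto
    then obtain c c' p q m k u1 u2 where c: "c \<in> Z" "c \<in> cyl v" "(c, c') \<in> g0" "c' \<in> Z" and p: "p \<in> Z" and q: "q \<in> Z"
      and prom: "(c', p) \<in> orient e s" "(c', q) \<in> orient e s" and k: "\<not> agree k u1 u2"
      and F: "\<forall>f\<subseteq>box_rel T. \<forall>u w. (u, w) \<in> word f g1 ws \<longrightarrow>
        (agree m p u \<longrightarrow> agree k u1 w) \<and> (agree m q u \<longrightarrow> agree k u2 w)"
      unfolding D_word_def by auto
    have F': "(agree m p u \<longrightarrow> agree k u1 w) \<and> (agree m q u \<longrightarrow> agree k u2 w)" if "(u, w) \<in> word f g1 ws" for u w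
      using F f_box[OF Ts(1)] that by blast
    obtain n where n: "\<And>x y x' y'. (x, y) \<in> word f g0 ((e, g1) # ws) \<Longrightarrow> (x', y') \<in> word f g0 ((e, g1) # ws) \<Longrightarrow>
      x \<in> cyl v \<Longrightarrow> x' \<in> cyl v \<Longrightarrow> agree n x x' \<Longrightarrow> agree k y y'"
      using uc unfolding unif_cont_on_def by metis
    define N where "N = max n (length v)"
    have w1: "partial_homeo (word f g1 ws)" by (rule word_homeo[OF group homeo g1 ws])
    have fe: "partial_homeo (orient e f)" using homeo partial_homeo_converse by (simp add: orient_def)
    obtain j where j: "\<And>x y. (x, y) \<in> g0 \<Longrightarrow> agree j c' y \<Longrightarrow> agree N c x"
    proof -
      have "rel_continuous (g0\<inverse>)" using group_homeo[OF g0] unfolding partial_homeo_def by blast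
      from rel_continuousD[OF this, of c' c N] c(3) show thesis using that unfolding converse_iff by metis
    qed
    have near: "\<exists>x y. (x, y) \<in> word f g0 ((e, g1) # ws) \<and> agree N c x \<and> (\<exists>u. agree m r u \<and> (u, y) \<in> word f g1 ws)"
      if r: "r \<in> Z" "(c', r) \<in> orient e s" for r
    proof -
      \<comment> \<open>A box near \<open>(c', r)\<close> contains points at which everything in sight is defined.\<close>
      define t where "t = max j m"
      define pr where "pr = (if e then (c', r) else (r, c'))"
      have pr: "pr \<in> Z \<times> Z" "pr \<in> S" using r c(4) inS[OF Ts(1)] by (auto simp: pr_def orient_def split: if_splits)
      then have "D_near pr t \<in> tasks" unfolding tasks_def by force
      from meet[OF this] obtain T' s' where T': "(T', s') \<in> G" "(T', s') \<in> D_near pr t" by auto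
      have "pr \<in> box_rel T'" using S_box[OF T'(1)] pr(2) by blast
      then obtain a b where ab: "(a, b) \<in> T'" "cyl a \<subseteq> cyl (init t (fst pr))" "cyl b \<subseteq> cyl (init t (snd pr))"
        using T'(2) unfolding D_near_def by blast
      define a' where "a' = (if e then a else b)"
      have a': "cyl a' \<subseteq> cyl (init t c')" using ab by (auto simp: a'_def pr_def split: if_splits)
      have "comeager (Domain (orient e f O word f g1 ws) \<inter> Range g0)"
        using partial_homeo_comp[OF fe w1] group_homeo[OF g0] comeager_Int unfolding partial_homeo_def by blast
      then obtain y where "y \<in> Domain (orient e f O word f g1 ws) \<inter> Range g0" and ya: "y \<in> cyl a'"
        using comeager_dense unfolding dense_set_def by blast
      then obtain x z w where xz: "(x, y) \<in> g0" "(y, z) \<in> orient e f" "(z, w) \<in> word f g1 ws" by blast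
      have "agree t c' y" using a' ya by auto
      moreover have "agree t r z"
      proof -
        have "z \<in> cyl (if e then b else a)"
          using xz(2) ya box_relD[OF subsetD[OF f_box[OF T'(1)]] ab(1)]
          by (cases e) (auto simp: orient_def a'_def)
        moreover have "cyl (if e then b else a) \<subseteq> cyl (init t r)" using ab by (auto simp: pr_def)
        ultimately show ?thesis unfolding in_cyl_init[symmetric] by blast
      qed
      ultimately have "agree j c' y" "agree m r z" using agree_mono by (auto simp: t_def)
      then show ?thesis using j xz by auto
    qed
    obtain x y u where x: "(x, y) \<in> word f g0 ((e, g1) # ws)" "agree N c x" "agree m p u" "(u, y) \<in> word f g1 ws"
      using near[OF p prom(1)] by blast
    obtain x' y' u' where x': "(x', y') \<in> word f g0 ((e, g1) # ws)" "agree N c x'" "agree m q u'" "(u', y') \<in> word f g1 ws"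
      using near[OF q prom(2)] by blast
    have "agree k u1 y" "agree k u2 y'" using F' x x' by blast+
    moreover have "x \<in> cyl v" "x' \<in> cyl v"
      using cyl_agree[OF c(2) x(2)] cyl_agree[OF c(2) x'(2)] by (simp_all add: N_def)
    moreover have "agree n x x'" using x(2) x'(2) by (simp add: agree_def N_def)
    ultimately have "agree k u1 u2" using n[OF x(1) x'(1)] by (simp add: agree_def)
    then show False using k by blast
  qed
  have "f \<subseteq> box_rel T0"
  proof -
    obtain T s where T: "(T, s) \<in> G" using G unfolding filter_on_poset_def by auto
    have "T0 \<subseteq> T" using GP[OF T] by (simp add: P_def)
    then show ?thesis using f_box[OF T] box_rel_antimono by blast
  qed
  then show ?thesis using homeo left right only wild by blast
qed

end

lemma ex_regular_point:
  assumes MA: MA_sigma_centered and \<Gamma>: "\<And>w. w \<in> \<Gamma> \<Longrightarrow> partial_homeo w" "small \<Gamma>" and X: "small X"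
  shows "\<exists>z\<in>cyl a. (\<forall>w\<in>\<Gamma>. z \<in> Domain w) \<and> (\<forall>w\<in>\<Gamma>. \<forall>x\<in>X. (z, x) \<notin> w)"
proof -
  define S where "S i = (case i of Inl w \<Rightarrow> Domain w | Inr (w, x) \<Rightarrow> {z. (z, x) \<notin> w})"
    for i :: "prel + (prel \<times> point)"
  have "\<exists>z\<in>cyl a. \<forall>i\<in>Inl ` \<Gamma> \<union> Inr ` (\<Gamma> \<times> X). z \<in> S i"
  proof (rule MA_comeager[OF MA])
    show "small (Inl ` \<Gamma> \<union> Inr ` (\<Gamma> \<times> X))" by (intro small_Un small_image small_Times assms)
    fix i assume i: "i \<in> Inl ` \<Gamma> \<union> Inr ` (\<Gamma> \<times> X)"
    then show "comeager (S i)"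
    proof
      assume "i \<in> Inl ` \<Gamma>"
      then show ?thesis using \<Gamma>(1) by (auto simp: S_def partial_homeo_def)
    next
      assume "i \<in> Inr ` (\<Gamma> \<times> X)"
      then obtain w x where wx: "i = Inr (w, x)" "w \<in> \<Gamma>" by auto
      have "- {THE z. (z, x) \<in> w} \<subseteq> {z. (z, x) \<notin> w}"
        using partial_homeo_unique(2)[OF \<Gamma>(1)[OF wx(2)]] by (auto intro!: the_equality[symmetric])
      then show ?thesis using comeager_mono[OF comeager_Compl_point] by (simp add: S_def wx)
    qed
  qed
  then obtain z where z: "z \<in> cyl a" "\<And>i. i \<in> Inl ` \<Gamma> \<union> Inr ` (\<Gamma> \<times> X) \<Longrightarrow> z \<in> S i" by blast
  have "z \<in> Domain w" if "w \<in> \<Gamma>" for w using z(2)[of "Inl w"] that by (simp add: S_def)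
  moreover have "(z, x) \<notin> w" if "w \<in> \<Gamma>" "x \<in> X" for w x
    using z(2)[of "Inr (w, x)"] that by (simp add: S_def)
  ultimately show ?thesis using z(1) by blast
qed

text \<open>The set \<open>Z\<close> of the poset is generated by one generic point in each cylinder.  Every word of the larger family is
  contained in a reduced word, to which either the old family or \<open>generic_map\<close> applies.\<close>

theorem extend_group:
  assumes MA: MA_sigma_centered
    and F: "\<And>f. f \<in> F \<Longrightarrow> partial_homeo f" "\<And>w. w \<in> gen F \<Longrightarrow> erratic w" "small F"
    and T0: "balanced T0" and col: "\<And>n::nat. inj_rel (colour n)"
    and X: "small X" "Domain (\<Union>n. colour n) = X" "Range (\<Union>n. colour n) = X"
    and d: "\<And>x. x \<in> X \<Longrightarrow> dense_set {y. (x, y) \<in> (\<Union>n. colour n)}"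
      "\<And>y. y \<in> X \<Longrightarrow> dense_set {x. (x, y) \<in> (\<Union>n. colour n)}"
  shows "\<exists>f. partial_homeo f \<and> f \<subseteq> box_rel T0 \<and> X \<subseteq> Domain f \<and> X \<subseteq> Range f \<and>
    (\<forall>x y. (x, y) \<in> f \<longrightarrow> x \<in> X \<or> y \<in> X \<longrightarrow> (x, y) \<in> (\<Union>n. colour n)) \<and>
    (\<forall>w\<in>gen (insert f F). erratic w)"
proof -
  have group: "homeo_group (gen F)" using homeo_group_gen F(1) by blast
  have gh: "partial_homeo w" if "w \<in> gen F" for w using group that unfolding homeo_group_def by blast
  have gc: "v O w \<in> gen F" "v\<inverse> \<in> gen F" if "v \<in> gen F" "w \<in> gen F" for v w
    using that gen_comp gen_converse by blast+
  have sG: "small (gen F)" using small_gen F(3) by blast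
  obtain z where z: "\<And>a. z a \<in> cyl a" "\<And>a w. w \<in> gen F \<Longrightarrow> z a \<in> Domain w"
    "\<And>a w x. w \<in> gen F \<Longrightarrow> x \<in> X \<Longrightarrow> (z a, x) \<notin> w"
    using ex_regular_point[OF MA gh sG X(1)] by metis
  define Z where "Z = {y. \<exists>a. \<exists>w\<in>gen F. (z a, y) \<in> w}"
  have zZ: "z a \<in> Z" for a using gen_Id unfolding Z_def by blast
  interpret forcing "gen F" Z T0 colour
  proof
    show "small Z"
    proof (rule small_if_parametrized[where f = "\<lambda>(a, w). THE y. (z a, y) \<in> w"])
      show "small ((UNIV :: bool list set) \<times> gen F)" by (intro small_Times sG small_countable) auto
      fix y assume "y \<in> Z"
      then obtain a w where aw: "w \<in> gen F" "(z a, y) \<in> w" unfolding Z_def by blast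
      then have "y = (THE y. (z a, y) \<in> w)"
        using partial_homeo_unique(1)[OF gh] by (auto intro!: the_equality[symmetric])
      then show "\<exists>i\<in>UNIV \<times> gen F. y = (case i of (a, w) \<Rightarrow> THE y. (z a, y) \<in> w)"
        using aw by (intro bexI[of _ "(a, w)"]) auto
    qed
    show "dense_set Z" unfolding dense_set_def using zZ z(1) by blast
    fix w v assume w: "w \<in> gen F" and v: "v \<in> Z"
    then obtain a u where u: "u \<in> gen F" "(z a, v) \<in> u" unfolding Z_def by blast
    have "z a \<in> Domain (u O w)" using z(2) gen_comp[OF u(1) w] by blast
    then show "v \<in> Domain w" using partial_homeo_unique(1)[OF gh[OF u(1)] u(2)] by blast
    fix y assume "(v, y) \<in> w"
    then show "y \<in> Z" unfolding Z_def using gen_comp[OF u(1) w] u(2) by blast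
  next
    show "Domain (\<Union>n. colour n) \<inter> Z = {}" "Range (\<Union>n. colour n) \<inter> Z = {}"
      unfolding X using z(3) unfolding Z_def by blast+
  qed (use group F sG T0 col X d in auto)
  obtain f where f: "partial_homeo f" "f \<subseteq> box_rel T0" "X \<subseteq> Domain f" "X \<subseteq> Range f"
    "\<And>x y. (x, y) \<in> f \<Longrightarrow> x \<in> X \<or> y \<in> X \<Longrightarrow> (x, y) \<in> (\<Union>n. colour n)"
    "\<And>g0 e g1 ws v. g0 \<in> gen F \<Longrightarrow> g1 \<in> gen F \<Longrightarrow> set ws \<subseteq> UNIV \<times> gen F \<Longrightarrow> reduced ((e, g1) # ws) \<Longrightarrow>
      \<not> unif_cont_on (word f g0 ((e, g1) # ws)) v"
    using generic_map[OF MA] unfolding C_def X by metis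
  have "erratic w" if w: "w \<in> gen (insert f F)" for w
  proof -
    have "insert f F \<subseteq> insert f (gen F)" using gen_base by blast
    from gen_subset_reduced_word[OF group f(1) this w]
    obtain g ws where gw: "g \<in> gen F" "set ws \<subseteq> UNIV \<times> gen F" "reduced ws" "w \<subseteq> word f g ws" by blast
    have "erratic (word f g ws)"
    proof (cases ws)
      case Nil
      then show ?thesis using F(2) gw(1) by simp
    next
      case (Cons s ws')
      obtain e g1 where "s = (e, g1)" by (cases s)
      then show ?thesis using f(6)[of g g1 ws' e] gw Cons unfolding erratic_def by auto
    qed
    moreover have "rel_continuous (word f g ws)"
      using word_homeo[OF group f(1) gw(1,2)] unfolding partial_homeo_def by blast
    moreover have "dense_set (Domain w)"
    proof -
      have "homeo_group (gen (insert f F))" using homeo_group_gen F(1) f(1) by blast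
      then show ?thesis using w comeager_dense unfolding homeo_group_def partial_homeo_def by blast
    qed
    ultimately show ?thesis using erratic_subset gw(4) by blast
  qed
  then show ?thesis using f by blast
qed

section \<open>Partial homeomorphisms given on a dense set\<close>

text \<open>The pairs \<open>(x, y)\<close> such that \<open>E\<close> tends to \<open>y\<close> at \<open>x\<close> and its inverse tends to \<open>x\<close> at \<open>y\<close>.  If \<open>E\<close> is
  a homeomorphism between dense sets, this is its largest extension to a homeomorphism.\<close>

definition closure_map :: "prel \<Rightarrow> prel"
  where "closure_map E = {(x, y). \<forall>k. \<exists>n. \<forall>z z'. (z, z') \<in> E \<longrightarrow>
    (agree n x z \<longrightarrow> agree k y z') \<and> (agree n y z' \<longrightarrow> agree k x z)}"

lemma closure_map_converse: "closure_map (E\<inverse>) = (closure_map E)\<inverse>"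
  unfolding closure_map_def by auto blast+

lemma closure_mapD:
  assumes "(x, y) \<in> closure_map E"
  shows "\<exists>n. \<forall>z z'. (z, z') \<in> E \<longrightarrow> (agree n x z \<longrightarrow> agree k y z') \<and> (agree n y z' \<longrightarrow> agree k x z)"
  using assms unfolding closure_map_def by simp

lemma rel_continuous_closure_map:
  assumes E: "dense_set (Domain E)" shows "rel_continuous (closure_map E)"
  unfolding rel_continuous_def
proof (intro allI impI)
  fix x y k assume xy: "(x, y) \<in> closure_map E"
  obtain n where n: "\<And>z z'. (z, z') \<in> E \<Longrightarrow> agree n x z \<Longrightarrow> agree k y z'"
    using closure_mapD[OF xy, of k] by metis
  have "agree k y y'" if xy': "(x', y') \<in> closure_map E" "agree n x x'" for x' y'
  proof -
    obtain n' where n': "\<And>z z'. (z, z') \<in> E \<Longrightarrow> agree n' x' z \<Longrightarrow> agree k y' z'"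
      using closure_mapD[OF xy'(1), of k] by metis
    obtain z z' where z: "(z, z') \<in> E" "agree (max n n') x' z" using dense_setD[OF E] by blast
    have "agree n x' z" "agree n' x' z" using agree_mono[OF z(2)] by auto
    then have "agree k y z'" "agree k y' z'" using n n' z(1) agree_trans[OF xy'(2)] by blast+
    then show ?thesis by (simp add: agree_def)
  qed
  then show "\<exists>n. \<forall>x' y'. (x', y') \<in> closure_map E \<longrightarrow> agree n x x' \<longrightarrow> agree k y y'" by blast
qed

text \<open>The points near which \<open>E\<close> and its inverse are constant up to the digit \<open>k\<close> form an open set,
  which is dense because it contains the domain; the intersection of these sets is the domain.\<close>

lemma comeager_Domain_closure_map:
  assumes E: "dense_set (Domain E)" and d: "dense_set (Domain (closure_map E))"
  shows "comeager (Domain (closure_map E))"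
proof -
  define Q where "Q k x n b \<longleftrightarrow> k \<le> length b \<and>
    (\<forall>z z'. (z, z') \<in> E \<longrightarrow> (agree n x z \<longrightarrow> z' \<in> cyl b) \<and> (z' \<in> cyl b \<longrightarrow> agree k x z))" for k x n b
  define U where "U k = {x. \<exists>n b. Q k x n b}" for k
  have "comeager (U k)" for k
  proof (rule comeager_open_dense)
    show "open (U k)"
      unfolding open_iff_agree
    proof
      fix x assume "x \<in> U k"
      then obtain n b where Q: "Q k x n b" unfolding U_def by blast
      have "Q k x' n b" if "agree (max n k) x x'" for x'
      proof -
        have "agree n x x'" "agree k x x'" using agree_mono[OF that] by auto
        then show ?thesis using Q unfolding Q_def by (meson agree_sym agree_trans)
      qed
      then show "\<exists>n. \<forall>y. agree n x y \<longrightarrow> y \<in> U k" unfolding U_def by blast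
    qed
    have "Domain (closure_map E) \<subseteq> U k"
    proof
      fix x assume "x \<in> Domain (closure_map E)"
      then obtain y where xy: "(x, y) \<in> closure_map E" by blast
      obtain n1 where n1: "\<And>z z'. (z, z') \<in> E \<Longrightarrow> agree n1 y z' \<Longrightarrow> agree k x z"
        using closure_mapD[OF xy, of k] by metis
      obtain n2 where n2: "\<And>z z'. (z, z') \<in> E \<Longrightarrow> agree n2 x z \<Longrightarrow> agree (max n1 k) y z'"
        using closure_mapD[OF xy, of "max n1 k"] by metis
      have "Q k x n2 (init (max n1 k) y)"
        unfolding Q_def using n1 n2 agree_mono[of "max n1 k" y _ n1] by auto
      then show "x \<in> U k" unfolding U_def by blast
    qed
    then show "dense_set (U k)" using dense_set_mono d by blast
  qed
  then have "comeager (\<Inter>k. U k)" by (rule comeager_INT)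
  moreover have "(\<Inter>k. U k) \<subseteq> Domain (closure_map E)"
  proof
    fix x assume "x \<in> (\<Inter>k. U k)"
    then have "\<forall>k. \<exists>nb. Q k x (fst nb) (snd nb)" unfolding U_def by auto
    from choice[OF this] obtain nb where nb: "\<And>k. Q k x (fst (nb k)) (snd (nb k))" by blast
    define n where "n k = fst (nb k)" for k
    define b where "b k = snd (nb k)" for k
    have Q: "Q k x (n k) (b k)" for k using nb by (simp add: n_def b_def)
    define y where "y i = b (Suc i) ! i" for i
    have y: "y \<in> cyl (b k)" for k
    proof -
      have "y i = b k ! i" if i: "i < length (b k)" for i
      proof -
        obtain z z' where z: "(z, z') \<in> E" "agree (max (n k) (n (Suc i))) x z" using dense_setD[OF E] by blast
        have "z' \<in> cyl (b k)" "z' \<in> cyl (b (Suc i))"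
          using Q[of k] Q[of "Suc i"] z(1) agree_mono[OF z(2)] unfolding Q_def by auto
        moreover have "i < length (b (Suc i))" using Q[of "Suc i"] by (simp add: Q_def)
        ultimately show ?thesis using i by (auto simp: cyl_def y_def)
      qed
      then show ?thesis by (simp add: cyl_def)
    qed
    have "(x, y) \<in> closure_map E"
      unfolding closure_map_def mem_Collect_eq split_conv
    proof
      fix k
      have "(agree (max (n k) (length (b k))) x z \<longrightarrow> agree k y z') \<and>
          (agree (max (n k) (length (b k))) y z' \<longrightarrow> agree k x z)" if z: "(z, z') \<in> E" for z z'
      proof (intro conjI impI)
        assume "agree (max (n k) (length (b k))) x z"
        then have "z' \<in> cyl (b k)" using Q[of k] z agree_mono unfolding Q_def by auto
        then show "agree k y z'" using cyl_eq_agree[OF y, of z' k] agree_mono Q[of k] unfolding Q_def by blast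
      next
        assume "agree (max (n k) (length (b k))) y z'"
        then have "z' \<in> cyl (b k)" using cyl_agree[OF y[of k]] by simp
        then show "agree k x z" using Q[of k] z unfolding Q_def by blast
      qed
      then show "\<exists>n. \<forall>z z'. (z, z') \<in> E \<longrightarrow> (agree n x z \<longrightarrow> agree k y z') \<and> (agree n y z' \<longrightarrow> agree k x z)"
        by blast
    qed
    then show "x \<in> Domain (closure_map E)" by blast
  qed
  ultimately show ?thesis by (rule comeager_mono)
qed

lemma partial_homeo_closure_map:
  assumes "dense_set (Domain E)" "dense_set (Range E)"
    and "dense_set (Domain (closure_map E))" "dense_set (Range (closure_map E))"
  shows "partial_homeo (closure_map E)"
proof -
  have "rel_continuous (closure_map (E\<inverse>))" "comeager (Domain (closure_map (E\<inverse>)))"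
    using assms rel_continuous_closure_map[of "E\<inverse>"] comeager_Domain_closure_map[of "E\<inverse>"]
    by (simp_all add: closure_map_converse)
  then show ?thesis
    using assms rel_continuous_closure_map[of E] comeager_Domain_closure_map[of E]
    by (simp add: partial_homeo_def closure_map_converse)
qed

section \<open>A countable group with dense orbits\<close>

definition regular :: "prel set \<Rightarrow> point \<Rightarrow> bool"
  where "regular F x \<longleftrightarrow> (\<forall>w\<in>gen F. x \<in> Domain w)"

definition orbit :: "prel set \<Rightarrow> point set \<Rightarrow> point set"
  where "orbit F P = {y. \<exists>p\<in>P. \<exists>w\<in>gen F. (p, y) \<in> w}"

definition homeos :: "prel set \<Rightarrow> bool"
  where "homeos F \<longleftrightarrow> (\<forall>f\<in>F. partial_homeo f) \<and> (\<forall>w\<in>gen F. erratic w)"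

lemma partial_homeo_gen: "homeos F \<Longrightarrow> w \<in> gen F \<Longrightarrow> partial_homeo w"
  using homeo_group_gen unfolding homeos_def homeo_group_def by blast

lemma regular_mono: "F \<subseteq> F' \<Longrightarrow> regular F' x \<Longrightarrow> regular F x"
  unfolding regular_def using gen_mono by blast

lemma orbit_mono: "F \<subseteq> F' \<Longrightarrow> P \<subseteq> P' \<Longrightarrow> orbit F P \<subseteq> orbit F' P'"
  unfolding orbit_def using gen_mono by blast

lemma orbit_Un: "orbit F (P \<union> P') = orbit F P \<union> orbit F P'"
  unfolding orbit_def by blast

lemma subset_orbit: "P \<subseteq> orbit F P"
  unfolding orbit_def using gen_Id by blast

lemma orbit_step: "x \<in> orbit F P \<Longrightarrow> w \<in> gen F \<Longrightarrow> (x, y) \<in> w \<Longrightarrow> y \<in> orbit F P"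
  unfolding orbit_def using gen_comp by blast

lemma orbit_orbit: "orbit F (orbit F P) = orbit F P"
proof (rule subset_antisym[OF subsetI subset_orbit])
  fix y assume "y \<in> orbit F (orbit F P)"
  then obtain x w where "x \<in> orbit F P" "w \<in> gen F" "(x, y) \<in> w" unfolding orbit_def[of F "orbit F P"] by blast
  then show "y \<in> orbit F P" by (rule orbit_step)
qed

lemma orbit_disjoint_iff:
  "orbit F P \<inter> N = {} \<longleftrightarrow> (\<forall>p\<in>P. \<forall>w\<in>gen F. \<forall>n\<in>N. (p, n) \<notin> w)"
  unfolding orbit_def by blast

lemma regular_orbit:
  assumes F: "homeos F" and P: "\<And>p. p \<in> P \<Longrightarrow> regular F p" and x: "x \<in> orbit F P"
  shows "regular F x"
  unfolding regular_def
proof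
  fix w assume w: "w \<in> gen F"
  obtain p v where pv: "p \<in> P" "v \<in> gen F" "(p, x) \<in> v" using x unfolding orbit_def by blast
  have "p \<in> Domain (v O w)" using P[OF pv(1)] gen_comp[OF pv(2) w] unfolding regular_def by blast
  then show "x \<in> Domain w"
    using partial_homeo_unique(1)[OF partial_homeo_gen[OF F pv(2)] pv(3)] by blast
qed

lemma orbit_subset_image:
  assumes "homeos F" shows "orbit F P \<subseteq> (\<lambda>(p, w). THE y. (p, y) \<in> w) ` (P \<times> gen F)"
proof
  fix y assume "y \<in> orbit F P"
  then obtain p w where pw: "p \<in> P" "w \<in> gen F" "(p, y) \<in> w" unfolding orbit_def by blast
  then have "y = (THE y. (p, y) \<in> w)"
    using partial_homeo_unique(1)[OF partial_homeo_gen[OF assms]] by (auto intro!: the_equality[symmetric])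
  then show "y \<in> (\<lambda>(p, w). THE y. (p, y) \<in> w) ` (P \<times> gen F)"
    using pw by (intro image_eqI[of _ _ "(p, w)"]) auto
qed

lemma small_orbit: "homeos F \<Longrightarrow> small F \<Longrightarrow> small P \<Longrightarrow> small (orbit F P)"
  by (rule small_mono[OF orbit_subset_image]) (auto intro: small_image small_Times small_gen)

lemma countable_orbit: "homeos F \<Longrightarrow> countable F \<Longrightarrow> countable P \<Longrightarrow> countable (orbit F P)"
  by (rule countable_subset[OF orbit_subset_image]) (auto intro: countable_gen)

lemma gen_increasing_union:
  assumes w: "w \<in> gen (\<Union>n::nat. F n)" and inc: "\<And>n. F n \<subseteq> F (Suc n)"
  shows "\<exists>n. w \<in> gen (F n)"
proof -
  have mono: "F m \<subseteq> F n" if "m \<le> n" for m n using lift_Suc_mono_le[of F, OF inc that] .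
  obtain F0 where F0: "F0 \<subseteq> (\<Union>n. F n)" "finite F0" "w \<in> gen F0" using gen_finite_support[OF w] by blast
  have "\<exists>n. F0 \<subseteq> F n"
    using F0(2,1)
  proof (induction F0)
    case (insert f F0)
    then obtain m n where "F0 \<subseteq> F n" "f \<in> F m" by auto
    then have "insert f F0 \<subseteq> F (max m n)" using mono[of m "max m n"] mono[of n "max m n"] by auto
    then show ?case by blast
  qed simp
  then show ?thesis using F0(3) gen_mono by blast
qed

text \<open>Generic maps that send \<open>{x. x 0 = c}\<close> onto the cylinder \<open>d # b\<close>, for all \<open>c\<close>, \<open>d\<close> and \<open>b\<close>, are added one
  after the other.  A cylinder of a nonempty word is used because the two halves need
  matching nonempty complements.\<close>

lemma ex_base_group:
  assumes MA: MA_sigma_centered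
  shows "\<exists>F. countable F \<and> homeos F \<and> (\<forall>x. regular F x \<longrightarrow> dense_set (orbit F {x}))"
proof -
  define t :: "nat \<Rightarrow> bool list \<times> bool list" where "t n = (case from_nat n of (c, d, b) \<Rightarrow> ([c], d # b))" for n
  have t: "\<exists>n. t n = ([c], d # b)" for c d b
    by (rule exI[of _ "to_nat (c, d, b)"]) (simp add: t_def)
  have bal: "balanced {t n}" for n
  proof -
    obtain c d b where tn: "t n = ([c], d # b)" by (cases "from_nat n :: bool \<times> bool \<times> bool list") (simp add: t_def)
    have in_c: "x \<in> cyl [c] \<longleftrightarrow> x 0 = c" for x by (auto simp: cyl_def)
    obtain y where y: "y \<in> cyl (d # b)" using cyl_nonempty by blast
    have "(\<lambda>_. \<not> d) \<notin> cyl (d # b)" by (auto simp: cyl_def intro!: exI[of _ 0])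
    moreover have mem: "(u, v) \<in> box_rel {t n} \<longleftrightarrow> (u 0 = c \<longleftrightarrow> v \<in> cyl (d # b))" for u v
      unfolding tn box_rel_insert in_c by (simp add: box_rel_def)
    ultimately have "\<exists>v. (u, v) \<in> box_rel {t n}" for u
      using y by (cases "u 0 = c") auto
    moreover have "\<exists>u. (u, v) \<in> box_rel {t n}" for v
      unfolding mem by (rule exI[of _ "\<lambda>_. if v \<in> cyl (d # b) then c else \<not> c"]) simp
    ultimately show ?thesis unfolding balanced_def by simp
  qed
  have step: "\<exists>F'. (countable F' \<and> homeos F') \<and> F \<subseteq> F' \<and> (\<exists>f\<in>F'. f \<subseteq> box_rel {t n})"
    if F: "countable F \<and> homeos F" for F n
  proof -
    have ph: "partial_homeo f" if "f \<in> F" for f using F that unfolding homeos_def by blast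
    have er: "erratic w" if "w \<in> gen F" for w using F that unfolding homeos_def by blast
    have sF: "small F" using F small_countable by blast
    have s0: "small ({} :: point set)" by (rule small_countable) simp
    have "\<exists>f. partial_homeo f \<and> f \<subseteq> box_rel {t n} \<and> {} \<subseteq> Domain f \<and> {} \<subseteq> Range f \<and>
      (\<forall>x y. (x, y) \<in> f \<longrightarrow> x \<in> {} \<or> y \<in> {} \<longrightarrow> (x, y) \<in> (\<Union>n::nat. {})) \<and> (\<forall>w\<in>gen (insert f F). erratic w)"
      by (rule extend_group[OF MA ph er sF bal _ s0]) (auto simp: inj_rel_def)
    then obtain f where "partial_homeo f" "f \<subseteq> box_rel {t n}" "\<forall>w\<in>gen (insert f F). erratic w" by blast
    then show ?thesis using F ph unfolding homeos_def by (intro exI[of _ "insert f F"]) auto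
  qed
  have "countable {} \<and> homeos {}"
  proof -
    have "w = Id" if "w \<in> gen {}" for w using that by (induction rule: gen.induct) auto
    then show ?thesis by (auto simp: homeos_def erratic_def)
  qed
  then have "\<exists>F. \<forall>n. (countable (F n) \<and> homeos (F n)) \<and> F n \<subseteq> F (Suc n) \<and> (\<exists>f\<in>F (Suc n). f \<subseteq> box_rel {t n})"
    using step by (intro dependent_nat_choice[of "\<lambda>n F. countable F \<and> homeos F"
        "\<lambda>n F F'. F \<subseteq> F' \<and> (\<exists>f\<in>F'. f \<subseteq> box_rel {t n})"]) auto
  then obtain F where F: "\<And>n. countable (F n)" "\<And>n. homeos (F n)" "\<And>n. F n \<subseteq> F (Suc n)"
    "\<And>n. \<exists>f\<in>F (Suc n). f \<subseteq> box_rel {t n}" by metis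
  define G where "G = (\<Union>n. F n)"
  have "homeos G"
    unfolding homeos_def
  proof (intro conjI ballI)
    show "partial_homeo f" if f: "f \<in> G" for f
    proof -
      obtain n where "f \<in> F n" using f unfolding G_def by (elim UN_E)
      then show ?thesis using F(2)[of n] unfolding homeos_def by (elim conjE bspec)
    qed
    show "erratic w" if w: "w \<in> gen G" for w
    proof -
      obtain n where "w \<in> gen (F n)" using gen_increasing_union[OF w[unfolded G_def] F(3)] by (elim exE)
      then show ?thesis using F(2)[of n] unfolding homeos_def by (elim conjE bspec)
    qed
  qed
  moreover have "countable G" unfolding G_def using F(1) by blast
  moreover have "dense_set (orbit G {x})" if x: "regular G x" for x
    unfolding dense_set_def
  proof
    fix a
    obtain n where n: "t n = ([x 0], hd (a @ [True]) # tl (a @ [True]))" using t by blast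
    obtain f where f: "f \<in> F (Suc n)" "f \<subseteq> box_rel {t n}" using F(4) by blast
    have "f \<in> G" unfolding G_def using f(1) by (rule UN_I[OF UNIV_I])
    then have fG: "f \<in> gen G" by (rule gen_base(1))
    then obtain y where y: "(x, y) \<in> f" using x unfolding regular_def by blast
    have "x \<in> cyl [x 0]" by (simp add: cyl_def)
    then have "y \<in> cyl (a @ [True])" using box_relD[of x y "{t n}"] f(2) y n by auto
    then have "y \<in> cyl a" by (auto simp: cyl_def nth_append)
    then show "\<exists>y\<in>orbit G {x}. y \<in> cyl a" using y fG unfolding orbit_def by blast
  qed
  ultimately show ?thesis by blast
qed

section \<open>One stage of the recursion\<close>

text \<open>The invariant of the recursion: \<open>F\<close> is the family of maps, \<open>P\<close> the set of points put into \<open>X\<close> and \<open>N\<close> the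
  set of points kept out of \<open>X\<close> so far.\<close>

definition good :: "prel set \<Rightarrow> point set \<Rightarrow> point set \<Rightarrow> bool"
  where "good F P N \<longleftrightarrow> homeos F \<and> (\<forall>p\<in>P. regular F p) \<and> orbit F P \<inter> N = {}"

lemma orbit_stable:
  assumes dom: "\<forall>f\<in>F. X \<subseteq> Domain f \<inter> Range f"
    and inv: "\<forall>f\<in>F. \<forall>x y. (x, y) \<in> f \<longrightarrow> (x \<in> X \<longleftrightarrow> y \<in> X)"
  shows "x \<in> X \<Longrightarrow> regular F x" "orbit F X = X"
proof -
  have F: "x \<in> Domain f \<and> x \<in> Range f" if "f \<in> F" "x \<in> X" for f x using dom that by blast
  have F2: "x \<in> X \<longleftrightarrow> y \<in> X" if "f \<in> F" "(x, y) \<in> f" for f x y using inv that by blast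
  have *: "(x \<in> X \<longrightarrow> x \<in> Domain w) \<and> (\<forall>y. (x, y) \<in> w \<longrightarrow> x \<in> X \<longrightarrow> y \<in> X)" if "w \<in> gen F" for w x
    using that
  proof (induction arbitrary: x rule: gen.induct)
    case (gen_left f w)
    have "x \<in> Domain (f O w)" if x: "x \<in> X"
    proof -
      obtain y where y: "(x, y) \<in> f" using F[OF gen_left(1) x] by blast
      then have "y \<in> Domain w" using F2[OF gen_left(1) y] x gen_left(3) by simp
      then show ?thesis using y by blast
    qed
    moreover have "z \<in> X" if "(x, z) \<in> f O w" "x \<in> X" for z
      using that F2[OF gen_left(1)] gen_left(3) by (metis relcompE prod.inject)
    ultimately show ?case by blast
  next
    case (gen_inv f w)
    have "x \<in> Domain (f\<inverse> O w)" if x: "x \<in> X"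
    proof -
      obtain y where y: "(y, x) \<in> f" using F[OF gen_inv(1) x] by blast
      then have "y \<in> Domain w" using F2[OF gen_inv(1) y] x gen_inv(3) by simp
      then show ?thesis using y by blast
    qed
    moreover have "z \<in> X" if "(x, z) \<in> f\<inverse> O w" "x \<in> X" for z
      using that F2[OF gen_inv(1)] gen_inv(3) by (metis relcompE prod.inject converse_iff)
    ultimately show ?case by blast
  qed auto
  show "x \<in> X \<Longrightarrow> regular F x" using * unfolding regular_def by blast
  show "orbit F X = X"
    by (rule subset_antisym[OF subsetI subset_orbit]) (use * in \<open>auto simp: orbit_def\<close>)
qed

text \<open>A commitment pairs \<open>A\<close> with \<open>B\<close>, the rest of the countable set \<open>E\<close> with the rest of \<open>E\<close>, and any
  other point with the points of its orbit under the countable family.  Each singleton is a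
  colour for the countable part and each word for the remaining part.  The orbit of \<open>z\<close> makes
  \<open>E - A\<close> and \<open>E - B\<close> dense.\<close>

lemma ex_colouring:
  assumes F0: "homeos F0" "countable F0" "\<And>x. regular F0 x \<Longrightarrow> dense_set (orbit F0 {x})"
    and X: "\<And>x. x \<in> X \<Longrightarrow> regular F0 x" "orbit F0 X = X" "z \<in> X"
    and AB: "countable A" "countable B" "dense_set A" "dense_set B" "A \<subseteq> X" "B \<subseteq> X"
    and z: "orbit F0 {z} \<inter> (A \<union> B) = {}"
  shows "\<exists>colour :: nat \<Rightarrow> prel. (\<forall>n. inj_rel (colour n)) \<and>
    Domain (\<Union>n. colour n) = X \<and> Range (\<Union>n. colour n) = X \<and>
    (\<forall>x\<in>X. dense_set {y. (x, y) \<in> (\<Union>n. colour n)}) \<and>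
    (\<forall>y\<in>X. dense_set {x. (x, y) \<in> (\<Union>n. colour n)}) \<and>
    (\<forall>(x, y)\<in>(\<Union>n. colour n). x \<in> A \<longleftrightarrow> y \<in> B)"
proof -
  define E where "E = orbit F0 (A \<union> B \<union> {z})"
  have cE: "countable E" unfolding E_def using countable_orbit[OF F0(1,2)] AB(1,2) by auto
  have EX: "E \<subseteq> X" using orbit_mono[of F0 F0 "A \<union> B \<union> {z}" X] X(2,3) AB(5,6) unfolding E_def by auto
  have "A \<union> B \<union> {z} \<subseteq> E" unfolding E_def by (rule subset_orbit)
  then have AE: "A \<subseteq> E" "B \<subseteq> E" by blast+
  have Einv: "x \<in> E \<longleftrightarrow> y \<in> E" if "w \<in> gen F0" "(x, y) \<in> w" for w x y
    using orbit_step[OF _ that] orbit_step[OF _ gen_converse[OF that(1)], of y _ x] that(2)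
    unfolding E_def by auto
  have Xinv: "y \<in> X" if "w \<in> gen F0" "(x, y) \<in> w" "x \<in> X" for w x y
    using orbit_step[of x F0 X] X(2) that by blast
  have zE: "orbit F0 {z} \<subseteq> E" unfolding E_def by (rule orbit_mono) auto
  have dz: "dense_set (orbit F0 {z})" using F0(3) X(1,3) by blast
  have dEA: "dense_set (E - A)" "dense_set (E - B)"
    using dense_set_mono[OF dz] zE z by blast+
  define \<C> where "\<C> = (\<lambda>p. {p}) ` (A \<times> B) \<union> (\<lambda>p. {p}) ` ((E - A) \<times> (E - B)) \<union>
    (\<lambda>w. w \<inter> (X - E) \<times> (X - E)) ` gen F0"
  have U: "\<Union>\<C> = A \<times> B \<union> (E - A) \<times> (E - B) \<union> {(x, y). x \<in> X - E \<and> y \<in> X - E \<and> (\<exists>w\<in>gen F0. (x, y) \<in> w)}"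
    unfolding \<C>_def by blast
  have c\<C>: "countable \<C>"
    unfolding \<C>_def using AB cE countable_gen[OF F0(2)] by (intro countable_Un countable_image) auto
  have ne: "\<C> \<noteq> {}" unfolding \<C>_def using gen_Id by blast
  define colour where "colour = from_nat_into \<C>"
  have ran: "range colour = \<C>" unfolding colour_def by (rule range_from_nat_into[OF ne c\<C>])
  then have Uc: "(\<Union>n. colour n) = \<Union>\<C>" by simp
  have inj: "inj_rel (colour n)" for n
  proof -
    have "colour n \<in> \<C>" using ran by blast
    then consider p where "colour n = {p}" | w where "w \<in> gen F0" "colour n = w \<inter> (X - E) \<times> (X - E)"
      unfolding \<C>_def by blast
    then show ?thesis
    proof cases
      case (2 w)
      have "inj_rel w"
        using partial_homeo_unique[OF partial_homeo_gen[OF F0(1) 2(1)]] unfolding inj_rel_def by metis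
      then show ?thesis using inj_rel_subset 2(2) by blast
    qed (auto simp: inj_rel_def)
  qed
  have right: "dense_set {y. (x, y) \<in> \<Union>\<C>}" if x: "x \<in> X" for x
  proof (cases "x \<in> E")
    case True
    then have "B \<subseteq> {y. (x, y) \<in> \<Union>\<C>} \<or> E - B \<subseteq> {y. (x, y) \<in> \<Union>\<C>}" unfolding U by blast
    then show ?thesis using dense_set_mono AB(4) dEA by blast
  next
    case False
    have "orbit F0 {x} \<subseteq> {y. (x, y) \<in> \<Union>\<C>}"
      unfolding U orbit_def using Einv Xinv x False by blast
    then show ?thesis using dense_set_mono F0(3) X(1) x by blast
  qed
  have left: "dense_set {x. (x, y) \<in> \<Union>\<C>}" if y: "y \<in> X" for y
  proof (cases "y \<in> E")
    case True
    then have "A \<subseteq> {x. (x, y) \<in> \<Union>\<C>} \<or> E - A \<subseteq> {x. (x, y) \<in> \<Union>\<C>}" unfolding U by blast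
    then show ?thesis using dense_set_mono AB(3) dEA by blast
  next
    case False
    have "orbit F0 {y} \<subseteq> {x. (x, y) \<in> \<Union>\<C>}"
    proof
      fix x assume "x \<in> orbit F0 {y}"
      then obtain w where w: "w \<in> gen F0" "(y, x) \<in> w" unfolding orbit_def by blast
      then have "x \<in> X" "x \<notin> E" using Xinv y Einv False by blast+
      then show "x \<in> {x. (x, y) \<in> \<Union>\<C>}"
        using w gen_converse[OF w(1)] y False unfolding U by blast
    qed
    then show ?thesis using dense_set_mono F0(3) X(1) y by blast
  qed
  have ex: "\<exists>y. y \<in> S" if "dense_set S" for S using that unfolding dense_set_def by blast
  have CX: "x \<in> X \<and> y \<in> X" if "(x, y) \<in> \<Union>\<C>" for x y
    using that EX AE unfolding U by blast
  have "Domain (\<Union>\<C>) = X"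
  proof (intro subset_antisym subsetI)
    fix x assume "x \<in> Domain (\<Union>\<C>)"
    then show "x \<in> X" using CX by (elim DomainE) simp
  next
    fix x assume "x \<in> X"
    from ex[OF right[OF this]] obtain y where "(x, y) \<in> \<Union>\<C>" by (elim exE CollectE)
    then show "x \<in> Domain (\<Union>\<C>)" by (rule DomainI)
  qed
  moreover have "Range (\<Union>\<C>) = X"
  proof (intro subset_antisym subsetI)
    fix y assume "y \<in> Range (\<Union>\<C>)"
    then show "y \<in> X" using CX by (elim RangeE) simp
  next
    fix y assume "y \<in> X"
    from ex[OF left[OF this]] obtain x where "(x, y) \<in> \<Union>\<C>" by (elim exE CollectE)
    then show "y \<in> Range (\<Union>\<C>)" by (rule RangeI)
  qed
  moreover have "\<forall>(x, y)\<in>\<Union>\<C>. x \<in> A \<longleftrightarrow> y \<in> B" unfolding U using AE by blast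
  ultimately show ?thesis
    using inj left right by (intro exI[of _ colour]) (simp only: Uc, blast)
qed

text \<open>The new map permutes the orbit \<open>X\<close> of \<open>insert z P\<close>, so the enlarged family generates no new
  points from it.\<close>

lemma ex_homeo_preserving_good:
  assumes MA: MA_sigma_centered
    and F0: "F0 \<subseteq> F" "homeos F0" "countable F0" "\<And>x. regular F0 x \<Longrightarrow> dense_set (orbit F0 {x})"
    and g: "good F P N" "small F" "small P" "small N"
    and AB: "countable A" "countable B" "dense_set A" "dense_set B" "A \<subseteq> P" "B \<subseteq> P"
  shows "\<exists>f z. good (insert f F) (insert z P) N \<and> (\<forall>x y. (x, y) \<in> f \<longrightarrow> (x \<in> A \<longleftrightarrow> y \<in> B))"
proof -
  have F: "homeos F" and P: "\<And>p. p \<in> P \<Longrightarrow> regular F p" and N: "orbit F P \<inter> N = {}"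
    using g(1) unfolding good_def by auto
  have "small (N \<union> (A \<union> B))" using g(4) AB(1,2) small_countable by (intro small_Un) auto
  from ex_regular_point[OF MA partial_homeo_gen[OF F] small_gen[OF g(2)] this]
  obtain z where z': "\<forall>w\<in>gen F. z \<in> Domain w" "\<forall>w\<in>gen F. \<forall>x\<in>N \<union> (A \<union> B). (z, x) \<notin> w" by metis
  have z: "regular F z" "orbit F {z} \<inter> (N \<union> (A \<union> B)) = {}"
    using z' unfolding regular_def orbit_disjoint_iff by simp_all
  define X where "X = orbit F (insert z P)"
  have Xreg: "regular F x" if "x \<in> X" for x
    using regular_orbit[OF F, of "insert z P"] P z(1) that unfolding X_def by blast
  have sub: "orbit F0 X = X"
    using orbit_mono[OF F0(1), of X X] subset_orbit[of X F0] orbit_orbit[of F "insert z P"]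
    unfolding X_def by (intro subset_antisym) simp_all
  have PX: "insert z P \<subseteq> X" unfolding X_def by (rule subset_orbit)
  have zo: "orbit F0 {z} \<inter> (A \<union> B) = {}" using z(2) orbit_mono[OF F0(1), of "{z}" "{z}"] by blast
  have "\<exists>colour :: nat \<Rightarrow> prel. (\<forall>n. inj_rel (colour n)) \<and>
    Domain (\<Union>n. colour n) = X \<and> Range (\<Union>n. colour n) = X \<and>
    (\<forall>x\<in>X. dense_set {y. (x, y) \<in> (\<Union>n. colour n)}) \<and>
    (\<forall>y\<in>X. dense_set {x. (x, y) \<in> (\<Union>n. colour n)}) \<and>
    (\<forall>(x, y)\<in>(\<Union>n. colour n). x \<in> A \<longleftrightarrow> y \<in> B)"
    by (rule ex_colouring[OF F0(2-4) _ sub _ AB(1-4) _ _ zo])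
      (use Xreg regular_mono[OF F0(1)] PX AB in auto)
  then obtain colour :: "nat \<Rightarrow> prel" where c':
    "\<forall>n. inj_rel (colour n)" "Domain (\<Union>n. colour n) = X" "Range (\<Union>n. colour n) = X"
    "\<forall>x\<in>X. dense_set {y. (x, y) \<in> (\<Union>n. colour n)}"
    "\<forall>y\<in>X. dense_set {x. (x, y) \<in> (\<Union>n. colour n)}"
    "\<forall>(x, y)\<in>(\<Union>n. colour n). x \<in> A \<longleftrightarrow> y \<in> B"
    by (elim exE conjE)
  define C where "C = (\<Union>n. colour n)"
  have col: "\<And>n. inj_rel (colour n)" using c'(1) by blast
  note c'' = c'(2-)[folded C_def]
  have c: "Domain C = X" "Range C = X"
    "\<And>x. x \<in> X \<Longrightarrow> dense_set {y. (x, y) \<in> C}" "\<And>y. y \<in> X \<Longrightarrow> dense_set {x. (x, y) \<in> C}"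
    "\<And>x y. (x, y) \<in> C \<Longrightarrow> x \<in> A \<longleftrightarrow> y \<in> B"
    using c''(1-2) bspec[OF c''(3)] bspec[OF c''(4)] bspec[OF c''(5)] by simp_all auto
  have sX: "small X"
    unfolding X_def using small_orbit[OF F g(2)] small_Un[OF small_countable[of "{z}"] g(3)] by simp
  have ph: "\<And>f. f \<in> F \<Longrightarrow> partial_homeo f" and er: "\<And>w. w \<in> gen F \<Longrightarrow> erratic w"
    using F unfolding homeos_def by auto
  have bal: "balanced {}" by (simp add: balanced_def box_rel_def)
  have "\<exists>f. partial_homeo f \<and> f \<subseteq> box_rel {} \<and> X \<subseteq> Domain f \<and> X \<subseteq> Range f \<and>
    (\<forall>x y. (x, y) \<in> f \<longrightarrow> x \<in> X \<or> y \<in> X \<longrightarrow> (x, y) \<in> C) \<and> (\<forall>w\<in>gen (insert f F). erratic w)"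
    by (rule extend_group[OF MA ph er g(2) bal col sX c(1-4)[unfolded C_def], folded C_def])
  then obtain f where f': "partial_homeo f" "X \<subseteq> Domain f" "X \<subseteq> Range f"
    "\<forall>x y. (x, y) \<in> f \<longrightarrow> x \<in> X \<or> y \<in> X \<longrightarrow> (x, y) \<in> C"
    "\<forall>w\<in>gen (insert f F). erratic w"
    by (elim exE conjE)
  then have f: "partial_homeo f" "X \<subseteq> Domain f" "X \<subseteq> Range f"
    "\<And>x y. (x, y) \<in> f \<Longrightarrow> x \<in> X \<or> y \<in> X \<Longrightarrow> (x, y) \<in> C"
    "\<And>w. w \<in> gen (insert f F) \<Longrightarrow> erratic w"
    by blast+
  have fX: "x \<in> X \<longleftrightarrow> y \<in> X" if "(x, y) \<in> f" for x y
    using f(4)[OF that] c(1,2) by blast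
  have XD: "x \<in> Domain h \<and> x \<in> Range h" if h: "h \<in> insert f F" and x: "x \<in> X" for h x
  proof (cases "h = f")
    case False
    then have "h \<in> gen F" "h\<inverse> \<in> gen F" using h gen_base by auto
    then show ?thesis using Xreg[OF x] unfolding regular_def by (metis Domain_converse)
  qed (use f x in blast)
  have XX: "x \<in> X \<longleftrightarrow> y \<in> X" if h: "h \<in> insert f F" and xy: "(x, y) \<in> h" for h x y
  proof (cases "h = f")
    case False
    then have "h \<in> gen F" "h\<inverse> \<in> gen F" using h gen_base by auto
    then show ?thesis
      unfolding X_def using xy orbit_step[of x F "insert z P" h y]
        orbit_step[of y F "insert z P" "h\<inverse>" x] unfolding converse_iff by metis
  qed (use xy fX in simp)
  have "\<forall>h\<in>insert f F. X \<subseteq> Domain h \<inter> Range h" using XD by auto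
  moreover have "\<forall>h\<in>insert f F. \<forall>x y. (x, y) \<in> h \<longrightarrow> (x \<in> X \<longleftrightarrow> y \<in> X)" using XX by simp
  ultimately have stable: "\<And>x. x \<in> X \<Longrightarrow> regular (insert f F) x" "orbit (insert f F) X = X"
    using orbit_stable[of "insert f F" X] by simp_all
  have "homeos (insert f F)" using ph f(1,5) unfolding homeos_def by auto
  moreover have "regular (insert f F) p" if "p \<in> insert z P" for p
    using stable(1) PX that by blast
  moreover have "orbit (insert f F) (insert z P) \<inter> N = {}"
  proof -
    have "orbit (insert f F) (insert z P) \<subseteq> X"
      using orbit_mono[OF order_refl PX] stable(2) by blast
    moreover have "X \<inter> N = {}"
      using N z(2) orbit_Un[of F "{z}" P] unfolding X_def by auto
    ultimately show ?thesis by blast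
  qed
  ultimately have "good (insert f F) (insert z P) N" unfolding good_def by blast
  moreover have "x \<in> A \<longleftrightarrow> y \<in> B" if xy: "(x, y) \<in> f" for x y
  proof (cases "x \<in> X")
    case True
    then show ?thesis using f(4)[OF xy] c(5) by blast
  next
    case False
    then show ?thesis using fX[OF xy] AB(5,6) PX by blast
  qed
  ultimately show ?thesis by blast
qed

text \<open>The point \<open>x\<close> can be kept out of the set under construction and \<open>y\<close> can be put into it, both at once.\<close>

definition suitable :: "prel set \<Rightarrow> point set \<Rightarrow> point set \<Rightarrow> point \<Rightarrow> point \<Rightarrow> bool"
  where "suitable F P N x y \<longleftrightarrow> x \<notin> orbit F P \<and> regular F y \<and> orbit F {y} \<inter> insert x N = {}"

definition stage_result :: "prel \<Rightarrow> point set \<Rightarrow> point set \<Rightarrow>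
    prel set \<Rightarrow> point set \<Rightarrow> point set \<Rightarrow> stage \<Rightarrow> bool"
  where "stage_result g A B F P N = (\<lambda>(f, P', N'). countable P' \<and> countable N' \<and> P' \<noteq> {} \<and>
    good (insert f F) (P \<union> P') (N \<union> N') \<and>
    ((\<exists>(x, y)\<in>g. suitable F P N x y) \<longrightarrow> (\<exists>(x, y)\<in>g. x \<in> N' \<and> y \<in> P')) \<and>
    (dense_set A \<and> dense_set B \<and> (\<forall>x\<in>A \<union> B. regular F x) \<and> orbit F (A \<union> B) \<inter> (N \<union> N') = {} \<longrightarrow>
      A \<union> B \<subseteq> P' \<and> (\<forall>x y. (x, y) \<in> f \<longrightarrow> (x \<in> A \<longleftrightarrow> y \<in> B))))"

text \<open>If \<open>A\<close> and \<open>B\<close> do not qualify, both are replaced by the orbit of a generic point, so that there is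
  always a map to add.\<close>

lemma ex_stage_result:
  assumes MA: MA_sigma_centered
    and F0: "F0 \<subseteq> F" "homeos F0" "countable F0" "\<And>x. regular F0 x \<Longrightarrow> dense_set (orbit F0 {x})"
    and g: "good F P N" "small F" "small P" "small N"
    and AB: "countable A" "countable B"
  shows "\<exists>r. stage_result g A B F P N r"
proof -
  have F: "homeos F" and P: "\<forall>p\<in>P. regular F p" and N: "orbit F P \<inter> N = {}"
    using g(1) unfolding good_def by auto
  have "\<exists>P1 N1. countable P1 \<and> countable N1 \<and> good F (P \<union> P1) (N \<union> N1) \<and>
    ((\<exists>(x, y)\<in>g. suitable F P N x y) \<longrightarrow> (\<exists>(x, y)\<in>g. x \<in> N1 \<and> y \<in> P1))"
  proof (cases "\<exists>(x, y)\<in>g. suitable F P N x y")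
    case True
    then obtain x y where xy: "(x, y) \<in> g" "suitable F P N x y" by blast
    have "orbit F (P \<union> {y}) \<inter> (N \<union> {x}) = {}"
      using xy(2) N unfolding orbit_Un suitable_def by blast
    then have "good F (P \<union> {y}) (N \<union> {x})"
      using F P xy(2) unfolding good_def suitable_def by blast
    then show ?thesis using xy(1) by (intro exI[of _ "{y}"] exI[of _ "{x}"]) auto
  next
    case False
    then show ?thesis using g(1) by (intro exI[of _ "{}"]) simp
  qed
  then obtain P1 N1 where P1: "countable P1" "countable N1" "good F (P \<union> P1) (N \<union> N1)"
    "(\<exists>(x, y)\<in>g. suitable F P N x y) \<longrightarrow> (\<exists>(x, y)\<in>g. x \<in> N1 \<and> y \<in> P1)" by (elim exE conjE)
  have sN: "small (N \<union> N1)" using g(4) P1(2) small_countable small_Un by blast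
  define cond where "cond A' B' \<longleftrightarrow> dense_set A' \<and> dense_set B' \<and> (\<forall>x\<in>A' \<union> B'. regular F x) \<and>
    orbit F (A' \<union> B') \<inter> (N \<union> N1) = {}" for A' B'
  have "\<exists>A' B'. countable A' \<and> countable B' \<and> cond A' B' \<and> (cond A B \<longrightarrow> A' = A \<and> B' = B)"
  proof (cases "cond A B")
    case False
    from ex_regular_point[OF MA partial_homeo_gen[OF F] small_gen[OF g(2)] sN]
    obtain z where z: "\<forall>w\<in>gen F. z \<in> Domain w" "\<forall>w\<in>gen F. \<forall>x\<in>N \<union> N1. (z, x) \<notin> w" by metis
    define D where "D = orbit F0 {z}"
    have zr: "regular F z" using z(1) by (simp add: regular_def)
    have DF: "D \<subseteq> orbit F {z}" unfolding D_def by (rule orbit_mono[OF F0(1)]) simp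
    have "dense_set D" unfolding D_def using F0(4) regular_mono[OF F0(1) zr] by blast
    moreover have "regular F x" if "x \<in> D" for x
      by (rule regular_orbit[OF F, of "{z}"]) (use zr that DF in auto)
    moreover have "orbit F D \<inter> (N \<union> N1) = {}"
    proof -
      have "orbit F D \<subseteq> orbit F {z}" using orbit_mono[OF order_refl DF, of F] orbit_orbit by blast
      moreover have "orbit F {z} \<inter> (N \<union> N1) = {}" using z(2) unfolding orbit_disjoint_iff by simp
      ultimately show ?thesis by blast
    qed
    moreover have "countable D" unfolding D_def using countable_orbit[OF F0(2,3)] by simp
    ultimately show ?thesis
      using False unfolding cond_def by (intro exI[of _ D] conjI impI) auto
  qed (use AB in blast)
  then obtain A' B' where A': "countable A'" "countable B'" "cond A' B'" "cond A B \<longrightarrow> A' = A \<and> B' = B"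
    by (elim exE conjE)
  define P2 where "P2 = P \<union> P1 \<union> (A' \<union> B')"
  have "good F P2 (N \<union> N1)"
    using P1(3) A'(3) unfolding good_def cond_def P2_def orbit_Un[of F "P \<union> P1"] by blast
  moreover have "small P2" unfolding P2_def
    by (intro small_Un g(3) small_countable P1 A')
  moreover have "dense_set A'" "dense_set B'" "A' \<subseteq> P2" "B' \<subseteq> P2"
    using A'(3) unfolding cond_def P2_def by auto
  ultimately obtain f z where f: "good (insert f F) (insert z P2) (N \<union> N1)"
    "\<forall>x y. (x, y) \<in> f \<longrightarrow> (x \<in> A' \<longleftrightarrow> y \<in> B')"
    using ex_homeo_preserving_good[OF MA F0 _ g(2) _ sN A'(1,2)] by metis
  define P' where "P' = insert z (P1 \<union> (A' \<union> B'))"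
  have "insert z P2 = P \<union> P'" unfolding P2_def P'_def by blast
  then have "good (insert f F) (P \<union> P') (N \<union> N1)" using f(1) by simp
  moreover have "countable P'" using P1(1) A'(1,2) unfolding P'_def by simp
  moreover have "cond A B \<longrightarrow> A \<union> B \<subseteq> P' \<and> (\<forall>x y. (x, y) \<in> f \<longrightarrow> (x \<in> A \<longleftrightarrow> y \<in> B))"
    using A'(4) f(2) unfolding P'_def by blast
  moreover have "(\<exists>(x, y)\<in>g. suitable F P N x y) \<longrightarrow> (\<exists>(x, y)\<in>g. x \<in> N1 \<and> y \<in> P')"
    using P1(4) unfolding P'_def by blast
  moreover have "P' \<noteq> {}" unfolding P'_def by simp
  ultimately have "stage_result g A B F P N (f, P', N1)"
    using P1(2) unfolding stage_result_def cond_def split_conv by (intro conjI) assumption+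
  then show ?thesis by (rule exI)
qed

section \<open>The recursion\<close>

lemma small_initial_segments:
  "\<exists>R :: 'a rel. wf R \<and> trans R \<and> (\<forall>x y. x = y \<or> (x, y) \<in> R \<or> (y, x) \<in> R) \<and>
    (\<forall>x. ordLess2 (card_of {y. (y, x) \<in> R}) (card_of (UNIV :: 'a set)))"
proof -
  define r where "r = card_of (UNIV :: 'a set)"
  have w: "well_order_on UNIV r" unfolding r_def by (rule card_of_well_order_on)
  have lin: "trans r" "antisym r" "total_on UNIV r" "wf (r - Id)"
    using w unfolding well_order_on_def linear_order_on_def partial_order_on_def preorder_on_def by auto
  have "{y. (y, x) \<in> r - Id} = underS r x" for x unfolding underS_def by auto
  moreover have "ordLess2 (card_of (underS r x)) r" for x
    unfolding r_def by (rule card_of_underS[OF card_of_Card_order]) (simp add: Field_card_of)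
  moreover have "trans (r - Id)"
    using lin(1,2) unfolding trans_def antisym_def by blast
  ultimately show ?thesis
    using lin(3,4) unfolding r_def[symmetric] total_on_def
    by (intro exI[of _ "r - Id"]) auto
qed

lemma small_countable_union:
  assumes J: "small J" and Q: "\<And>\<beta>. \<beta> \<in> J \<Longrightarrow> countable (Q \<beta>)"
  shows "small (\<Union>(Q ` J))"
proof (rule small_if_parametrized[where f = "\<lambda>(\<beta>, n). from_nat_into (Q \<beta>) n"])
  show "small (J \<times> (UNIV :: nat set))" by (intro small_Times J small_countable) simp
  fix x assume "x \<in> \<Union>(Q ` J)"
  then obtain \<beta> where \<beta>: "\<beta> \<in> J" "x \<in> Q \<beta>" by blast
  then obtain n where "from_nat_into (Q \<beta>) n = x" using from_nat_into_surj[OF Q] by blast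
  then show "\<exists>i\<in>J \<times> UNIV. x = (case i of (\<beta>, n) \<Rightarrow> from_nat_into (Q \<beta>) n)"
    using \<beta>(1) by (intro bexI[of _ "(\<beta>, n)"]) auto
qed

text \<open>The stage at \<open>\<alpha>\<close> sees the results for \<open>J \<alpha>\<close>, the predecessors of \<open>\<alpha>\<close> in a well-ordering whose
  initial segments are small.  The invariant passes to limits because a violation involves only
  a word in finitely many maps and two points, all of which are present at some earlier stage.\<close>

lemma transfinite_construction:
  fixes g :: "nat set \<Rightarrow> prel" and A B :: "nat set \<Rightarrow> point set"
  assumes MA: MA_sigma_centered
    and F0: "homeos F0" "countable F0" "\<And>x. regular F0 x \<Longrightarrow> dense_set (orbit F0 {x})"
    and N0: "countable N0" and AB: "\<And>\<alpha>. countable (A \<alpha>)" "\<And>\<alpha>. countable (B \<alpha>)"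
  shows "\<exists>(F :: nat set \<Rightarrow> prel) P N J. 
    (\<forall>\<alpha>. stage_result (g \<alpha>) (A \<alpha>) (B \<alpha>) (F0 \<union> F ` J \<alpha>) (\<Union>(P ` J \<alpha>)) (N0 \<union> \<Union>(N ` J \<alpha>)) (F \<alpha>, P \<alpha>, N \<alpha>)) \<and>
    (\<forall>\<alpha>. small (J \<alpha>)) \<and> good (F0 \<union> range F) (\<Union>(range P)) (N0 \<union> \<Union>(range N))"
proof -
  obtain R :: "nat set rel" where R: "wf R" "trans R" "\<And>x y. x = y \<or> (x, y) \<in> R \<or> (y, x) \<in> R"
    "\<And>x. ordLess2 (card_of {y. (y, x) \<in> R}) (card_of (UNIV :: nat set set))"
    using small_initial_segments by metis
  define J where "J \<alpha> = {\<beta>. (\<beta>, \<alpha>) \<in> R}" for \<alpha>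
  have sJ: "small (J \<alpha>)" for \<alpha> using R(4) unfolding small_iff_card J_def .
  define FF where "FF S K = F0 \<union> (fst \<circ> S) ` K" for S :: "nat set \<Rightarrow> stage" and K
  define PP where "PP S K = \<Union>((fst \<circ> snd \<circ> S) ` K)" for S :: "nat set \<Rightarrow> stage" and K
  define NN where "NN S K = N0 \<union> \<Union>((snd \<circ> snd \<circ> S) ` K)" for S :: "nat set \<Rightarrow> stage" and K
  \<comment> \<open>That the invariant holds at every stage can only be shown after the recursion has been set up.\<close>
  define ok where "ok S \<alpha> r \<longleftrightarrow> (good (FF S (J \<alpha>)) (PP S (J \<alpha>)) (NN S (J \<alpha>)) \<longrightarrow>
      stage_result (g \<alpha>) (A \<alpha>) (B \<alpha>) (FF S (J \<alpha>)) (PP S (J \<alpha>)) (NN S (J \<alpha>)) r) \<and>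
      countable (fst (snd r)) \<and> countable (snd (snd r))" for S \<alpha> r
  have "\<exists>S. \<forall>\<alpha>. ok S \<alpha> (S \<alpha>)"
  proof (rule dependent_wf_choice[OF R(1)])
    fix S S' :: "nat set \<Rightarrow> stage" and \<alpha> r
    assume eq: "\<And>\<beta>. (\<beta>, \<alpha>) \<in> R \<Longrightarrow> S \<beta> = S' \<beta>"
    have "(fst \<circ> S) ` J \<alpha> = (fst \<circ> S') ` J \<alpha>" "(fst \<circ> snd \<circ> S) ` J \<alpha> = (fst \<circ> snd \<circ> S') ` J \<alpha>"
      "(snd \<circ> snd \<circ> S) ` J \<alpha> = (snd \<circ> snd \<circ> S') ` J \<alpha>"
      by (rule image_cong; simp add: J_def eq)+
    then show "ok S \<alpha> r = ok S' \<alpha> r" unfolding ok_def FF_def PP_def NN_def by simp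
  next
    fix \<alpha> and S :: "nat set \<Rightarrow> stage"
    assume prev: "\<And>\<beta>. (\<beta>, \<alpha>) \<in> R \<Longrightarrow> ok S \<beta> (S \<beta>)"
    have c: "countable (fst (snd (S \<beta>)))" "countable (snd (snd (S \<beta>)))" if "\<beta> \<in> J \<alpha>" for \<beta>
      using prev that unfolding ok_def J_def by auto
    have sF: "small (FF S (J \<alpha>))" unfolding FF_def
      by (intro small_Un small_image sJ small_countable F0)
    have sP: "small (PP S (J \<alpha>))" unfolding PP_def by (rule small_countable_union[OF sJ]) (simp add: c)
    have sN: "small (NN S (J \<alpha>))" unfolding NN_def
      by (intro small_Un small_countable_union[OF sJ] small_countable N0) (simp add: c)
    have sub: "F0 \<subseteq> FF S (J \<alpha>)" unfolding FF_def by blast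
    show "\<exists>r. ok S \<alpha> r"
    proof (cases "good (FF S (J \<alpha>)) (PP S (J \<alpha>)) (NN S (J \<alpha>))")
      case True
      obtain r where r: "stage_result (g \<alpha>) (A \<alpha>) (B \<alpha>) (FF S (J \<alpha>)) (PP S (J \<alpha>)) (NN S (J \<alpha>)) r"
        by (rule exE[OF ex_stage_result[OF MA sub F0 True sF sP sN AB]])
      then have "countable (fst (snd r)) \<and> countable (snd (snd r))"
        unfolding stage_result_def by (auto split: prod.splits)
      then show ?thesis using r unfolding ok_def by blast
    next
      case False
      then show ?thesis unfolding ok_def by (intro exI[of _ "({}, {}, {})"]) simp
    qed
  qed
  then obtain S where S: "\<And>\<alpha>. ok S \<alpha> (S \<alpha>)" by blast
  have mono: "FF S K \<subseteq> FF S L" "PP S K \<subseteq> PP S L" "NN S K \<subseteq> NN S L" if "K \<subseteq> L" for K L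
    using that unfolding FF_def PP_def NN_def by auto
  have base: "good (FF S {}) (PP S {}) (NN S {})"
    using F0(1) by (auto simp: FF_def PP_def NN_def good_def orbit_def)
  have limit: "good (FF S K) (PP S K) (NN S K)"
    if K: "\<And>\<beta>. \<beta> \<in> K \<Longrightarrow> J \<beta> \<subseteq> K \<and> good (FF S (insert \<beta> (J \<beta>))) (PP S (insert \<beta> (J \<beta>))) (NN S (insert \<beta> (J \<beta>)))"
    for K
  proof -
    have top: "\<exists>L. L0 \<subseteq> L \<and> L \<subseteq> K \<and> good (FF S L) (PP S L) (NN S L)" if L0: "finite L0" "L0 \<subseteq> K" for L0
    proof (cases "L0 = {}")
      case False
      have "\<exists>\<beta>\<in>L0. L0 \<subseteq> insert \<beta> (J \<beta>)"
        using L0(1) False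
      proof (induction L0 rule: finite_ne_induct)
        case (insert x L0)
        then obtain \<beta> where \<beta>: "\<beta> \<in> L0" "L0 \<subseteq> insert \<beta> (J \<beta>)" by blast
        show ?case
        proof (cases "x \<in> insert \<beta> (J \<beta>)")
          case False
          then have "(\<beta>, x) \<in> R" using R(3)[of x \<beta>] unfolding J_def by blast
          then have "insert \<beta> (J \<beta>) \<subseteq> J x" using transD[OF R(2)] by (auto simp: J_def)
          with \<beta>(2) have "L0 \<subseteq> J x" by (rule subset_trans)
          then show ?thesis by (intro bexI[of _ x]) auto
        next
          case True
          then show ?thesis using \<beta> by (intro bexI[of _ \<beta>]) auto
        qed
      qed simp
      then obtain \<beta> where "\<beta> \<in> L0" "L0 \<subseteq> insert \<beta> (J \<beta>)" by blast
      then show ?thesis using K[of \<beta>] L0(2) by (intro exI[of _ "insert \<beta> (J \<beta>)"]) blast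
    qed (use base in blast)
    have word: "\<exists>L0. finite L0 \<and> L0 \<subseteq> K \<and> w \<in> gen (FF S L0)" if w: "w \<in> gen (FF S K)" for w
    proof -
      obtain F1 where F1: "F1 \<subseteq> FF S K" "finite F1" "w \<in> gen F1" using gen_finite_support[OF w] by metis
      have "F1 - F0 \<subseteq> (fst \<circ> S) ` K" using F1(1) unfolding FF_def by blast
      moreover have "finite (F1 - F0)" using F1(2) by simp
      ultimately obtain L0 where L0: "L0 \<subseteq> K" "finite L0" "F1 - F0 = (fst \<circ> S) ` L0"
        using finite_subset_image[of "F1 - F0" "fst \<circ> S" K] by metis
      have "F1 \<subseteq> FF S L0" unfolding FF_def L0(3)[symmetric] by auto
      then have "w \<in> gen (FF S L0)" using F1(3) gen_mono by blast
      then show ?thesis using L0(1,2) by (intro exI[of _ L0] conjI)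
    qed
    show ?thesis
      unfolding good_def
    proof (intro conjI ballI)
      show "homeos (FF S K)"
        unfolding homeos_def
      proof (intro conjI ballI)
        fix f assume f: "f \<in> FF S K"
        then obtain L0 where "finite L0" "L0 \<subseteq> K" "f \<in> FF S L0"
        proof (cases "f \<in> F0")
          case False
          then obtain \<beta> where "\<beta> \<in> K" "f = fst (S \<beta>)" using f unfolding FF_def by auto
          then show thesis using that[of "{\<beta>}"] unfolding FF_def by simp
        qed (use that[of "{}"] in \<open>simp add: FF_def\<close>)
        then obtain L where "f \<in> FF S L" "good (FF S L) (PP S L) (NN S L)" using top mono(1) by (metis subsetD)
        then show "partial_homeo f" unfolding good_def homeos_def by simp
      next
        fix w assume "w \<in> gen (FF S K)"
        then obtain L0 where L0: "finite L0" "L0 \<subseteq> K" "w \<in> gen (FF S L0)" using word by metis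
        then obtain L where L: "L0 \<subseteq> L" "good (FF S L) (PP S L) (NN S L)" using top by metis
        then have "w \<in> gen (FF S L)" using subsetD[OF gen_mono[OF mono(1)] L0(3), of L] by simp
        then show "erratic w" using L(2) unfolding good_def homeos_def by simp
      qed
    next
      fix p assume p: "p \<in> PP S K"
      then obtain \<beta> where \<beta>: "\<beta> \<in> K" "p \<in> PP S {\<beta>}" unfolding PP_def by auto
      show "regular (FF S K) p"
        unfolding regular_def
      proof
        fix w assume "w \<in> gen (FF S K)"
        then obtain L0 where L0: "finite L0" "L0 \<subseteq> K" "w \<in> gen (FF S L0)" using word by metis
        then obtain L where L: "insert \<beta> L0 \<subseteq> L" "good (FF S L) (PP S L) (NN S L)"
          using top[of "insert \<beta> L0"] \<beta>(1) by auto
        then have "w \<in> gen (FF S L)" "p \<in> PP S L"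
          using subsetD[OF gen_mono[OF mono(1)] L0(3), of L] subsetD[OF mono(2) \<beta>(2), of L] L(1)
          by simp_all
        then show "p \<in> Domain w" using L(2) unfolding good_def regular_def by simp
      qed
    next
      show "orbit (FF S K) (PP S K) \<inter> NN S K = {}"
        unfolding orbit_disjoint_iff
      proof (intro ballI)
        fix p w n assume p: "p \<in> PP S K" and w: "w \<in> gen (FF S K)" and n: "n \<in> NN S K"
        obtain \<beta> where \<beta>: "\<beta> \<in> K" "p \<in> PP S {\<beta>}" using p unfolding PP_def by auto
        obtain \<gamma> where \<gamma>: "\<gamma> \<in> K" "n \<in> NN S {\<gamma>}" using n \<beta>(1) unfolding NN_def by auto
        obtain L0 where L0: "finite L0" "L0 \<subseteq> K" "w \<in> gen (FF S L0)" using word[OF w] by metis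
        then obtain L where L: "insert \<gamma> (insert \<beta> L0) \<subseteq> L" "good (FF S L) (PP S L) (NN S L)"
          using top[of "insert \<gamma> (insert \<beta> L0)"] \<beta>(1) \<gamma>(1) by auto
        then have "w \<in> gen (FF S L)" "p \<in> PP S L" "n \<in> NN S L"
          using subsetD[OF gen_mono[OF mono(1)] L0(3), of L] subsetD[OF mono(2) \<beta>(2), of L]
            subsetD[OF mono(3) \<gamma>(2), of L] L(1) by simp_all
        then show "(p, n) \<notin> w" using L(2) unfolding good_def orbit_disjoint_iff by simp
      qed
    qed
  qed
  have next_good: "good (FF S (insert \<alpha> (J \<alpha>))) (PP S (insert \<alpha> (J \<alpha>))) (NN S (insert \<alpha> (J \<alpha>)))"
    if "good (FF S (J \<alpha>)) (PP S (J \<alpha>)) (NN S (J \<alpha>))" for \<alpha>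
  proof -
    have "stage_result (g \<alpha>) (A \<alpha>) (B \<alpha>) (FF S (J \<alpha>)) (PP S (J \<alpha>)) (NN S (J \<alpha>)) (S \<alpha>)"
      using S that unfolding ok_def by blast
    then have "good (insert (fst (S \<alpha>)) (FF S (J \<alpha>))) (PP S (J \<alpha>) \<union> fst (snd (S \<alpha>))) (NN S (J \<alpha>) \<union> snd (snd (S \<alpha>)))"
      unfolding stage_result_def by (auto split: prod.splits)
    moreover have "FF S (insert \<alpha> (J \<alpha>)) = insert (fst (S \<alpha>)) (FF S (J \<alpha>))"
      "PP S (insert \<alpha> (J \<alpha>)) = PP S (J \<alpha>) \<union> fst (snd (S \<alpha>))"
      "NN S (insert \<alpha> (J \<alpha>)) = NN S (J \<alpha>) \<union> snd (snd (S \<alpha>))"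
      unfolding FF_def PP_def NN_def by auto
    ultimately show ?thesis by simp
  qed
  have good: "good (FF S (J \<alpha>)) (PP S (J \<alpha>)) (NN S (J \<alpha>))" for \<alpha>
  proof (induction \<alpha> rule: wf_induct_rule[OF R(1)])
    case (1 \<alpha>)
    show ?case
    proof (rule limit)
      fix \<beta> assume "\<beta> \<in> J \<alpha>"
      then have \<beta>: "(\<beta>, \<alpha>) \<in> R" by (simp add: J_def)
      then have "J \<beta> \<subseteq> J \<alpha>" using transD[OF R(2)] by (auto simp: J_def)
      then show "J \<beta> \<subseteq> J \<alpha> \<and> good (FF S (insert \<beta> (J \<beta>))) (PP S (insert \<beta> (J \<beta>))) (NN S (insert \<beta> (J \<beta>)))"
        using next_good[OF 1[OF \<beta>]] by blast
    qed
  qed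
  have "good (FF S UNIV) (PP S UNIV) (NN S UNIV)"
    by (rule limit) (use next_good[OF good] in blast)
  moreover have "stage_result (g \<alpha>) (A \<alpha>) (B \<alpha>) (FF S (J \<alpha>)) (PP S (J \<alpha>)) (NN S (J \<alpha>)) (S \<alpha>)" for \<alpha>
    using S good unfolding ok_def by blast
  ultimately show ?thesis
    using sJ unfolding FF_def PP_def NN_def
    by (intro exI[of _ "fst \<circ> S"] exI[of _ "fst \<circ> snd \<circ> S"] exI[of _ "snd \<circ> snd \<circ> S"] exI[of _ J]) simp
qed

section \<open>Partial homeomorphisms agreeing with words\<close>

lemma compact_points: "compact (UNIV :: point set)"
proof -
  have "compact_space cantor_space"
    unfolding cantor_space_def by (simp add: compact_space_product_topology compact_space_discrete_topology)
  then show ?thesis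
    unfolding compact_space_def cantor_space_euclidean by (simp add: compactin_euclidean_iff)
qed

text \<open>Every point of the cylinder is in the domain of \<open>v\<close> or of \<open>g\<close>.  The values of \<open>v\<close> near a point of
  the latter are close to those of \<open>g\<close>, since the two maps agree on a comeager set.  So \<open>v\<close> oscillates
  little near each point, and compactness makes this uniform.\<close>

lemma unif_cont_on_if_agrees:
  assumes v: "partial_homeo v" and g: "partial_homeo g" and cover: "\<And>x. x \<in> Domain v \<union> Domain g"
    and eq: "\<And>x y y'. x \<in> cyl a \<Longrightarrow> (x, y) \<in> g \<Longrightarrow> (x, y') \<in> v \<Longrightarrow> y = y'"
  shows "unif_cont_on v a"
  unfolding unif_cont_on_def
proof
  fix k
  have vc: "rel_continuous v" and gc: "rel_continuous g" using v g unfolding partial_homeo_def by auto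
  have dense: "dense_set (Domain v \<inter> Domain g)"
    using v g comeager_Int comeager_dense unfolding partial_homeo_def by blast
  define Q where "Q x n \<longleftrightarrow> (\<forall>u y u' y'. (u, y) \<in> v \<longrightarrow> (u', y') \<in> v \<longrightarrow> u \<in> cyl a \<longrightarrow> u' \<in> cyl a \<longrightarrow>
    agree n x u \<longrightarrow> agree n x u' \<longrightarrow> agree k y y')" for x n
  have "\<exists>n. Q x n" for x
  proof (cases "x \<in> cyl a")
    case False
    then have "Q x (length a)" unfolding Q_def using cyl_eq_agree agree_sym by blast
    then show ?thesis by blast
  next
    case True
    have "\<exists>n z. \<forall>u y. (u, y) \<in> v \<longrightarrow> u \<in> cyl a \<longrightarrow> agree n x u \<longrightarrow> agree k z y"
    proof (cases "x \<in> Domain v")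
      case True
      then obtain z where "(x, z) \<in> v" by blast
      then show ?thesis using rel_continuousD[OF vc, of x z k] by blast
    next
      case False
      then obtain z where z: "(x, z) \<in> g" using cover[of x] by blast
      obtain n where n: "\<And>u y. (u, y) \<in> g \<Longrightarrow> agree n x u \<Longrightarrow> agree k z y"
        using rel_continuousD[OF gc z, of k] by metis
      have "agree k z y" if uy: "(u, y) \<in> v" "u \<in> cyl a" "agree n x u" for u y
      proof -
        obtain m where m: "\<And>u' y'. (u', y') \<in> v \<Longrightarrow> agree m u u' \<Longrightarrow> agree k y y'"
          using rel_continuousD[OF vc uy(1), of k] by metis
        obtain u' where u': "u' \<in> Domain v \<inter> Domain g" "agree (max m (max n (length a))) u u'"
          using dense_setD[OF dense] by blast
        then obtain y1 y2 where y: "(u', y1) \<in> v" "(u', y2) \<in> g" by blast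
        have "u' \<in> cyl a" using cyl_agree[OF uy(2) u'(2)] by simp
        then have "y2 = y1" using eq y by blast
        moreover have "agree k y y1" using m y(1) agree_mono[OF u'(2)] by simp
        moreover have "agree k z y2" using n[OF y(2)] agree_trans[OF uy(3) agree_mono[OF u'(2)]] by simp
        ultimately show ?thesis by (simp add: agree_def)
      qed
      then show ?thesis by blast
    qed
    then obtain n z where nz: "\<And>u y. (u, y) \<in> v \<Longrightarrow> u \<in> cyl a \<Longrightarrow> agree n x u \<Longrightarrow> agree k z y" by metis
    have "Q x n"
      unfolding Q_def
    proof (intro allI impI)
      fix u y u' y' assume "(u, y) \<in> v" "(u', y') \<in> v" "u \<in> cyl a" "u' \<in> cyl a" "agree n x u" "agree n x u'"
      then have "agree k z y" "agree k z y'" using nz by blast+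
      then show "agree k y y'" by (simp add: agree_def)
    qed
    then show ?thesis by blast
  qed
  then obtain n where n: "\<And>x. Q x (n x)" by metis
  have cov: "(UNIV :: point set) \<subseteq> (\<Union>x\<in>UNIV. cyl (init (n x) x))"
  proof
    fix x show "x \<in> (\<Union>x\<in>UNIV. cyl (init (n x) x))" by (rule UN_I[OF UNIV_I[of x]]) simp
  qed
  obtain D where "D \<subseteq> UNIV" and D: "finite D" "(UNIV :: point set) \<subseteq> (\<Union>x\<in>D. cyl (init (n x) x))"
    by (rule compactE_image[OF compact_points _ cov]) (rule open_cyl)
  define M where "M = Max (insert 0 (n ` D))"
  have M: "n x \<le> M" if "x \<in> D" for x unfolding M_def using D(1) that by (intro Max_ge) auto
  have "agree k y y'" if uu: "(u, y) \<in> v" "(u', y') \<in> v" "u \<in> cyl a" "u' \<in> cyl a" "agree M u u'" for u y u' y'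
  proof -
    have "u \<in> (\<Union>x\<in>D. cyl (init (n x) x))" using D(2) by blast
    then obtain x where x: "x \<in> D" "agree (n x) x u" by auto
    then have "agree (n x) x u'" using agree_trans agree_mono[OF uu(5) M[OF x(1)]] by blast
    then show ?thesis using n[of x] uu x(2) unfolding Q_def by blast
  qed
  then show "\<exists>n. \<forall>x y x' y'. (x, y) \<in> v \<longrightarrow> (x', y') \<in> v \<longrightarrow> x \<in> cyl a \<longrightarrow> x' \<in> cyl a \<longrightarrow> agree n x x' \<longrightarrow> agree k y y'"
    by (intro exI[of _ M]) simp
qed

lemma comeager_disagreement:
  assumes v: "rel_continuous v" and g: "rel_continuous g"
    and dis: "\<And>a. cyl a \<subseteq> cyl c \<Longrightarrow> \<exists>x y y'. x \<in> cyl a \<and> (x, y) \<in> g \<and> (x, y') \<in> v \<and> y \<noteq> y'"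
  shows "comeager {x. x \<in> cyl c \<longrightarrow> (\<forall>y. (x, y) \<in> g \<longrightarrow> (x, y) \<notin> v)}"
proof -
  define U where "U = {x. x \<notin> cyl c \<or> (\<exists>n. \<forall>u y y'. agree n x u \<longrightarrow> (u, y) \<in> g \<longrightarrow> (u, y') \<in> v \<longrightarrow> y \<noteq> y')}"
  have "comeager U"
  proof (rule comeager_open_dense)
    show "open U"
      unfolding open_iff_agree
    proof
      fix x assume x: "x \<in> U"
      show "\<exists>n. \<forall>y. agree n x y \<longrightarrow> y \<in> U"
      proof (cases "x \<in> cyl c")
        case False
        have "y \<in> U" if "agree (length c) x y" for y
          using cyl_agree[of y c "length c" x] False agree_sym[OF that] unfolding U_def by blast
        then show ?thesis by blast
      next
        case True
        then obtain n where n: "\<And>u y y'. agree n x u \<Longrightarrow> (u, y) \<in> g \<Longrightarrow> (u, y') \<in> v \<Longrightarrow> y \<noteq> y'"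
          using x unfolding U_def by blast
        have "z \<in> U" if z: "agree n x z" for z
          unfolding U_def using n agree_trans[OF z] by blast
        then show ?thesis by blast
      qed
    qed
    show "dense_set U"
      unfolding dense_set_def
    proof
      fix a
      show "\<exists>x\<in>U. x \<in> cyl a"
      proof (cases "cyl a \<subseteq> cyl c")
        case False
        then show ?thesis unfolding U_def by blast
      next
        case True
        obtain x y y' where x: "x \<in> cyl a" "(x, y) \<in> g" "(x, y') \<in> v" "y \<noteq> y'" using dis[OF True] by blast
        obtain k where k: "\<not> agree k y y'" using not_eq_imp_not_agree[OF x(4)] by blast
        obtain n where n: "\<And>u z. (u, z) \<in> g \<Longrightarrow> agree n x u \<Longrightarrow> agree k y z"
          using rel_continuousD[OF g x(2), of k] by metis
        obtain m where m: "\<And>u z. (u, z) \<in> v \<Longrightarrow> agree m x u \<Longrightarrow> agree k y' z"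
          using rel_continuousD[OF v x(3), of k] by metis
        have "z \<noteq> z'" if u: "agree (max n m) x u" "(u, z) \<in> g" "(u, z') \<in> v" for u z z'
        proof
          assume "z = z'"
          moreover have "agree k y z" "agree k y' z'" using n m u agree_mono[OF u(1)] by auto
          ultimately show False using k by (simp add: agree_def)
        qed
        then have "x \<in> U" unfolding U_def by blast
        then show ?thesis using x(1) by blast
      qed
    qed
  qed
  then show ?thesis
    by (rule comeager_mono) (use agree_refl in \<open>unfold U_def, blast\<close>)
qed

text \<open>Let \<open>cyl c\<close> be moved by \<open>g\<close>.  If no word agreed with \<open>g\<close> on any smaller cylinder, then each word
  would disagree with \<open>g\<close> on a comeager subset of \<open>cyl c\<close>.  The other requirements on a suitable pair
  hold on comeager sets as well, so a suitable pair would exist.\<close>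

lemma agrees_with_word_if_no_suitable:
  assumes MA: MA_sigma_centered and F: "homeos F" "small F" and P: "small P" and N: "small N"
    and g: "partial_homeo g" and x0: "(x0, y0) \<in> g" "x0 \<noteq> y0"
    and no: "\<And>x y. (x, y) \<in> g \<Longrightarrow> \<not> suitable F P N x y"
  shows "\<exists>v\<in>gen F. \<exists>a. (\<forall>x y y'. x \<in> cyl a \<longrightarrow> (x, y) \<in> g \<longrightarrow> (x, y') \<in> v \<longrightarrow> y = y') \<and>
    (\<forall>x\<in>cyl a. (x, x) \<notin> g)"
proof (rule ccontr)
  assume contra: "\<not> ?thesis"
  have gc: "rel_continuous g" and gD: "comeager (Domain g)" using g unfolding partial_homeo_def by auto
  obtain k where k: "\<not> agree k x0 y0" using not_eq_imp_not_agree[OF x0(2)] by blast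
  obtain n where n: "\<And>x y. (x, y) \<in> g \<Longrightarrow> agree n x0 x \<Longrightarrow> agree k y0 y"
    using rel_continuousD[OF gc x0(1), of k] by metis
  \<comment> \<open>On this cylinder \<open>g\<close> takes values near \<open>y0\<close>, which are apart from \<open>x0\<close> in the first \<open>k\<close> digits, so it has no fixed points.\<close>
  define c where "c = init (max n k) x0"
  have moved: "(x, x) \<notin> g" if "x \<in> cyl c" for x
  proof
    assume "(x, x) \<in> g"
    moreover have "agree n x0 x" "agree k x0 x" using that agree_mono[of "max n k" x0 x] by (auto simp: c_def)
    ultimately have "agree k y0 x" "agree k x0 x" using n by auto
    then show False using k by (simp add: agree_def)
  qed
  define T where "T v = {x. x \<in> cyl c \<longrightarrow> (\<forall>y. (x, y) \<in> g \<longrightarrow> (x, y) \<notin> v)}" for v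
  have T: "comeager (T v)" if v: "v \<in> gen F" for v
    unfolding T_def
  proof (rule comeager_disagreement[OF _ gc])
    show "rel_continuous v" using partial_homeo_gen[OF F(1) v] unfolding partial_homeo_def by blast
    fix a assume "cyl a \<subseteq> cyl c"
    then have "\<forall>x\<in>cyl a. (x, x) \<notin> g" using moved by blast
    then show "\<exists>x y y'. x \<in> cyl a \<and> (x, y) \<in> g \<and> (x, y') \<in> v \<and> y \<noteq> y'" using contra v by blast
  qed
  define pre where "pre S = {x. \<exists>y\<in>S. (x, y) \<in> g}" for S
  define I where "I = {Domain g} \<union> (\<lambda>p. - {p}) ` orbit F P \<union> (\<lambda>w. pre (Domain w)) ` gen F \<union>
    (\<lambda>(w, n). pre {y. (y, n) \<notin> w}) ` (gen F \<times> N) \<union> T ` gen F"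
  have sI: "small I"
    unfolding I_def
    by (intro small_Un small_image small_Times small_gen small_orbit F P N small_countable) simp
  have cI: "comeager S" if S: "S \<in> I" for S
  proof -
    consider "S = Domain g" | p where "S = - {p}" | w where "w \<in> gen F" "S = pre (Domain w)"
      | w n where "w \<in> gen F" "S = pre {y. (y, n) \<notin> w}" | v where "v \<in> gen F" "S = T v"
      using S unfolding I_def by auto
    then show ?thesis
    proof cases
      case (3 w)
      then show ?thesis
        using comeager_vimage[OF g] partial_homeo_gen[OF F(1) 3(1)] unfolding pre_def partial_homeo_def by simp
    next
      case (4 w n)
      have "- {THE y. (y, n) \<in> w} \<subseteq> {y. (y, n) \<notin> w}"
        using partial_homeo_unique(2)[OF partial_homeo_gen[OF F(1) 4(1)]] by (auto intro!: the_equality[symmetric])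
      then have "comeager {y. (y, n) \<notin> w}" using comeager_mono[OF comeager_Compl_point] by blast
      from comeager_vimage[OF g this] show ?thesis unfolding 4(2) pre_def .
    qed (use gD comeager_Compl_point T in auto)
  qed
  have "\<exists>x\<in>cyl c. \<forall>S\<in>I. x \<in> S" by (rule MA_comeager[OF MA sI cI])
  then obtain x where x: "x \<in> cyl c" "\<And>S. S \<in> I \<Longrightarrow> x \<in> S" by blast
  have "x \<in> Domain g" by (rule x(2)) (simp add: I_def)
  then obtain y where xy: "(x, y) \<in> g" by blast
  have pre: "y \<in> S" if S: "pre S \<in> I" for S
  proof -
    obtain y' where "y' \<in> S" "(x, y') \<in> g" using x(2)[OF S] unfolding pre_def by blast
    then show ?thesis using partial_homeo_unique(1)[OF g xy] by simp
  qed
  have "x \<notin> orbit F P"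
  proof
    assume "x \<in> orbit F P"
    then have "- {x} \<in> I" unfolding I_def by blast
    then show False using x(2) by blast
  qed
  moreover have "regular F y"
    unfolding regular_def by (intro ballI pre) (simp add: I_def)
  moreover have "orbit F {y} \<inter> insert x N = {}"
    unfolding orbit_disjoint_iff
  proof (intro ballI)
    fix p w n assume p: "p \<in> {y}" and w: "w \<in> gen F" and n: "n \<in> insert x N"
    show "(p, n) \<notin> w"
    proof (cases "n = x")
      case True
      have "T (w\<inverse>) \<in> I" unfolding I_def using gen_converse[OF w] by blast
      then have "x \<in> T (w\<inverse>)" by (rule x(2))
      then show ?thesis using x(1) xy p True unfolding T_def by auto
    next
      case False
      then have "pre {y. (y, n) \<notin> w} \<in> I" using w n unfolding I_def by force
      then show ?thesis using pre p by blast
    qed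
  qed
  ultimately have "suitable F P N x y" unfolding suitable_def by blast
  then show False using no[OF xy] by blast
qed

section \<open>Translation to topology\<close>

lemma subtopology_cantor_space: "subtopology cantor_space X = top_of_set X"
  by (simp add: cantor_space_euclidean)

lemma continuous_on_iff_agree:
  fixes h :: "point \<Rightarrow> point"
  shows "continuous_on X h \<longleftrightarrow> (\<forall>x\<in>X. \<forall>k. \<exists>n. \<forall>x'\<in>X. agree n x x' \<longrightarrow> agree k (h x) (h x'))"
proof
  assume c: "continuous_on X h"
  show "\<forall>x\<in>X. \<forall>k. \<exists>n. \<forall>x'\<in>X. agree n x x' \<longrightarrow> agree k (h x) (h x')"
  proof (intro ballI allI)
    fix x k assume x: "x \<in> X"
    obtain A where A: "open A" "x \<in> A" "\<And>y. y \<in> X \<Longrightarrow> y \<in> A \<Longrightarrow> h y \<in> cyl (init k (h x))"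
      using c[unfolded continuous_on_topological, rule_format, OF x open_cyl, of "init k (h x)"] by auto
    then show "\<exists>n. \<forall>x'\<in>X. agree n x x' \<longrightarrow> agree k (h x) (h x')"
      unfolding open_iff_agree in_cyl_init by blast
  qed
next
  assume h: "\<forall>x\<in>X. \<forall>k. \<exists>n. \<forall>x'\<in>X. agree n x x' \<longrightarrow> agree k (h x) (h x')"
  show "continuous_on X h"
    unfolding continuous_on_topological
  proof (intro ballI allI impI)
    fix x B assume x: "x \<in> X" and B: "open B" "h x \<in> B"
    obtain k where k: "\<And>y. agree k (h x) y \<Longrightarrow> y \<in> B" using B unfolding open_iff_agree by blast
    obtain n where n: "\<And>x'. x' \<in> X \<Longrightarrow> agree n x x' \<Longrightarrow> agree k (h x) (h x')" using h x by metis
    show "\<exists>A. open A \<and> x \<in> A \<and> (\<forall>y\<in>X. y \<in> A \<longrightarrow> h y \<in> B)"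
      by (intro exI[of _ "cyl (init n x)"]) (use k n open_cyl in auto)
  qed
qed

lemma dense_set_if_dense_in_subspace:
  assumes A: "dense_in_space (top_of_set X) A" and X: "dense_set X" shows "dense_set A"
  unfolding dense_set_def
proof
  fix a
  obtain x where x: "x \<in> X" "x \<in> cyl a" using X unfolding dense_set_def by blast
  then have "x \<in> top_of_set X closure_of A" using A unfolding dense_in_space_def by simp
  moreover have "openin (top_of_set X) (X \<inter> cyl a)" using open_cyl by (auto simp: openin_open)
  ultimately show "\<exists>x\<in>A. x \<in> cyl a" using x unfolding in_closure_of by blast
qed

lemma closure_of_dense_set:
  assumes D: "dense_set D" "D \<subseteq> X" shows "top_of_set X closure_of D = X"
proof (intro subset_antisym subsetI)
  fix x assume x: "x \<in> X"
  show "x \<in> top_of_set X closure_of D"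
    unfolding in_closure_of
  proof (intro conjI allI impI)
    fix T assume "x \<in> T \<and> openin (top_of_set X) T"
    then obtain U where U: "open U" "x \<in> U" "T = X \<inter> U" by (auto simp: openin_open)
    then obtain y where "y \<in> D" "y \<in> U" using dense_set_open[OF D(1) U(1)] by blast
    then show "\<exists>y. y \<in> D \<and> y \<in> T" using D(2) U(3) by blast
  qed (use x in simp)
qed (simp add: in_closure_of)

lemma homeomorphic_map_of_rel:
  assumes f: "partial_homeo f" and X: "X \<subseteq> Domain f" "X \<subseteq> Range f"
    and inv: "\<And>x y. (x, y) \<in> f \<Longrightarrow> x \<in> X \<longleftrightarrow> y \<in> X"
  shows "\<exists>h. homeomorphic_map (top_of_set X) (top_of_set X) h \<and> (\<forall>x\<in>X. (x, h x) \<in> f)"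
proof -
  have "\<forall>x\<in>X. \<exists>y. (x, y) \<in> f" "\<forall>y\<in>X. \<exists>x. (x, y) \<in> f" using X by blast+
  then obtain h k where h: "\<And>x. x \<in> X \<Longrightarrow> (x, h x) \<in> f" and k: "\<And>y. y \<in> X \<Longrightarrow> (k y, y) \<in> f" by metis
  have hX: "h x \<in> X" "k x \<in> X" if "x \<in> X" for x using inv h k that by blast+
  have "continuous_on X h" "continuous_on X k"
    unfolding continuous_on_iff_agree
    using f h k unfolding partial_homeo_def rel_continuous_def converse_iff by metis+
  moreover have "k (h x) = x" "h (k x) = x" if "x \<in> X" for x
    using partial_homeo_unique[OF f] h k hX that by metis+
  ultimately have "homeomorphic_maps (top_of_set X) (top_of_set X) h k"
    using hX unfolding homeomorphic_maps_def by (auto simp: continuous_map_subtopology_eu)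
  then show ?thesis using h homeomorphic_map_maps by blast
qed

text \<open>A set of numbers codes doubly indexed points; every such array has a code.\<close>

definition coded_point :: "nat \<Rightarrow> nat set \<Rightarrow> nat \<Rightarrow> point"
  where "coded_point j \<alpha> n = (\<lambda>m. prod_encode (j, prod_encode (n, m)) \<in> \<alpha>)"

lemma coded_point_surj: "\<exists>\<alpha>. \<forall>j n. coded_point j \<alpha> n = p j n"
proof
  define \<alpha> where "\<alpha> = {prod_encode (j, prod_encode (n, m)) |j n m. p j n m}"
  show "\<forall>j n. coded_point j \<alpha> n = p j n"
    unfolding coded_point_def \<alpha>_def by (auto simp: prod_encode_eq)
qed

lemma partial_homeo_of_homeomorphism:
  assumes Y: "dense_set Y" and h: "homeomorphic_map (top_of_set Y) (top_of_set Y) h"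
  shows "\<exists>e :: nat \<Rightarrow> point \<times> point. partial_homeo (closure_map (range e)) \<and>
    (\<forall>x\<in>Y. (x, h x) \<in> closure_map (range e))"
proof -
  obtain k where "homeomorphic_maps (top_of_set Y) (top_of_set Y) h k" using h homeomorphic_map_maps by blast
  then have hk: "continuous_on Y h" "continuous_on Y k" "\<And>x. x \<in> Y \<Longrightarrow> h x \<in> Y" "\<And>x. x \<in> Y \<Longrightarrow> k x \<in> Y"
    "\<And>x. x \<in> Y \<Longrightarrow> k (h x) = x" "\<And>x. x \<in> Y \<Longrightarrow> h (k x) = x"
    unfolding homeomorphic_maps_def by (auto simp: continuous_map_subtopology_eu)
  note cont = hk(1,2)[unfolded continuous_on_iff_agree]
  obtain d where d: "\<And>a. d a \<in> Y" "\<And>a. d a \<in> cyl a" using Y unfolding dense_set_def by metis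
  define e where "e n = (d (from_nat n), h (d (from_nat n)))" for n :: nat
  have E: "range e = {(d a, h (d a)) |a. True}"
  proof -
    have mem: "(d a, h (d a)) \<in> range e" for a
      by (rule range_eqI[of _ _ "to_nat a"]) (simp add: e_def)
    show ?thesis
    proof (intro subset_antisym subsetI)
      show "z \<in> {(d a, h (d a)) |a. True}" if "z \<in> range e" for z using that by (auto simp: e_def)
      show "z \<in> range e" if "z \<in> {(d a, h (d a)) |a. True}" for z using that mem by blast
    qed
  qed
  have in_closure: "(x, h x) \<in> closure_map (range e)" if x: "x \<in> Y" for x
    unfolding closure_map_def mem_Collect_eq split_conv
  proof
    fix l
    obtain n where n: "\<And>x'. x' \<in> Y \<Longrightarrow> agree n x x' \<Longrightarrow> agree l (h x) (h x')" using cont(1) x by metis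
    obtain m where m: "\<And>y. y \<in> Y \<Longrightarrow> agree m (h x) y \<Longrightarrow> agree l (k (h x)) (k y)" using cont(2) hk(3)[OF x] by metis
    have "(agree (max n m) x z \<longrightarrow> agree l (h x) z') \<and> (agree (max n m) (h x) z' \<longrightarrow> agree l x z)"
      if z: "(z, z') \<in> range e" for z z'
    proof -
      obtain a where a: "z = d a" "z' = h (d a)" using z unfolding E by blast
      show ?thesis
        using n[OF d(1)[of a]] m[OF hk(3)[OF d(1)[of a]]] agree_mono[of "max n m"] x hk(5) d(1) unfolding a by auto
    qed
    then show "\<exists>n. \<forall>z z'. (z, z') \<in> range e \<longrightarrow> (agree n x z \<longrightarrow> agree l (h x) z') \<and> (agree n (h x) z' \<longrightarrow> agree l x z)"
      by blast
  qed
  have Dom: "dense_set (Domain (range e))" unfolding dense_set_def E using d by blast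
  have Ran: "dense_set (Range (range e))"
    unfolding dense_set_def
  proof
    fix b
    obtain y where y: "y \<in> Y" "y \<in> cyl b" using Y unfolding dense_set_def by blast
    obtain n where n: "\<And>x'. x' \<in> Y \<Longrightarrow> agree n (k y) x' \<Longrightarrow> agree (length b) (h (k y)) (h x')"
      using cont(1) hk(4)[OF y(1)] by metis
    define a where "a = init n (k y)"
    have "agree n (k y) (d a)" using d(2)[of a] by (simp add: a_def)
    then have "agree (length b) y (h (d a))" using n[OF d(1)] hk(6)[OF y(1)] by simp
    then have "h (d a) \<in> cyl b" using cyl_agree[OF y(2)] by simp
    then show "\<exists>x\<in>Range (range e). x \<in> cyl b" unfolding E by blast
  qed
  have "Y \<subseteq> Domain (closure_map (range e))" using in_closure by blast
  moreover have "Y \<subseteq> Range (closure_map (range e))"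
    using in_closure hk(4,6) by (metis RangeI subsetI)
  ultimately have "partial_homeo (closure_map (range e))"
    using partial_homeo_closure_map[OF Dom Ran] dense_set_mono Y by blast
  then show ?thesis using in_closure by blast
qed

theorem theorem8:
  assumes MA_sigma_centered
  shows "\<exists>X :: (nat \<Rightarrow> bool) set.
    countable_dense_homogeneous (subtopology cantor_space X) \<and>
    dense_in_space cantor_space (topspace cantor_space - X) \<and>
    rigid_space (subtopology cantor_space (topspace cantor_space - X))"
proof -
  note MA = assms
  obtain F0 where F0: "countable F0" "homeos F0" "\<And>x. regular F0 x \<Longrightarrow> dense_set (orbit F0 {x})"
    using ex_base_group[OF MA] by metis
  \<comment> \<open>These points, zero from some place on, make the complement dense.\<close>
  define N0 where "N0 = range (\<lambda>a i. i < length a \<and> a ! i :: bool)"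
  have N0: "countable N0" "dense_set N0"
    unfolding N0_def dense_set_def by (auto simp: cyl_def intro!: exI)
  \<comment> \<open>A code \<open>\<alpha>\<close> lists a map in its rows 0 and 1 and two countable sets in its rows 2 and 3.\<close>
  define g where "g \<alpha> = closure_map (range (\<lambda>n. (coded_point 0 \<alpha> n, coded_point 1 \<alpha> n)))" for \<alpha>
  have c: "countable (range (coded_point j \<alpha>))" for j \<alpha> by simp
  have "\<exists>F P N J. (\<forall>\<alpha>. stage_result (g \<alpha>) (range (coded_point 2 \<alpha>)) (range (coded_point 3 \<alpha>))
      (F0 \<union> F ` J \<alpha>) (\<Union>(P ` J \<alpha>)) (N0 \<union> \<Union>(N ` J \<alpha>)) (F \<alpha>, P \<alpha>, N \<alpha>)) \<and>
    (\<forall>\<alpha>. small (J \<alpha>)) \<and> good (F0 \<union> range F) (\<Union>(range P)) (N0 \<union> \<Union>(range N))"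
    by (rule transfinite_construction[OF MA F0(2,1,3) N0(1) c c])
  then obtain F P N J where con': "\<forall>\<alpha>. stage_result (g \<alpha>) (range (coded_point 2 \<alpha>)) (range (coded_point 3 \<alpha>))
      (F0 \<union> F ` J \<alpha>) (\<Union>(P ` J \<alpha>)) (N0 \<union> \<Union>(N ` J \<alpha>)) (F \<alpha>, P \<alpha>, N \<alpha>)"
    and sJ': "\<forall>\<alpha>. small (J \<alpha>)" and good: "good (F0 \<union> range F) (\<Union>(range P)) (N0 \<union> \<Union>(range N))"
    by (elim exE conjE)
  note con = spec[OF con'] and sJ = spec[OF sJ']
  define FF where "FF = F0 \<union> range F"
  define PP where "PP = \<Union>(range P)"
  define NN where "NN = N0 \<union> \<Union>(range N)"
  define X where "X = orbit FF PP"
  have FF: "homeos FF" and regP: "\<And>p. p \<in> PP \<Longrightarrow> regular FF p" and XN: "X \<inter> NN = {}"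
    using good unfolding good_def FF_def PP_def NN_def X_def by auto
  have regX: "regular FF x" if "x \<in> X" for x
    using regular_orbit[OF FF regP] that unfolding X_def by blast
  have oX: "orbit FF X = X" unfolding X_def by (rule orbit_orbit)
  have PX: "PP \<subseteq> X" unfolding X_def by (rule subset_orbit)
  have before: "F0 \<union> F ` J \<alpha> \<subseteq> FF" "\<Union>(P ` J \<alpha>) \<subseteq> PP" "N0 \<union> \<Union>(N ` J \<alpha>) \<subseteq> NN" "N \<alpha> \<subseteq> NN" "P \<alpha> \<subseteq> PP" for \<alpha>
    unfolding FF_def PP_def NN_def by auto
  have stepD: "countable (P \<alpha>)" "countable (N \<alpha>)" "P \<alpha> \<noteq> {}" for \<alpha>
    using con[of \<alpha>] unfolding stage_result_def by auto
  obtain p where p: "p \<in> PP" using stepD(3) unfolding PP_def by blast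
  define D where "D = orbit F0 {p}"
  have D: "countable D" "dense_set D" "D \<subseteq> X"
  proof -
    show "countable D" unfolding D_def using countable_orbit[OF F0(2,1)] by simp
    have "F0 \<subseteq> FF" by (simp add: FF_def)
    then show "dense_set D" unfolding D_def using F0(3) regular_mono regP[OF p] by blast
    show "D \<subseteq> X" unfolding D_def X_def by (rule orbit_mono) (use p in \<open>auto simp: FF_def\<close>)
  qed
  have dX: "dense_set X" using dense_set_mono D by blast
  have dY: "dense_set (- X)" by (rule dense_set_mono[OF N0(2)]) (use XN in \<open>auto simp: NN_def\<close>)
  have gen_X: "X \<subseteq> Domain w" "(x, y) \<in> w \<Longrightarrow> x \<in> X \<longleftrightarrow> y \<in> X" if w: "w \<in> gen FF" for w x y
  proof -
    show "X \<subseteq> Domain w" using regX w unfolding regular_def by blast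
    show "x \<in> X \<longleftrightarrow> y \<in> X" if "(x, y) \<in> w"
      using orbit_step[OF _ w that] orbit_step[OF _ gen_converse[OF w], of y PP x] that unfolding X_def by auto
  qed
  have cdh: "\<exists>h. homeomorphic_map (top_of_set X) (top_of_set X) h \<and> h ` A = B"
    if A: "countable A" "dense_in_space (top_of_set X) A" and B: "countable B" "dense_in_space (top_of_set X) B" for A B
  proof -
    have AX: "A \<subseteq> X" "B \<subseteq> X" using A B unfolding dense_in_space_def by auto
    have d: "dense_set A" "dense_set B" using dense_set_if_dense_in_subspace dX A B by blast+
    then have ne: "A \<noteq> {}" "B \<noteq> {}" unfolding dense_set_def by auto
    obtain \<alpha> where \<alpha>: "\<forall>j n. coded_point j \<alpha> n = (if j = 2 then from_nat_into A n else from_nat_into B n)"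
      using coded_point_surj[of "\<lambda>j n. if j = 2 then from_nat_into A n else from_nat_into B n"] by blast
    have "coded_point 2 \<alpha> = from_nat_into A" "coded_point 3 \<alpha> = from_nat_into B" by (rule ext, simp add: \<alpha>)+
    then have ran: "range (coded_point 2 \<alpha>) = A" "range (coded_point 3 \<alpha>) = B" using A B ne by simp_all
    have "\<forall>x\<in>A \<union> B. regular (F0 \<union> F ` J \<alpha>) x" using regX AX regular_mono[OF before(1)] by blast
    moreover have "orbit (F0 \<union> F ` J \<alpha>) (A \<union> B) \<inter> (N0 \<union> \<Union>(N ` J \<alpha>) \<union> N \<alpha>) = {}"
    proof -
      have "orbit (F0 \<union> F ` J \<alpha>) (A \<union> B) \<subseteq> X"
        using orbit_mono[OF before(1), of "A \<union> B" X] AX oX by auto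
      then show ?thesis using XN before(3,4) by blast
    qed
    ultimately have f: "\<forall>x y. (x, y) \<in> F \<alpha> \<longrightarrow> (x \<in> A \<longleftrightarrow> y \<in> B)"
      using con[of \<alpha>] d unfolding stage_result_def ran by simp
    have FG: "F \<alpha> \<in> gen FF" "(F \<alpha>)\<inverse> \<in> gen FF" using gen_base[of "F \<alpha>" FF] by (simp_all add: FF_def)
    have "X \<subseteq> Range (F \<alpha>)" using gen_X(1)[OF FG(2)] by simp
    then obtain h where h: "homeomorphic_map (top_of_set X) (top_of_set X) h" "\<forall>x\<in>X. (x, h x) \<in> F \<alpha>"
      using homeomorphic_map_of_rel[OF partial_homeo_gen[OF FF FG(1)] gen_X(1)[OF FG(1)] _ gen_X(2)[OF FG(1)]] by blast
    have "h ` A = B"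
    proof (intro subset_antisym subsetI)
      fix y assume "y \<in> h ` A"
      then show "y \<in> B" using h(2) f AX by blast
    next
      fix y assume y: "y \<in> B"
      then obtain x where x: "(x, y) \<in> F \<alpha>" using \<open>X \<subseteq> Range (F \<alpha>)\<close> AX by blast
      then have "x \<in> A" using f y by blast
      moreover from this have "(x, h x) \<in> F \<alpha>" using h(2) AX by blast
      then have "h x = y" using partial_homeo_unique(1)[OF partial_homeo_gen[OF FF FG(1)] x] by simp
      ultimately show "y \<in> h ` A" by blast
    qed
    then show ?thesis using h(1) by blast
  qed
  have rigid: "h x0 = x0" if h: "homeomorphic_map (top_of_set (- X)) (top_of_set (- X)) h" and x0: "x0 \<in> - X" for h x0
  proof (rule ccontr)
    assume moves: "h x0 \<noteq> x0"
    obtain e :: "nat \<Rightarrow> point \<times> point" where e: "partial_homeo (closure_map (range e))"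
      "\<forall>x\<in>- X. (x, h x) \<in> closure_map (range e)"
      using partial_homeo_of_homeomorphism[OF dY h] by blast
    obtain \<alpha> where \<alpha>: "\<forall>j n. coded_point j \<alpha> n = (if j = 0 then fst (e n) else snd (e n))"
      using coded_point_surj[of "\<lambda>j n. if j = 0 then fst (e n) else snd (e n)"] by blast
    have ge: "g \<alpha> = closure_map (range e)" unfolding g_def by (simp add: \<alpha>)
    have gph: "partial_homeo (g \<alpha>)" and gh: "\<And>x. x \<in> - X \<Longrightarrow> (x, h x) \<in> g \<alpha>" using e ge by auto
    have hX: "h x \<in> - X" if "x \<in> - X" for x
      using homeomorphic_imp_surjective_map[OF h] that by auto
    define F1 where "F1 = F0 \<union> F ` J \<alpha>"
    define P1 where "P1 = \<Union>(P ` J \<alpha>)"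
    define N1 where "N1 = N0 \<union> \<Union>(N ` J \<alpha>)"
    have F1: "homeos F1" using FF gen_mono[OF before(1)[of \<alpha>]] before(1)[of \<alpha>] unfolding homeos_def F1_def by blast
    have no: "\<not> suitable F1 P1 N1 x y" if xy: "(x, y) \<in> g \<alpha>" for x y
    proof
      assume "suitable F1 P1 N1 x y"
      then obtain x' y' where x': "(x', y') \<in> g \<alpha>" "x' \<in> N \<alpha>" "y' \<in> P \<alpha>"
        using con[of \<alpha>] xy unfolding stage_result_def F1_def P1_def N1_def by auto
      then have "x' \<in> - X" "y' \<in> X" using XN PX before(4,5) by blast+
      then have "h x' = y'" using partial_homeo_unique(1)[OF gph gh x'(1)] by blast
      then show False using hX \<open>x' \<in> - X\<close> \<open>y' \<in> X\<close> by blast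
    qed
    have sF: "small F1" unfolding F1_def by (intro small_Un small_image sJ small_countable F0)
    have sP: "small P1" unfolding P1_def by (rule small_countable_union[OF sJ stepD(1)])
    have sN: "small N1" unfolding N1_def by (intro small_Un small_countable_union[OF sJ] stepD(2) small_countable N0(1))
    obtain v a where v: "v \<in> gen F1" and eq: "\<forall>x y y'. x \<in> cyl a \<longrightarrow> (x, y) \<in> g \<alpha> \<longrightarrow> (x, y') \<in> v \<longrightarrow> y = y'"
      and fix_free: "\<forall>x\<in>cyl a. (x, x) \<notin> g \<alpha>"
      using agrees_with_word_if_no_suitable[OF MA F1 sF sP sN gph gh[OF x0] moves[symmetric] no] by metis
    have vFF: "v \<in> gen FF" using v gen_mono[OF before(1)] unfolding F1_def by blast
    have vph: "partial_homeo v" by (rule partial_homeo_gen[OF FF vFF])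
    have "unif_cont_on v a"
    proof (rule unif_cont_on_if_agrees[OF vph gph])
      show "x \<in> Domain v \<union> Domain (g \<alpha>)" for x using gen_X(1)[OF vFF] gh by blast
    qed (use eq in blast)
    moreover have "erratic v" using FF vFF unfolding homeos_def by simp
    ultimately have Id: "v \<subseteq> Id" unfolding erratic_def by metis
    have "dense_set (Domain v \<inter> Domain (g \<alpha>))"
      using vph gph comeager_Int comeager_dense unfolding partial_homeo_def by blast
    then obtain x y y' where x: "x \<in> cyl a" "(x, y) \<in> g \<alpha>" "(x, y') \<in> v" unfolding dense_set_def by blast
    then have "(x, x) \<in> g \<alpha>" using Id eq by blast
    then show False using fix_free x(1) by blast
  qed
  have "metrizable_space cantor_space"
    unfolding cantor_space_def metrizable_space_product_topology by simp
  then have "metrizable_space (top_of_set X)"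
    using metrizable_space_subtopology unfolding cantor_space_euclidean by blast
  moreover have "separable_space (top_of_set X)"
    unfolding separable_space_def using D closure_of_dense_set[OF D(2,3)] by auto
  ultimately have "countable_dense_homogeneous (subtopology cantor_space X)"
    unfolding countable_dense_homogeneous_def subtopology_cantor_space using cdh by blast
  moreover have "dense_in_space cantor_space (- X)"
    unfolding dense_in_space_def using closure_of_dense_set[OF dY, of UNIV] by (simp add: cantor_space_euclidean)
  moreover have "rigid_space (subtopology cantor_space (- X))"
    unfolding rigid_space_def subtopology_cantor_space using rigid by simp
  ultimately show ?thesis
    by (intro exI[of _ X]) (simp add: Compl_eq_Diff_UNIV)
qed

end
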